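(* Let $0<q_0,q_1<\infty$ with $q_0\neq q_1$, let $0<q,p,r<\infty$, $0<\theta<1$, $b_j\in SV_{0,q_j}$ for $j=0,1$, and $b,w\in SV$. For $t>0$ put $$\rho(t)=\frac{\|u^{-1/q_0}b_0(u)\|_{q_0,(t,\infty)}}{\|u^{-1/q_1}b_1(u)\|_{q_1,(t,\infty)}},\qquad \rho_\epsilon(t)=\frac{\|u^{-1/q_0}b_0(u)\|_{q_0,(t,\infty)}^{1+\epsilon}}{\|u^{-1/q_1}b_1(u)\|_{q_1,(t,\infty)}}\quad(\epsilon>0).$$ Assume that $\rho_\epsilon$ is equivalent to a non-decreasing function for some $\epsilon>0$, and that $\rho$ is increasing with $\lim_{t\to0^+}\rho(t)=0$ and $\lim_{t\to\infty}\rho(t)=\infty$. Then $$\left(\Gamma(r,q_0,p;b_0,w),\Gamma(r,q_1,p;b_1,w)\right)_{\theta,q;b}=\Gamma(r,q,p;\tilde b,w)$$ (with equivalence of quasi-norms), where $$\tilde b(t)=[\rho(t)]^{1-\theta}\,b(\rho(t))\,[b_1(t)]^{q_1/q}\left(\int_t^\infty b_1^{q_1}(u)\frac{du}{u}\right)^{1/q_1-1/q}.$$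
   Context: Notation: $\|\cdot\|_{q,(a,b)}$ is the $L^q$-quasi-norm on $(a,b)$ with respect to Lebesgue measure ($1/q=0$ if $q=\infty$). $A\lesssim B$ means $A\le cB$ with a positive constant $c$ independent of the appropriate parameters; $A\approx B$ means $A\lesssim B$ and $B\lesssim A$. A positive function $g$ on $(0,\infty)$ is equivalent to a function $h$ if $g(t)\approx h(t)$ for all $t>0$. Slowly varying functions: a Lebesgue measurable $b:(0,\infty)\to(0,\infty)$ is slowly varying, $b\in SV$, if for every $\varepsilon>0$ there are positive functions $g_\varepsilon$ (non-decreasing) and $g_{-\varepsilon}$ (non-increasing) on $(0,\infty)$ with $t^{\varepsilon}b(t)\approx g_\varepsilon(t)$ and $t^{-\varepsilon}b(t)\approx g_{-\varepsilon}(t)$ for all $t>0$. For $0<q\le\infty$, $b\in SV_{0,q}$ means $b\in SV$ and $\|u^{-1/q}b(u)\|_{q,(1,\infty)}<\infty$. Interpolation: for a compatible couple $(A_0,A_1)$ of quasi-normed spaces, $f\in A_0+A_1$, $t>0$, $K(t,f;A_0,A_1)=\inf\{\|f_0\|_{A_0}+t\|f_1\|_{A_1}: f_0\in A_0,\ f_1\in A_1,\ f=f_0+f_1\}$, and for $0<q\le\infty$, $0\le\theta\le1$, $b\in SV$, $(A_0,A_1)_{\theta,q;b}$ is the space of $f\in A_0+A_1$ with $\|t^{-\theta-1/q}b(t)K(t,f;A_0,A_1)\|_{q,(0,\infty)}<\infty$, equipped with this quasi-norm. Generalized gamma spaces: let $(\Omega,\mu)$ be a $\sigma$-finite measure space and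 let $f^\ast$ denote the non-increasing rearrangement of a measurable function $f$ on $\Omega$. For $0<q,r\le\infty$, $0<p<\infty$, $b\in SV_{0,q}$ and $w\in SV$, $\Gamma(r,q,p;b,w)=\Gamma(r,q,p;b,w)(\Omega)$ consists of all real-valued measurable functions $f$ on $\Omega$ for which the quasi-norm $$\|f\|_{\Gamma(r,q,p;b,w)}=\left\|t^{-1/q}b(t)\,\|\tau^{1/p-1/r}w(\tau)f^\ast(\tau)\|_{r,(0,t)}\right\|_{q,(0,\infty)}$$ is finite. *)

theory Defs
  imports "HOL-Analysis.Analysis" "HOL-Library.Function_Algebras"
begin

section \<open>Quasi-norms of Lebesgue type (finite exponents)\<close>

text \<open>Power of an extended nonnegative number with a positive real exponent.\<close>

definition epowr :: "ennreal \<Rightarrow> real \<Rightarrow> ennreal" where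
  "epowr x a = (if x = \<infinity> then \<infinity> else ennreal (enn2real x powr a))"

text \<open>The functions are nonnegative and extended-valued, since a rearrangement or a K-functional
  may be infinite.  Only exponents \<open>0 < q < \<infinity>\<close> are covered.\<close>

definition Lq_norm :: "real \<Rightarrow> real set \<Rightarrow> (real \<Rightarrow> ennreal) \<Rightarrow> ennreal" where
  "Lq_norm q S g = epowr (\<integral>\<^sup>+x\<in>S. epowr (g x) q \<partial>lebesgue) (1 / q)"

section \<open>Slowly varying functions\<close>

definition equivalent_pos :: "(real \<Rightarrow> real) \<Rightarrow> (real \<Rightarrow> real) \<Rightarrow> bool" where
  "equivalent_pos g h \<longleftrightarrow> (\<exists>c>0. \<exists>C>0. \<forall>t>0. c * h t \<le> g t \<and> g t \<le> C * h t)"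

definition slowly_varying :: "(real \<Rightarrow> real) \<Rightarrow> bool" where
  "slowly_varying b \<longleftrightarrow>
     b \<in> borel_measurable (lebesgue_on {0<..}) \<and> (\<forall>t>0. b t > 0) \<and>
     (\<forall>\<epsilon>>0.
        (\<exists>g. (\<forall>t>0. g t > 0) \<and> mono_on {0<..} g \<and> equivalent_pos (\<lambda>t. t powr \<epsilon> * b t) g) \<and>
        (\<exists>g. (\<forall>t>0. g t > 0) \<and> antimono_on {0<..} g \<and> equivalent_pos (\<lambda>t. t powr (-\<epsilon>) * b t) g))"

text \<open>\<open>\<parallel>u\<^sup>-\<^sup>1\<^sup>/\<^sup>q b(u)\<parallel>\<close> in \<open>L\<^sup>q(t, \<infinity>)\<close>.\<close>

definition tail_norm :: "real \<Rightarrow> (real \<Rightarrow> real) \<Rightarrow> real \<Rightarrow> ennreal" where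
  "tail_norm q b t = Lq_norm q {t<..} (\<lambda>u. ennreal (u powr (- 1 / q) * b u))"

definition SV0 :: "real \<Rightarrow> (real \<Rightarrow> real) \<Rightarrow> bool" where
  "SV0 q b \<longleftrightarrow> slowly_varying b \<and> tail_norm q b 1 < \<infinity>"

section \<open>Real interpolation\<close>

text \<open>A quasi-normed space inside an ambient vector space, which plays the role of the space in
  which both members of a couple are embedded.  For function spaces the elements are functions
  rather than classes modulo null sets; all quasi-norms below depend only on the class.\<close>

record 'v qn_space =
  points :: "'v set"
  qnorm :: "'v \<Rightarrow> ennreal"

definition sum_space :: "'v::ab_group_add qn_space \<Rightarrow> 'v qn_space \<Rightarrow> 'v set" where
  "sum_space A0 A1 = {f0 + f1 | f0 f1. f0 \<in> points A0 \<and> f1 \<in> points A1}"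

definition K_functional ::
    "'v::ab_group_add qn_space \<Rightarrow> 'v qn_space \<Rightarrow> real \<Rightarrow> 'v \<Rightarrow> ennreal" where
  "K_functional A0 A1 t f =
     Inf {qnorm A0 f0 + ennreal t * qnorm A1 f1 | f0 f1.
            f0 \<in> points A0 \<and> f1 \<in> points A1 \<and> f = f0 + f1}"

definition interp_norm ::
    "'v::ab_group_add qn_space \<Rightarrow> 'v qn_space \<Rightarrow> real \<Rightarrow> real \<Rightarrow> (real \<Rightarrow> real) \<Rightarrow> 'v \<Rightarrow> ennreal" where
  "interp_norm A0 A1 \<theta> q b f =
     Lq_norm q {0<..} (\<lambda>t. ennreal (t powr (- \<theta> - 1 / q) * b t) * K_functional A0 A1 t f)"

definition interp_space ::
    "'v::ab_group_add qn_space \<Rightarrow> 'v qn_space \<Rightarrow> real \<Rightarrow> real \<Rightarrow> (real \<Rightarrow> real) \<Rightarrow> 'v qn_space" where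
  "interp_space A0 A1 \<theta> q b =
     \<lparr>points = {f \<in> sum_space A0 A1. interp_norm A0 A1 \<theta> q b f < \<infinity>},
      qnorm = interp_norm A0 A1 \<theta> q b\<rparr>"

text \<open>Equality of spaces with equivalence of quasi-norms.\<close>

definition same_space :: "'v qn_space \<Rightarrow> 'v qn_space \<Rightarrow> bool" where
  "same_space A B \<longleftrightarrow> points A = points B \<and>
     (\<exists>c>0. \<exists>C>0. \<forall>f\<in>points A.
        ennreal c * qnorm B f \<le> qnorm A f \<and> qnorm A f \<le> ennreal C * qnorm B f)"

section \<open>Generalized gamma spaces\<close>

definition rearrangement :: "'a measure \<Rightarrow> ('a \<Rightarrow> real) \<Rightarrow> real \<Rightarrow> ennreal" where
  "rearrangement M f t =
     Inf {ennreal s | s. s \<ge> 0 \<and> emeasure M {x \<in> space M. \<bar>f x\<bar> > s} \<le> ennreal t}"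

definition Gamma_norm ::
    "'a measure \<Rightarrow> real \<Rightarrow> real \<Rightarrow> real \<Rightarrow> (real \<Rightarrow> real) \<Rightarrow> (real \<Rightarrow> real) \<Rightarrow> ('a \<Rightarrow> real) \<Rightarrow> ennreal" where
  "Gamma_norm M r q p b w f =
     Lq_norm q {0<..} (\<lambda>t. ennreal (t powr (- 1 / q) * b t) *
       Lq_norm r {0<..<t} (\<lambda>\<tau>. ennreal (\<tau> powr (1 / p - 1 / r) * w \<tau>) * rearrangement M f \<tau>))"

text \<open>The conditions \<open>b \<in> SV\<^sub>0\<^sub>,\<^sub>q\<close> and \<open>w \<in> SV\<close> are not part of the definition.\<close>

definition Gamma_space ::
    "'a measure \<Rightarrow> real \<Rightarrow> real \<Rightarrow> real \<Rightarrow> (real \<Rightarrow> real) \<Rightarrow> (real \<Rightarrow> real) \<Rightarrow> ('a \<Rightarrow> real) qn_space" where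
  "Gamma_space M r q p b w =
     \<lparr>points = {f \<in> borel_measurable M. Gamma_norm M r q p b w f < \<infinity>},
      qnorm = Gamma_norm M r q p b w\<rparr>"

section \<open>The functions governing the reiteration\<close>

text \<open>\<open>\<rho>\<close> is the case \<open>\<epsilon> = 0\<close> of \<open>\<rho>\<^sub>\<epsilon>\<close>.  For \<open>b\<^sub>j\<close> in \<open>SV\<^sub>0\<^sub>,\<^sub>q\<^sub>j\<close> the tail norms are finite and
  positive at every \<open>t > 0\<close>, so that the conversion to reals is harmless; the same applies to
  the integral in \<open>b_tilde\<close>, which converges.\<close>

definition rho ::
    "real \<Rightarrow> real \<Rightarrow> (real \<Rightarrow> real) \<Rightarrow> (real \<Rightarrow> real) \<Rightarrow> real \<Rightarrow> real" where
  "rho q0 q1 b0 b1 t = enn2real (tail_norm q0 b0 t) / enn2real (tail_norm q1 b1 t)"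

definition rho_eps ::
    "real \<Rightarrow> real \<Rightarrow> real \<Rightarrow> (real \<Rightarrow> real) \<Rightarrow> (real \<Rightarrow> real) \<Rightarrow> real \<Rightarrow> real" where
  "rho_eps \<epsilon> q0 q1 b0 b1 t =
     enn2real (tail_norm q0 b0 t) powr (1 + \<epsilon>) / enn2real (tail_norm q1 b1 t)"

definition b_tilde ::
    "real \<Rightarrow> real \<Rightarrow> real \<Rightarrow> real \<Rightarrow> (real \<Rightarrow> real) \<Rightarrow> (real \<Rightarrow> real) \<Rightarrow> (real \<Rightarrow> real) \<Rightarrow> real \<Rightarrow> real" where
  "b_tilde q0 q1 q \<theta> b0 b1 b t =
     rho q0 q1 b0 b1 t powr (1 - \<theta>) * b (rho q0 q1 b0 b1 t) * b1 t powr (q1 / q) *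
     (LINT u:{t<..}|lebesgue. b1 u powr q1 / u) powr (1 / q1 - 1 / q)"

end

theory Submission
  imports Defs
begin

text \<open>
  Write \<open>F f t\<close> for the inner norm of \<open>\<tau>\<^bsup>1/p - 1/r\<^esup> w f\<^sup>*\<close> over \<open>(0, t)\<close>, which is non-decreasing in \<open>t\<close>,
  and \<open>a\<^sub>j(t)\<close> for the tail norm of \<open>b\<^sub>j\<close>, so that \<open>\<rho> = a\<^sub>0 / a\<^sub>1\<close>.  The gamma quasi-norms are weighted
  norms of \<open>F f\<close>, and both sides of the theorem turn out to be equivalent to weighted \<open>\<ell>\<^sup>q\<close> sums over
  the integers, sampled at the points \<open>T k\<close> with \<open>\<rho> (T k) = 2\<^sup>k\<close>.  They exist because \<open>\<rho>\<close> is continuous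
  and increases from \<open>0\<close> to \<open>\<infinity>\<close>.

  The interpolation quasi-norm is equivalent to the sum of \<open>(u\<^sub>k K(2\<^sup>k, f))\<^sup>q\<close> with
  \<open>u\<^sub>k = 2\<^bsup>- \<theta> k\<^esup> b(2\<^sup>k)\<close>, since the K-functional is monotone and \<open>b\<close> slowly varying.  The gamma
  quasi-norm with \<open>b_tilde\<close> is equivalent to the sum of \<open>(u\<^sub>k G\<^sub>k)\<^sup>q\<close> with \<open>G\<^sub>k = a\<^sub>0(T k) F f (T k)\<close>: on
  \<open>(T k, T (k + 1)]\<close> everything in \<open>b_tilde\<close> but the factor \<open>b\<^sub>1\<^bsup>q\<^sub>1/q\<^esup>\<close> is constant up to bounded
  factors, and that factor integrates to a fixed portion of the tail.  Here \<open>a\<^sub>1\<close> drops by at least the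
  factor two in each step because \<open>a\<^sub>0\<close> decreases (\<open>a1_T_halves\<close>), and by at most a constant because
  \<open>\<rho>\<^sub>\<epsilon>\<close> is equivalent to a non-decreasing function (\<open>a1_T_doubling\<close>).

  It remains to compare \<open>K(2\<^sup>k, f)\<close> with \<open>G\<^sub>k\<close>.  The bound \<open>G\<^sub>k \<lesssim> K(2\<^sup>k, f)\<close> holds for each \<open>k\<close>
  (\<open>K_lower\<close>): \<open>F\<close> is quasi-additive in \<open>f\<close>, and \<open>a\<^sub>j(t) F g t\<close> is at most the \<open>j\<close>-th quasi-norm of \<open>g\<close>.
  In the other direction, cutting \<open>f\<close> at the height \<open>f\<^sup>*(T k)\<close> bounds \<open>K(2\<^sup>k, f)\<close> by the first
  quasi-norm over \<open>(0, T k)\<close> plus \<open>2\<^sup>k\<close> times the second one over \<open>(T k, \<infinity>)\<close> (\<open>K_upper\<close>).  Split along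
  the points \<open>T j\<close>, these are power sums of \<open>G\<^sub>j\<close> over \<open>j \<le> k\<close> and of \<open>2\<^bsup>k - j\<^esup> G\<^sub>j\<close> over \<open>j \<ge> k\<close>.  Because
  \<open>0 < \<theta> < 1\<close>, the factor \<open>u\<^sub>k\<close> makes both of them geometrically weighted, and a discrete Hardy
  inequality for arbitrary positive exponents (\<open>discrete_hardy\<close>) bounds their \<open>\<ell>\<^sup>q\<close> norms in \<open>k\<close> by
  that of \<open>u\<^sub>k G\<^sub>k\<close>.
\<close>

section \<open>Powers of extended nonnegative numbers\<close>

lemma epowr_ennreal: "0 \<le> x \<Longrightarrow> epowr (ennreal x) a = ennreal (x powr a)"
  by (simp add: epowr_def)

lemma epowr_top [simp]: "epowr top a = top"
  by (simp add: epowr_def)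

lemma epowr_zero [simp]: "epowr 0 a = 0"
  by (simp add: epowr_def)

lemma epowr_one_exponent [simp]: "epowr x 1 = x"
  by (cases x rule: ennreal_cases) (auto simp: epowr_ennreal)

lemma epowr_eq_top_iff [simp]: "epowr x a = top \<longleftrightarrow> x = top"
  by (cases x rule: ennreal_cases) (auto simp: epowr_ennreal)

lemma epowr_eq_zero_iff [simp]: "epowr x a = 0 \<longleftrightarrow> x = 0"
  by (cases x rule: ennreal_cases) (auto simp: epowr_ennreal)

lemma epowr_mono:
  assumes "x \<le> y" "0 \<le> a"
  shows "epowr x a \<le> epowr y a"
  using assms
  by (cases x rule: ennreal_cases; cases y rule: ennreal_cases)
     (auto simp: epowr_ennreal top_unique intro!: powr_mono2 ennreal_leI)

lemma epowr_mult:
  assumes "0 < a"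
  shows "epowr (x * y) a = epowr x a * epowr y a"
proof -
  consider "x = 0" | "y = 0" | "x = top" "y \<noteq> 0" | "y = top" "x \<noteq> 0"
    | u v where "x = ennreal u" "y = ennreal v" "0 \<le> u" "0 \<le> v"
    by (metis ennreal_cases)
  then show ?thesis
    by cases (auto simp: ennreal_top_mult ennreal_mult_top epowr_ennreal powr_mult
        simp flip: ennreal_mult)
qed

lemma epowr_epowr: "epowr (epowr x a) c = epowr x (a * c)"
  by (cases x rule: ennreal_cases) (auto simp: epowr_ennreal powr_powr)

lemma epowr_inverse_exponent:
  assumes "0 < a"
  shows "epowr (epowr x a) (1 / a) = x" "epowr (epowr x (1 / a)) a = x"
  using assms by (simp_all add: epowr_epowr)

lemma epowr_const_mult:
  assumes "0 \<le> c" "0 < a"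
  shows "epowr (ennreal c * y) a = ennreal (c powr a) * epowr y a"
  using assms by (simp add: epowr_mult epowr_ennreal)

lemma epowr_le_const_mult:
  assumes "x \<le> ennreal c * y" "0 \<le> c" "0 < a"
  shows "epowr x a \<le> ennreal (c powr a) * epowr y a"
  using epowr_mono[OF assms(1), of a] assms(2,3) by (simp add: epowr_const_mult)

lemma epowr_add_le:
  assumes "0 < a"
  shows "epowr (x + y) a \<le> ennreal (2 powr a) * (epowr x a + epowr y a)"
proof -
  have "x + y \<le> ennreal 2 * max x y"
    by (metis add_mono ennreal_numeral max.cobounded1 max.cobounded2 mult_2 zero_le_numeral)
  then have "epowr (x + y) a \<le> ennreal (2 powr a) * epowr (max x y) a"
    using assms by (intro epowr_le_const_mult) auto
  also have "epowr (max x y) a \<le> epowr x a + epowr y a"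
    by (auto simp: max_def)
  finally show ?thesis by (simp add: mult_left_mono)
qed

lemma measurable_epowr [measurable]: "(\<lambda>x. epowr x a) \<in> borel_measurable borel"
  unfolding epowr_def by measurable

section \<open>Sums over the integers and a discrete Hardy inequality\<close>

abbreviation zsum :: "(int \<Rightarrow> ennreal) \<Rightarrow> ennreal" where
  "zsum X \<equiv> \<integral>\<^sup>+k. X k \<partial>count_space UNIV"

lemma zsum_ge_term: "X k \<le> zsum X"
  by (rule nn_integral_ge_point) simp

lemma zsum_mono: "(\<And>k. X k \<le> Y k) \<Longrightarrow> zsum X \<le> zsum Y"
  by (rule nn_integral_mono) simp

lemma zsum_cmult: "zsum (\<lambda>k. c * X k) = c * zsum X"
  by (rule nn_integral_cmult) simp

lemma zsum_multc: "zsum (\<lambda>k. X k * c) = zsum X * c"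
  by (rule nn_integral_multc) simp

lemma zsum_swap: "zsum (\<lambda>k. zsum (\<lambda>j. X k j)) = zsum (\<lambda>j. zsum (\<lambda>k. X k j))"
  by (rule nn_integral_count_space_nn_integral) auto

lemma zsum_shift: "zsum (\<lambda>k. X (k + c)) = zsum X"
  by (rule nn_integral_bij_count_space) (auto intro!: bij_betwI[where g = "\<lambda>k. k - c"])

lemma zsum_geometric_finite:
  assumes "0 < \<beta>"
  shows "zsum (\<lambda>k. ennreal (2 powr (- \<beta> * \<bar>of_int k\<bar>))) < top"
proof -
  let ?f = "\<lambda>k::int. ennreal (2 powr (- \<beta> * \<bar>of_int k\<bar>))"
  define x where "x = (2::real) powr (- \<beta>)"
  have x: "0 < x" "x < 1" using assms by (auto simp: x_def powr_less_one)
  have pw: "2 powr (- (\<beta> * real n)) = x ^ n" for n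
    by (simp add: x_def powr_powr flip: powr_realpow)
  have "(\<Sum>n. ennreal (x ^ n)) = ennreal (\<Sum>n. x ^ n)"
    using x by (intro suminf_ennreal2) (auto intro: summable_geometric)
  then have fin: "(\<integral>\<^sup>+n. ennreal (x ^ n) \<partial>count_space UNIV) < top"
    by (simp add: nn_integral_count_space_nat)
  have p: "(\<integral>\<^sup>+k. ?f k \<partial>count_space (range int)) = (\<integral>\<^sup>+n. ennreal (x ^ n) \<partial>count_space UNIV)"
    by (subst nn_integral_bij_count_space[of int UNIV "range int", symmetric])
       (auto simp: bij_betw_def pw)
  have m: "(\<integral>\<^sup>+k. ?f k \<partial>count_space (range (\<lambda>n. - int n)))
      = (\<integral>\<^sup>+n. ennreal (x ^ n) \<partial>count_space UNIV)"
    by (subst nn_integral_bij_count_space[of "\<lambda>n. - int n" UNIV "range (\<lambda>n. - int n)", symmetric])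
       (auto simp: bij_betw_def pw inj_on_def)
  have U: "k \<in> range int \<or> k \<in> range (\<lambda>n. - int n)" for k :: int
    by (cases k rule: int_cases2) auto
  have "zsum ?f \<le> zsum (\<lambda>k. ?f k * indicator (range int) k + ?f k * indicator (range (\<lambda>n. - int n)) k)"
    using U by (intro zsum_mono) (auto split: split_indicator)
  also have "\<dots> = (\<integral>\<^sup>+k. ?f k \<partial>count_space (range int)) + (\<integral>\<^sup>+k. ?f k \<partial>count_space (range (\<lambda>n. - int n)))"
    by (subst nn_integral_add) (auto simp: nn_integral_count_space_indicator)
  also have "\<dots> < top" unfolding p m using fin by simp
  finally show ?thesis .
qed

text \<open>Convolution with a two-sided geometric sequence is bounded on weighted power sums even when the
  inner exponent \<open>s\<close> differs from \<open>q\<close> and either of them is below one, where convexity is of no use.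
  The geometric factor leaves room to replace an \<open>\<ell>\<^sup>s\<close> sum by a supremum and the supremum by an
  \<open>\<ell>\<^sup>q\<close> sum.\<close>

lemma discrete_hardy:
  fixes s q \<alpha> :: real
  assumes "0 < s" "0 < q" "0 < \<alpha>"
  shows "\<exists>C>0. \<forall>X. zsum (\<lambda>k. epowr (zsum (\<lambda>j. epowr (ennreal (2 powr (- \<alpha> * \<bar>of_int (k - j)\<bar>)) * X j) s)) (q / s))
     \<le> ennreal C * zsum (\<lambda>j. epowr (X j) q)"
proof -
  define g where "g \<beta> k = ennreal (2 powr (- \<beta> * \<bar>of_int k\<bar>))" for \<beta> and k :: int
  have "\<exists>S\<ge>0. zsum (g \<beta>) = ennreal S" if "0 < \<beta>" for \<beta>
    using zsum_geometric_finite[OF that] unfolding g_def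
    by (metis ennreal_cases less_irrefl)
  then obtain S where S: "\<And>\<beta>. 0 < \<beta> \<Longrightarrow> 0 \<le> S \<beta>" "\<And>\<beta>. 0 < \<beta> \<Longrightarrow> zsum (g \<beta>) = ennreal (S \<beta>)"
    by metis
  have g_pow: "epowr (g \<beta> k) a = g (\<beta> * a) k" for \<beta> k a
    by (simp add: g_def epowr_ennreal powr_powr mult_ac)
  have g_mult: "g \<beta> k * g \<beta>' k = g (\<beta> + \<beta>') k" for \<beta> \<beta>' k
    by (simp add: g_def algebra_simps flip: ennreal_mult powr_add)
  have g_rev: "zsum (\<lambda>j. g \<beta> (k - j)) = zsum (g \<beta>)" for \<beta> k
    by (rule nn_integral_bij_count_space) (auto intro!: bij_betwI[where g = "\<lambda>j. k - j"])
  have g_shift: "zsum (\<lambda>k. g \<beta> (k - j)) = zsum (g \<beta>)" for \<beta> j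
    by (rule nn_integral_bij_count_space) (auto intro!: bij_betwI[where g = "\<lambda>k. k + j"])
  let ?A = "S (\<alpha> * s / 2) powr (q / s)" and ?B = "S (\<alpha> * q / 2)"
  have "zsum (\<lambda>k. epowr (zsum (\<lambda>j. epowr (g \<alpha> (k - j) * X j) s)) (q / s))
     \<le> ennreal (?A * ?B) * zsum (\<lambda>j. epowr (X j) q)" for X
  proof -
    define Y where "Y k = zsum (\<lambda>j. epowr (g (\<alpha> / 2) (k - j) * X j) q)" for k
    \<comment> \<open>Half of the decay is spent on summing over \<open>j\<close>; with the other half every term is
       bounded by the sum \<open>Y k\<close> of the \<open>q\<close>-th powers.\<close>
    have entry: "epowr (g \<alpha> (k - j) * X j) s \<le> epowr (Y k) (s / q) * g (\<alpha> * s / 2) (k - j)" for k j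
    proof -
      have "epowr (g (\<alpha> / 2) (k - j) * X j) q \<le> Y k"
        unfolding Y_def by (rule zsum_ge_term)
      from epowr_mono[OF this, of "s / q"]
      have *: "epowr (g (\<alpha> / 2) (k - j) * X j) s \<le> epowr (Y k) (s / q)"
        using assms by (simp add: epowr_epowr)
      have "g \<alpha> (k - j) * X j = g (\<alpha> / 2) (k - j) * (g (\<alpha> / 2) (k - j) * X j)"
        by (simp add: g_mult flip: mult.assoc)
      then have "epowr (g \<alpha> (k - j) * X j) s
          = g (\<alpha> * s / 2) (k - j) * epowr (g (\<alpha> / 2) (k - j) * X j) s"
        using assms by (simp add: epowr_mult g_pow mult_ac)
      also have "\<dots> \<le> g (\<alpha> * s / 2) (k - j) * epowr (Y k) (s / q)"
        by (intro mult_left_mono * zero_le)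
      finally show ?thesis by (simp add: mult.commute)
    qed
    have row: "epowr (zsum (\<lambda>j. epowr (g \<alpha> (k - j) * X j) s)) (q / s) \<le> ennreal ?A * Y k" for k
    proof -
      have "zsum (\<lambda>j. epowr (g \<alpha> (k - j) * X j) s) \<le> ennreal (S (\<alpha> * s / 2)) * epowr (Y k) (s / q)"
        using zsum_mono[of "\<lambda>j. epowr (g \<alpha> (k - j) * X j) s", OF entry] assms
        by (simp add: zsum_cmult g_rev S(2) mult.commute)
      from epowr_le_const_mult[OF this, of "q / s"] show ?thesis
        using assms S(1) by (simp add: epowr_epowr)
    qed
    have "zsum Y = zsum (\<lambda>j. zsum (\<lambda>k. epowr (X j) q * g (\<alpha> * q / 2) (k - j)))"
      using assms unfolding Y_def by (subst zsum_swap) (simp add: epowr_mult g_pow mult_ac)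
    also have "\<dots> = ennreal ?B * zsum (\<lambda>j. epowr (X j) q)"
      using assms by (simp add: zsum_cmult zsum_multc g_shift S(2) mult.commute)
    finally have Y: "zsum Y = ennreal ?B * zsum (\<lambda>j. epowr (X j) q)" .
    have "zsum (\<lambda>k. epowr (zsum (\<lambda>j. epowr (g \<alpha> (k - j) * X j) s)) (q / s)) \<le> ennreal ?A * zsum Y"
      using zsum_mono[of _ "\<lambda>k. ennreal ?A * Y k", OF row] by (simp add: zsum_cmult)
    also have "\<dots> = ennreal (?A * ?B) * zsum (\<lambda>j. epowr (X j) q)"
      using assms S(1)[of "\<alpha> * q / 2"] by (simp add: Y ennreal_mult mult.assoc)
    finally show ?thesis .
  qed
  then have "zsum (\<lambda>k. epowr (zsum (\<lambda>j. epowr (g \<alpha> (k - j) * X j) s)) (q / s))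
     \<le> ennreal (?A * ?B + 1) * zsum (\<lambda>j. epowr (X j) q)" for X
    by (rule order_trans) (auto intro!: mult_right_mono ennreal_leI)
  moreover have "0 < ?A * ?B + 1"
    using assms S(1)[of "\<alpha> * q / 2"] by (intro add_nonneg_pos mult_nonneg_nonneg) auto
  ultimately show ?thesis unfolding g_def by blast
qed

section \<open>Weighted integrals with respect to \<open>dt / t\<close>\<close>

text \<open>Every quasi-norm in the definition of a gamma space, inner or outer, is an \<open>L\<^sup>q\<close>-norm with respect
  to \<open>b(t)\<^sup>q dt / t\<close> for some positive \<open>b\<close>; \<open>wint q b S\<close> is integration against this measure.\<close>

definition weight :: "(real \<Rightarrow> real) \<Rightarrow> bool" where
  "weight b \<longleftrightarrow> b \<in> borel_measurable (lebesgue_on {0<..}) \<and> (\<forall>t>0. b t > 0)"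

definition wint :: "real \<Rightarrow> (real \<Rightarrow> real) \<Rightarrow> real set \<Rightarrow> (real \<Rightarrow> ennreal) \<Rightarrow> ennreal" where
  "wint q b S G = (\<integral>\<^sup>+x\<in>S. ennreal (b x powr q / x) * G x \<partial>lebesgue)"

abbreviation mass :: "real \<Rightarrow> (real \<Rightarrow> real) \<Rightarrow> real set \<Rightarrow> ennreal" where
  "mass q b S \<equiv> wint q b S (\<lambda>_. 1)"

lemma Lq_norm_eq_wint:
  assumes "S \<subseteq> {0<..}" "0 < q" "\<And>x. x \<in> S \<Longrightarrow> 0 \<le> b x"
  shows "Lq_norm q S (\<lambda>x. ennreal (x powr (- 1 / q) * b x) * G x)
    = epowr (wint q b S (\<lambda>x. epowr (G x) q)) (1 / q)"
proof -
  have "epowr (ennreal (x powr (- 1 / q) * b x) * G x) q = ennreal (b x powr q / x) * epowr (G x) q"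
    if "x \<in> S" for x
  proof -
    have "0 < x" "0 \<le> b x" using assms that by auto
    moreover have "(x powr (- 1 / q)) powr q = 1 / x"
      using \<open>0 < x\<close> assms(2) unfolding powr_powr by (simp add: powr_minus_divide)
    ultimately have "(x powr (- 1 / q) * b x) powr q = b x powr q / x"
      by (simp add: powr_mult)
    then show ?thesis
      using \<open>0 \<le> b x\<close> assms(2) by (simp add: epowr_const_mult)
  qed
  then show ?thesis
    unfolding Lq_norm_def wint_def
    by (intro arg_cong2[where f = epowr] nn_integral_cong) (auto split: split_indicator)
qed

lemma tail_norm_eq_mass:
  assumes "0 < q" "0 \<le> t" "weight b"
  shows "tail_norm q b t = epowr (mass q b {t<..}) (1 / q)"
  using Lq_norm_eq_wint[of "{t<..}" q b "\<lambda>_. 1"] assms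
  by (auto simp: tail_norm_def weight_def less_imp_le epowr_def)

lemma measurable_weight:
  assumes "weight b" "S \<in> sets lebesgue" "S \<subseteq> {0<..}"
  shows "(\<lambda>x. ennreal (b x powr q / x) * indicator S x) \<in> borel_measurable lebesgue"
proof -
  have b: "b \<in> borel_measurable (lebesgue_on {0<..})" using assms(1) by (simp add: weight_def)
  have "(\<lambda>x. x) \<in> borel_measurable (lebesgue_on {0<..})"
    using id_borel_measurable_lebesgue_on[of "{0<..}"] by (simp add: id_def)
  with b have "(\<lambda>x. ennreal (b x powr q / x)) \<in> borel_measurable (lebesgue_on {0<..})"
    by measurable
  then have m: "(\<lambda>x. ennreal (b x powr q / x) * indicator {0<..} x) \<in> borel_measurable lebesgue"
    by (subst (asm) borel_measurable_restrict_space_iff_ennreal) auto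
  have "(\<lambda>x. ennreal (b x powr q / x) * indicator S x)
      = (\<lambda>x. ennreal (b x powr q / x) * indicator {0<..} x * indicator S x)"
    using assms(3) by (intro ext) (auto split: split_indicator)
  then show ?thesis using m assms(2) by simp
qed

lemma measurable_weighted:
  assumes "weight b" "S \<in> sets lebesgue" "S \<subseteq> {0<..}" "G \<in> borel_measurable lebesgue"
  shows "(\<lambda>x. ennreal (b x powr q / x) * G x * indicator S x) \<in> borel_measurable lebesgue"
  using borel_measurable_times_ennreal[OF measurable_weight[OF assms(1-3), of q] assms(4)]
  by (simp add: mult_ac)

lemma wint_mono:
  assumes "S \<subseteq> T" "\<And>x. x \<in> S \<Longrightarrow> G x \<le> H x"
  shows "wint q b S G \<le> wint q b T H"
  unfolding wint_def using assms
  by (intro nn_integral_mono) (auto split: split_indicator intro!: mult_left_mono)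

lemma wint_cmult:
  assumes "weight b" "S \<in> sets lebesgue" "S \<subseteq> {0<..}" "G \<in> borel_measurable lebesgue"
  shows "wint q b S (\<lambda>x. c * G x) = c * wint q b S G"
  unfolding wint_def
  by (subst nn_integral_cmult[OF measurable_weighted[OF assms], symmetric]) (simp add: mult_ac)

lemma wint_add:
  assumes "weight b" "S \<in> sets lebesgue" "S \<subseteq> {0<..}"
    "G \<in> borel_measurable lebesgue" "H \<in> borel_measurable lebesgue"
  shows "wint q b S (\<lambda>x. G x + H x) = wint q b S G + wint q b S H"
  unfolding wint_def using measurable_weighted[OF assms(1-4)] measurable_weighted[OF assms(1-3,5)]
  by (subst nn_integral_add[symmetric]) (auto simp: distrib_left distrib_right)

lemma wint_Un:
  assumes "weight b" "S \<in> sets lebesgue" "S \<subseteq> {0<..}" "T \<in> sets lebesgue" "T \<subseteq> {0<..}"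
    "S \<inter> T = {}" "G \<in> borel_measurable lebesgue"
  shows "wint q b (S \<union> T) G = wint q b S G + wint q b T G"
  unfolding wint_def using measurable_weighted[OF assms(1-3,7)] measurable_weighted[OF assms(1,4,5,7)] assms(6)
  by (subst nn_integral_add[symmetric]) (auto intro!: nn_integral_cong split: split_indicator)

lemma wint_weight_le:
  assumes "weight b'" "S \<in> sets lebesgue" "S \<subseteq> {0<..}" "G \<in> borel_measurable lebesgue"
    "0 < q" "0 \<le> c" "\<And>x. x \<in> S \<Longrightarrow> 0 \<le> b x \<and> b x \<le> c * b' x"
  shows "wint q b S G \<le> ennreal (c powr q) * wint q b' S G"
proof -
  have *: "ennreal (b x powr q / x) \<le> ennreal (c powr q) * ennreal (b' x powr q / x)" if "x \<in> S" for x
  proof -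
    have "0 < x" "0 < b' x" using assms(1,3) that by (auto simp: weight_def)
    moreover have "b x powr q \<le> (c * b' x) powr q"
      using assms(5,7) that by (intro powr_mono2) auto
    ultimately show ?thesis
      using assms(6) by (simp add: powr_mult divide_right_mono flip: ennreal_mult)
  qed
  have "wint q b S G \<le> wint q b' S (\<lambda>x. ennreal (c powr q) * G x)"
    unfolding wint_def using mult_right_mono[OF *]
    by (intro nn_integral_mono) (auto split: split_indicator simp: mult_ac)
  then show ?thesis using assms(1-4) by (simp add: wint_cmult)
qed

text \<open>Integrals are compared with sums over a partition by bounding the integrand on each piece.
  The integrand \<open>h\<close> is an arbitrary function because these bounds are applied to \<open>b_tilde\<close>, which
  contains the composition of \<open>b\<close> with \<open>\<rho>\<close>: a homeomorphism may destroy Lebesgue measurability.\<close>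

lemma nn_integral_le_zsum_mass:
  fixes I :: "int \<Rightarrow> real set"
  assumes "weight b" "\<And>k. I k \<in> sets lebesgue" "\<And>k. I k \<subseteq> {0<..}"
    and "\<And>x. x \<in> S \<Longrightarrow> \<exists>k. x \<in> I k \<and> h x \<le> c k * ennreal (b x powr q / x)"
  shows "(\<integral>\<^sup>+x\<in>S. h x \<partial>lebesgue) \<le> zsum (\<lambda>k. c k * mass q b (I k))"
proof -
  let ?g = "\<lambda>k x. c k * (ennreal (b x powr q / x) * indicator (I k) x)"
  have "(\<integral>\<^sup>+x\<in>S. h x \<partial>lebesgue) \<le> (\<integral>\<^sup>+x. zsum (\<lambda>k. ?g k x) \<partial>lebesgue)"
  proof (intro nn_integral_mono)
    fix x
    show "h x * indicator S x \<le> zsum (\<lambda>k. ?g k x)"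
    proof (cases "x \<in> S")
      case True
      then obtain k where "x \<in> I k" "h x \<le> c k * ennreal (b x powr q / x)" using assms(4) by blast
      then show ?thesis using True zsum_ge_term[of "\<lambda>k. ?g k x" k] by auto
    qed simp
  qed
  also have "\<dots> = zsum (\<lambda>k. \<integral>\<^sup>+x. ?g k x \<partial>lebesgue)"
    by (intro nn_integral_count_space_nn_integral borel_measurable_times_ennreal
        measurable_weight assms) auto
  also have "\<dots> = zsum (\<lambda>k. c k * mass q b (I k))"
    unfolding wint_def using assms by (simp add: nn_integral_cmult measurable_weight)
  finally show ?thesis .
qed

lemma zsum_mass_le_nn_integral:
  fixes I :: "int \<Rightarrow> real set"
  assumes "weight b" "\<And>k. I k \<in> sets lebesgue" "\<And>k. I k \<subseteq> {0<..}" "\<And>k. I k \<subseteq> S"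
    and disj: "\<And>k l x. x \<in> I k \<Longrightarrow> x \<in> I l \<Longrightarrow> k = l"
    and "\<And>k x. x \<in> I k \<Longrightarrow> c k * ennreal (b x powr q / x) \<le> h x"
  shows "zsum (\<lambda>k. c k * mass q b (I k)) \<le> (\<integral>\<^sup>+x\<in>S. h x \<partial>lebesgue)"
proof -
  let ?g = "\<lambda>k x. c k * (ennreal (b x powr q / x) * indicator (I k) x)"
  have "zsum (\<lambda>k. c k * mass q b (I k)) = zsum (\<lambda>k. \<integral>\<^sup>+x. ?g k x \<partial>lebesgue)"
    unfolding wint_def using assms by (simp add: nn_integral_cmult measurable_weight)
  also have "\<dots> = (\<integral>\<^sup>+x. zsum (\<lambda>k. ?g k x) \<partial>lebesgue)"
    by (intro nn_integral_count_space_nn_integral[symmetric] borel_measurable_times_ennreal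
        measurable_weight assms) auto
  also have "\<dots> \<le> (\<integral>\<^sup>+x\<in>S. h x \<partial>lebesgue)"
  proof (intro nn_integral_mono)
    fix x
    show "zsum (\<lambda>k. ?g k x) \<le> h x * indicator S x"
    proof (cases "\<exists>l. x \<in> I l")
      case True
      then obtain l where l: "x \<in> I l" by blast
      have "zsum (\<lambda>k. ?g k x) = zsum (\<lambda>k. ?g l x * indicator {l} k)"
        using disj l by (intro nn_integral_cong) (auto split: split_indicator)
      also have "\<dots> = ?g l x"
        by (subst nn_integral_cmult_indicator) auto
      also have "\<dots> \<le> h x * indicator S x"
        using subsetD[OF assms(4) l] assms(6)[OF l] l by simp
      finally show ?thesis .
    next
      case False
      then have "zsum (\<lambda>k. ?g k x) = zsum (\<lambda>k. 0)" by (intro nn_integral_cong) auto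
      then show ?thesis by simp
    qed
  qed
  finally show ?thesis .
qed

lemma wint_le_zsum:
  fixes I :: "int \<Rightarrow> real set"
  assumes "weight b" "\<And>k. I k \<in> sets lebesgue" "\<And>k. I k \<subseteq> {0<..}"
    and "\<And>x. x \<in> S \<Longrightarrow> \<exists>k. x \<in> I k \<and> G x \<le> c k"
  shows "wint q b S G \<le> zsum (\<lambda>k. c k * mass q b (I k))"
  unfolding wint_def[of q b S G]
  by (rule nn_integral_le_zsum_mass[OF assms(1-3)])
     (use assms(4) mult_left_mono[OF _ zero_le] in \<open>fastforce simp: mult.commute\<close>)

lemma zsum_le_wint:
  fixes I :: "int \<Rightarrow> real set"
  assumes "weight b" "\<And>k. I k \<in> sets lebesgue" "\<And>k. I k \<subseteq> {0<..}" "\<And>k. I k \<subseteq> S"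
    and "\<And>k l x. x \<in> I k \<Longrightarrow> x \<in> I l \<Longrightarrow> k = l"
    and "\<And>k x. x \<in> I k \<Longrightarrow> c k \<le> G x"
  shows "zsum (\<lambda>k. c k * mass q b (I k)) \<le> wint q b S G"
  unfolding wint_def[of q b S G]
  by (rule zsum_mass_le_nn_integral[OF assms(1-5)], assumption, assumption)
     (subst mult.commute, intro mult_left_mono assms(6) zero_le)

lemma greaterThanLessThan_subset: "0 \<le> s \<Longrightarrow> {s<..<t} \<subseteq> {0::real<..}"
  by auto

text \<open>The measure \<open>dt / t\<close> is invariant under dilations, so that a dilation only acts on the weight
  and on the integrand.\<close>

lemma wint_dilate:
  assumes "weight b" "0 < l" "G \<in> borel_measurable lebesgue"
  shows "wint q b {0<..<u} G = wint q (\<lambda>x. b (l * x)) {0<..<u / l} (\<lambda>x. G (l * x))"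
proof -
  have "wint q b {0<..<u} G = ennreal \<bar>l\<bar> *
      (\<integral>\<^sup>+x. ennreal (b (0 + l * x) powr q / (0 + l * x)) * G (0 + l * x) * indicator {0<..<u} (0 + l * x) \<partial>lebesgue)"
    unfolding wint_def using assms measurable_weighted[OF assms(1) _ _ assms(3), of "{0<..<u}" q, OF _ greaterThanLessThan_subset]
    by (subst nn_integral_real_affine_lebesgue[where c = l and t = 0]) auto
  also have "\<dots> = (\<integral>\<^sup>+x. ennreal l *
      (ennreal (b (0 + l * x) powr q / (0 + l * x)) * G (0 + l * x) * indicator {0<..<u} (0 + l * x)) \<partial>lebesgue)"
    using assms measurable_weighted[OF assms(1) _ _ assms(3), of "{0<..<u}" q, OF _ greaterThanLessThan_subset]
      lebesgue_affine_measurable[where c = "\<lambda>_::real. l" and t = 0]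
    by (subst nn_integral_cmult) (auto intro!: measurable_compose[of "\<lambda>x. l * x" lebesgue lebesgue])
  also have "\<dots> = wint q (\<lambda>x. b (l * x)) {0<..<u / l} (\<lambda>x. G (l * x))"
    unfolding wint_def
  proof (intro nn_integral_cong)
    fix x
    have "ennreal l * ennreal (b (l * x) powr q / (l * x)) = ennreal (b (l * x) powr q / x)" if "0 < x"
      using that assms(2) by (simp flip: ennreal_mult)
    moreover have "0 < l * x \<and> l * x < u \<longleftrightarrow> 0 < x \<and> x < u / l"
      using assms(2) by (auto simp: zero_less_mult_iff field_simps)
    ultimately show "ennreal l * (ennreal (b (0 + l * x) powr q / (0 + l * x)) * G (0 + l * x) * indicator {0<..<u} (0 + l * x))
      = ennreal (b (l * x) powr q / x) * G (l * x) * indicator {0<..<u / l} x"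
      by (auto split: split_indicator simp flip: mult.assoc)
  qed
  finally show ?thesis .
qed

lemma mass_pos:
  assumes "weight b" "0 \<le> s" "s < t"
  shows "0 < mass q b {s<..<t}"
proof (rule ccontr)
  let ?f = "\<lambda>x. ennreal (b x powr q / x) * indicator {s<..<t} x"
  assume "\<not> 0 < mass q b {s<..<t}"
  then have "(\<integral>\<^sup>+x. ?f x \<partial>lebesgue) = 0" by (simp add: wint_def)
  then have "emeasure lebesgue {x \<in> space lebesgue. ?f x \<noteq> 0} = 0"
    using measurable_weight[OF assms(1), of "{s<..<t}" q, OF _ greaterThanLessThan_subset] assms(2) by (subst (asm) nn_integral_0_iff) auto
  moreover have "{x \<in> space lebesgue. ?f x \<noteq> 0} = {s<..<t}"
  proof -
    have "?f x \<noteq> 0 \<longleftrightarrow> x \<in> {s<..<t}" for x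
    proof (cases "x \<in> {s<..<t}")
      case True
      then have "0 < x" using assms(2) by auto
      then have "0 < b x" using assms(1) by (auto simp: weight_def)
      then show ?thesis using True \<open>0 < x\<close> by (simp add: ennreal_eq_0_iff not_le zero_less_divide_iff)
    qed simp
    then show ?thesis by (simp only: space_completion space_lborel space_borel UNIV_I simp_thms Collect_mem_eq)
  qed
  ultimately have "emeasure lebesgue {s<..<t} = 0" by (simp only:)
  then show False using assms(3) by simp
qed

lemma mono_borel_measurable_ennreal:
  fixes f :: "real \<Rightarrow> ennreal"
  assumes "mono f \<or> antimono f"
  shows "f \<in> borel_measurable lebesgue"
proof -
  have "f \<in> borel_measurable borel"
  proof (rule borel_measurableI_greater)
    fix y
    have "is_interval {x. y < f x}"
      using assms
    proof
      assume "mono f"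
      then show ?thesis unfolding is_interval_1 by (auto intro: less_le_trans dest: monoD)
    next
      assume "antimono f"
      then show ?thesis unfolding is_interval_1 by (auto intro: less_le_trans dest: antimonoD)
    qed
    then have "{x. y < f x} \<in> sets borel"
      by (rule real_interval_borel_measurable)
    then show "{x \<in> space borel. y < f x} \<in> sets borel" by simp
  qed
  then show ?thesis by (simp add: measurable_completion)
qed

section \<open>Slowly varying weights\<close>

lemma slowly_varying_weight: "slowly_varying b \<Longrightarrow> weight b"
  by (simp add: slowly_varying_def weight_def)

lemma scaled_bound:
  fixes c C D x y :: real
  assumes "c * x \<le> y" "0 < c" "0 < C" "C / c \<le> D" "0 \<le> y"
  shows "C * x \<le> D * y"
proof -
  have "x \<le> y / c" using assms(1,2) by (simp only: pos_le_divide_eq mult.commute)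
  then have "C * x \<le> C * (y / c)" using assms(3) by (intro mult_left_mono) simp_all
  also have "\<dots> = (C / c) * y" by (simp only: times_divide_eq_right times_divide_eq_left)
  also have "\<dots> \<le> D * y" using assms(4,5) by (rule mult_right_mono)
  finally show ?thesis .
qed

text \<open>Potter-type bounds: the ratio \<open>b t / b s\<close> is at most a constant times any given positive power
  of \<open>t / s\<close>, in both directions.  Every later use of slow variation goes through them.\<close>

lemma slowly_varying_power_bounds:
  assumes "slowly_varying b" "0 < \<epsilon>"
  shows "\<exists>C\<ge>1. \<forall>s t. 0 < s \<longrightarrow> s \<le> t \<longrightarrow>
    b t \<le> C * (t / s) powr \<epsilon> * b s \<and> b s \<le> C * (t / s) powr \<epsilon> * b t"
proof -
  have bpos: "\<And>t. 0 < t \<Longrightarrow> 0 < b t" using assms by (simp add: slowly_varying_def)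
  obtain g c C where g: "mono_on {0<..} g" "0 < c" "0 < C"
    "\<And>t. 0 < t \<Longrightarrow> c * g t \<le> t powr \<epsilon> * b t \<and> t powr \<epsilon> * b t \<le> C * g t"
    using assms unfolding slowly_varying_def equivalent_pos_def by metis
  obtain g' c' C' where g': "antimono_on {0<..} g'" "0 < c'" "0 < C'"
    "\<And>t. 0 < t \<Longrightarrow> c' * g' t \<le> t powr (- \<epsilon>) * b t \<and> t powr (- \<epsilon>) * b t \<le> C' * g' t"
    using assms unfolding slowly_varying_def equivalent_pos_def by metis
  define D where "D = max 1 (max (C / c) (C' / c'))"
  show ?thesis
  proof (intro exI[of _ D] conjI allI impI)
    show "1 \<le> D" by (simp add: D_def)
    fix s t :: real assume st: "0 < s" "s \<le> t"
    define x y where "x = s powr \<epsilon>" and "y = t powr \<epsilon>"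
    have xy: "0 < x" "0 < y" "(t / s) powr \<epsilon> = y / x"
      "s powr (- \<epsilon>) = 1 / x" "t powr (- \<epsilon>) = 1 / y"
      using st by (simp_all add: x_def y_def powr_divide powr_minus_divide)
    have t: "0 < t" using st by simp
    have D: "C / c \<le> D" "C' / c' \<le> D" by (auto simp: D_def)
    have "g' t \<le> g' s" using monotone_onD[OF g'(1), of s t] st by simp
    then have "C' * g' t \<le> C' * g' s" using g'(3) by (intro mult_left_mono) simp_all
    also have "\<dots> \<le> D * (1 / x * b s)"
      using g'(4)[OF st(1)] bpos[OF st(1)] xy(1) unfolding xy
      by (intro scaled_bound[OF _ g'(2,3) D(2)]) simp_all
    finally have le: "1 / y * b t \<le> D * (1 / x * b s)"
      using g'(4)[OF t] unfolding xy by linarith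
    have "b t = y * (1 / y * b t)" using xy(2) by simp
    also have "\<dots> \<le> y * (D * (1 / x * b s))"
      using le xy(2) by (intro mult_left_mono) simp_all
    finally show "b t \<le> D * (t / s) powr \<epsilon> * b s"
      unfolding xy(3) by (simp only: times_divide_eq_right times_divide_eq_left mult_ac mult_1)
    have "g s \<le> g t" using mono_onD[OF g(1), of s t] st by simp
    then have "C * g s \<le> C * g t" using g(3) by (intro mult_left_mono) simp_all
    also have "\<dots> \<le> D * (y * b t)"
      using g(4)[OF t] bpos[OF t] xy(2) unfolding y_def[symmetric]
      by (intro scaled_bound[OF _ g(2,3) D(1)]) simp_all
    finally have le: "x * b s \<le> D * (y * b t)"
      using g(4)[OF st(1)] unfolding x_def by linarith
    have "b s = x * b s / x" using xy(1) by simp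
    also have "\<dots> \<le> D * (y * b t) / x"
      using le xy(1) by (intro divide_right_mono) simp_all
    finally show "b s \<le> D * (t / s) powr \<epsilon> * b t"
      unfolding xy(3) by (simp only: times_divide_eq_right times_divide_eq_left mult_ac)
  qed
qed

lemma slowly_varying_doubling:
  assumes "slowly_varying b"
  obtains C where "1 \<le> C"
    "\<And>s t. 0 < s \<Longrightarrow> s \<le> t \<Longrightarrow> t \<le> 2 * s \<Longrightarrow> b t \<le> C * b s \<and> b s \<le> C * b t"
proof -
  have pos: "\<And>t. 0 < t \<Longrightarrow> 0 < b t" using assms by (simp add: slowly_varying_def)
  obtain C where C: "1 \<le> C"
    "\<And>s t. 0 < s \<Longrightarrow> s \<le> t \<Longrightarrow> b t \<le> C * (t / s) powr 1 * b s"
    "\<And>s t. 0 < s \<Longrightarrow> s \<le> t \<Longrightarrow> b s \<le> C * (t / s) powr 1 * b t"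
    using slowly_varying_power_bounds[OF assms zero_less_one] by metis
  have "b t \<le> (C * 2) * b s \<and> b s \<le> (C * 2) * b t" if "0 < s" "s \<le> t" "t \<le> 2 * s" for s t
  proof -
    have "(t / s) powr 1 \<le> 2" using that by (simp add: pos_divide_le_eq)
    then have le: "C * (t / s) powr 1 \<le> C * 2" using C(1) by (intro mult_left_mono) auto
    show ?thesis
      using C(2,3)[OF that(1,2)] mult_right_mono[OF le, of "b s"] mult_right_mono[OF le, of "b t"]
        pos[of s] pos[of t] that by linarith
  qed
  with C(1) show thesis by (intro that[of "C * 2"]) auto
qed

lemma mass_interval_le:
  assumes "0 < s" "s \<le> t" "\<And>x. s < x \<Longrightarrow> x \<le> t \<Longrightarrow> b x powr q \<le> c"
  shows "mass q b {s<..t} \<le> ennreal (c * (t - s) / s)"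
proof (cases "s = t")
  case True
  then show ?thesis by (simp add: wint_def)
next
  case False
  then have st: "s < t" using assms by simp
  have c: "0 \<le> c" using assms(3)[of t] st powr_ge_zero[of "b t" q] by linarith
  have "mass q b {s<..t} \<le> (\<integral>\<^sup>+x. ennreal (c / s) * indicator {s<..t} x \<partial>lebesgue)"
    unfolding wint_def
  proof (intro nn_integral_mono)
    fix x
    have "b x powr q / x \<le> c / s" if "s < x" "x \<le> t"
      using assms(1,3) that c by (intro frac_le) auto
    then show "ennreal (b x powr q / x) * 1 * indicator {s<..t} x \<le> ennreal (c / s) * indicator {s<..t} x"
      by (auto split: split_indicator intro: ennreal_leI)
  qed
  also have "\<dots> = ennreal (c * (t - s) / s)"
    using assms(1,2) c by (subst nn_integral_cmult_indicator) (simp_all flip: ennreal_mult)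
  finally show ?thesis .
qed

lemma mass_interval_ge:
  assumes "0 < s" "s \<le> t" "0 \<le> c" "\<And>x. s < x \<Longrightarrow> x \<le> t \<Longrightarrow> c \<le> b x powr q"
  shows "ennreal (c * (t - s) / t) \<le> mass q b {s<..t}"
proof -
  have "ennreal (c * (t - s) / t) = (\<integral>\<^sup>+x. ennreal (c / t) * indicator {s<..t} x \<partial>lebesgue)"
    using assms(1-3) by (subst nn_integral_cmult_indicator) (simp_all flip: ennreal_mult)
  also have "\<dots> \<le> mass q b {s<..t}"
    unfolding wint_def
  proof (intro nn_integral_mono)
    fix x
    have "c / t \<le> b x powr q / x" if "s < x" "x \<le> t"
      using assms that by (intro frac_le) auto
    then show "ennreal (c / t) * indicator {s<..t} x \<le> ennreal (b x powr q / x) * 1 * indicator {s<..t} x"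
      by (auto split: split_indicator intro: ennreal_leI)
  qed
  finally show ?thesis .
qed

text \<open>The octave above \<open>t\<close> alone contributes a fixed multiple of \<open>b(t)\<^sup>q\<close> to the tail.\<close>

lemma slowly_varying_le_tail_mass:
  assumes "slowly_varying b" "0 < q"
  shows "\<exists>C>0. \<forall>t>0. ennreal (b t powr q) \<le> ennreal C * mass q b {t<..}"
proof -
  have pos: "\<And>t. 0 < t \<Longrightarrow> 0 < b t" using assms by (simp add: slowly_varying_def)
  obtain C where C: "1 \<le> C"
    "\<And>s t. 0 < s \<Longrightarrow> s \<le> t \<Longrightarrow> t \<le> 2 * s \<Longrightarrow> b t \<le> C * b s \<and> b s \<le> C * b t"
    using slowly_varying_doubling[OF assms(1)] by blast
  have "ennreal (b t powr q) \<le> ennreal (2 * C powr q) * mass q b {t<..}" if t: "0 < t" for t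
  proof -
    let ?c = "b t powr q / C powr q"
    have "?c \<le> b x powr q" if "t < x" "x \<le> 2 * t" for x
    proof -
      have "b t powr q \<le> (C * b x) powr q"
        using C(2)[of t x] t that pos[OF t] assms(2) by (intro powr_mono2) auto
      then show ?thesis
        using C(1) pos[of x] t that by (simp add: powr_mult pos_divide_le_eq mult.commute)
    qed
    then have "ennreal (?c * (2 * t - t) / (2 * t)) \<le> mass q b {t<..2 * t}"
      using t C(1) by (intro mass_interval_ge) auto
    also have "\<dots> \<le> mass q b {t<..}" by (intro wint_mono) auto
    finally have le: "ennreal (?c / 2) \<le> mass q b {t<..}" using t by simp
    have "b t powr q = (2 * C powr q) * (?c / 2)" using C(1) by simp
    then have "ennreal (b t powr q) = ennreal (2 * C powr q) * ennreal (?c / 2)"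
      by (metis ennreal_mult' mult_nonneg_nonneg powr_ge_zero zero_le_numeral)
    also have "\<dots> \<le> ennreal (2 * C powr q) * mass q b {t<..}"
      by (intro mult_left_mono le) simp
    finally show ?thesis .
  qed
  moreover have "0 < 2 * C powr q" using C(1) by simp
  ultimately show ?thesis by blast
qed

text \<open>Half of the power \<open>\<delta>\<close> compensates the growth of \<open>b\<close> towards zero, the other half makes the
  integral converge.\<close>

lemma slowly_varying_power_integral_le:
  assumes "slowly_varying b" "0 < q" "0 < \<delta>"
  shows "\<exists>C>0. \<forall>t>0. wint q b {0<..t} (\<lambda>u. ennreal ((u / t) powr \<delta>)) \<le> ennreal C * ennreal (b t powr q)"
proof -
  have pos: "\<And>t. 0 < t \<Longrightarrow> 0 < b t" using assms by (simp add: slowly_varying_def)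
  define \<eta> where "\<eta> = \<delta> / 2"
  have \<eta>: "0 < \<eta>" using assms by (simp add: \<eta>_def)
  obtain C where C: "1 \<le> C"
    "\<And>s t. 0 < s \<Longrightarrow> s \<le> t \<Longrightarrow> b s \<le> C * (t / s) powr (\<eta> / q) * b t"
    using slowly_varying_power_bounds[OF assms(1) divide_pos_pos[OF \<eta> assms(2)]] by metis
  have "wint q b {0<..t} (\<lambda>u. ennreal ((u / t) powr \<delta>)) \<le> ennreal (C powr q / \<eta>) * ennreal (b t powr q)"
    if t: "0 < t" for t
  proof -
    define D where "D = C powr q * b t powr q / t powr \<eta>"
    have D: "0 \<le> D" by (simp add: D_def)
    have pt: "b u powr q / u * (u / t) powr \<delta> \<le> D * u powr (\<eta> - 1)" if u: "0 < u" "u \<le> t" for u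
    proof -
      have split: "(u / t) powr \<delta> = u powr \<eta> / t powr \<eta> * (u powr \<eta> / t powr \<eta>)"
        using u t by (simp add: \<eta>_def powr_divide flip: powr_add)
      have "b u powr q \<le> (C * (t / u) powr (\<eta> / q) * b t) powr q"
        using C(2)[OF u] pos[OF u(1)] assms(2) by (intro powr_mono2) auto
      also have "\<dots> = C powr q * (t powr \<eta> / u powr \<eta>) * b t powr q"
        using C(1) pos[OF t] u t assms(2) by (simp add: powr_mult powr_powr powr_divide)
      finally have "b u powr q * ((u / t) powr \<delta> / u)
          \<le> C powr q * (t powr \<eta> / u powr \<eta>) * b t powr q * ((u / t) powr \<delta> / u)"
        using u t by (intro mult_right_mono) auto
      also have "\<dots> = D * (u powr \<eta> / u)"
        using u t unfolding split by (simp add: D_def)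
      also have "u powr \<eta> / u = u powr (\<eta> - 1)" using u by (simp add: powr_diff)
      finally show ?thesis by (simp only: times_divide_eq_left times_divide_eq_right)
    qed
    have "((\<lambda>u. u powr (\<eta> - 1)) has_integral (t powr \<eta> / \<eta>)) {0..t}"
      using has_integral_powr_from_0[of "\<eta> - 1" t] \<eta> t by simp
    then have I: "(\<integral>\<^sup>+u\<in>{0..t}. ennreal (u powr (\<eta> - 1)) \<partial>lborel) = ennreal (t powr \<eta> / \<eta>)"
      by (intro nn_integral_has_integral_lebesgue') auto
    have "wint q b {0<..t} (\<lambda>u. ennreal ((u / t) powr \<delta>))
        \<le> (\<integral>\<^sup>+u. ennreal D * (ennreal (u powr (\<eta> - 1)) * indicator {0..t} u) \<partial>lebesgue)"
      unfolding wint_def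
      using pt pos D by (intro nn_integral_mono)
        (auto split: split_indicator intro!: ennreal_leI simp flip: ennreal_mult')
    also have "\<dots> = ennreal D * (\<integral>\<^sup>+u\<in>{0..t}. ennreal (u powr (\<eta> - 1)) \<partial>lborel)"
      by (simp add: nn_integral_completion nn_integral_cmult)
    also have "\<dots> = ennreal (C powr q / \<eta>) * ennreal (b t powr q)"
      using t \<eta> D unfolding I by (simp add: D_def flip: ennreal_mult)
    finally show ?thesis .
  qed
  moreover have "0 < C powr q / \<eta>" using C(1) \<eta> by simp
  ultimately show ?thesis by blast
qed

section \<open>Tails of slowly varying weights\<close>

definition tail_mass :: "real \<Rightarrow> (real \<Rightarrow> real) \<Rightarrow> real \<Rightarrow> real" where
  "tail_mass q b t = enn2real (mass q b {t<..})"

lemma mass_tail_split: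
  assumes "weight b" "0 < s" "s \<le> t"
  shows "mass q b {s<..} = mass q b {s<..t} + mass q b {t<..}"
proof -
  have "{s<..} = {s<..t} \<union> {t<..}" using assms by auto
  moreover have "mass q b ({s<..t} \<union> {t<..}) = mass q b {s<..t} + mass q b {t<..}"
    using assms by (intro wint_Un) auto
  ultimately show ?thesis by simp
qed

lemma slowly_varying_interval_bound:
  assumes "slowly_varying b" "0 < q" "0 < s"
  obtains c where "\<And>x. s \<le> x \<Longrightarrow> x \<le> t \<Longrightarrow> b x powr q \<le> c"
proof -
  have pos: "\<And>t. 0 < t \<Longrightarrow> 0 < b t" using assms by (simp add: slowly_varying_def)
  obtain C where C: "1 \<le> C" "\<And>s t. 0 < s \<Longrightarrow> s \<le> t \<Longrightarrow> b t \<le> C * (t / s) powr 1 * b s"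
    using slowly_varying_power_bounds[OF assms(1) zero_less_one] by metis
  have "b x powr q \<le> (C * (t / s) * b s) powr q" if x: "s \<le> x" "x \<le> t" for x
  proof (rule powr_mono2)
    have "b x \<le> C * (x / s) * b s" using C(2)[of s x] x assms(3) by simp
    also have "\<dots> \<le> C * (t / s) * b s"
      using C(1) pos[OF assms(3)] x assms(3)
      by (intro mult_right_mono mult_left_mono divide_right_mono) auto
    finally show "b x \<le> C * (t / s) * b s" .
    show "0 \<le> b x" using pos[of x] x assms(3) by simp
  qed (use assms in simp)
  then show thesis by (rule that)
qed

lemma
  assumes "SV0 q b" "0 < q" "0 < t"
  shows mass_tail: "mass q b {t<..} = ennreal (tail_mass q b t)"
    and tail_mass_pos: "0 < tail_mass q b t"
proof -
  have sv: "slowly_varying b" and w: "weight b"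
    using assms(1) by (auto simp: SV0_def slowly_varying_weight)
  have "epowr (mass q b {1<..}) (1 / q) < top"
    using assms(1,2) tail_norm_eq_mass[OF assms(2) _ w, of 1] by (simp add: SV0_def)
  then have fin1: "mass q b {1<..} < top" by (simp add: less_top[symmetric])
  have "mass q b {t<..} < top"
  proof (cases "t \<le> 1")
    case True
    obtain c where "\<And>x. t \<le> x \<Longrightarrow> x \<le> 1 \<Longrightarrow> b x powr q \<le> c"
      using slowly_varying_interval_bound[OF sv assms(2,3), of 1] by blast
    then have "mass q b {t<..1} \<le> ennreal (c * (1 - t) / t)"
      using True assms(3) by (intro mass_interval_le) auto
    then have "mass q b {t<..1} < top" by (rule le_less_trans) simp
    then show ?thesis using fin1 mass_tail_split[OF w assms(3) True] by simp
  next
    case False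
    then have "mass q b {t<..} \<le> mass q b {1<..}" by (intro wint_mono) auto
    with fin1 show ?thesis by (rule le_less_trans[rotated])
  qed
  then show *: "mass q b {t<..} = ennreal (tail_mass q b t)" by (simp add: tail_mass_def)
  have "0 < mass q b {t<..<t + 1}" using assms(3) by (intro mass_pos w) auto
  also have "\<dots> \<le> mass q b {t<..}" by (intro wint_mono) auto
  finally show "0 < tail_mass q b t" unfolding * by simp
qed

lemma mass_interval_eq:
  assumes "SV0 q b" "0 < q" "0 < s" "s \<le> t"
  shows "mass q b {s<..t} = ennreal (tail_mass q b s - tail_mass q b t)"
    and tail_mass_antimono: "tail_mass q b t \<le> tail_mass q b s"
proof -
  have w: "weight b" using assms(1) by (auto simp: SV0_def slowly_varying_weight)
  have pos: "0 < tail_mass q b s" "0 < tail_mass q b t" using tail_mass_pos assms by auto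
  have eq: "ennreal (tail_mass q b s) = mass q b {s<..t} + ennreal (tail_mass q b t)"
    using mass_tail_split[OF w assms(3,4), of q] mass_tail[OF assms(1,2,3)] mass_tail[OF assms(1,2), of t] assms(3,4) by simp
  then obtain m where m: "mass q b {s<..t} = ennreal m" "0 \<le> m"
    by (cases "mass q b {s<..t}" rule: ennreal_cases) auto
  have "tail_mass q b s = m + tail_mass q b t"
    using eq m pos by (simp flip: ennreal_plus)
  then show "mass q b {s<..t} = ennreal (tail_mass q b s - tail_mass q b t)"
    "tail_mass q b t \<le> tail_mass q b s" using m by auto
qed

text \<open>The density \<open>b\<^sup>q / u\<close> is bounded on compact subsets of \<open>(0, \<infinity>)\<close>, hence the tail is locally
  Lipschitz there.\<close>

lemma tail_mass_continuous:
  assumes "SV0 q b" "0 < q"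
  shows "continuous_on {0<..} (tail_mass q b)"
proof -
  have sv: "slowly_varying b" using assms(1) by (simp add: SV0_def)
  have "isCont (tail_mass q b) x" if x: "0 < x" for x
  proof -
    obtain c where c: "\<And>y. x / 2 \<le> y \<Longrightarrow> y \<le> 2 * x \<Longrightarrow> b y powr q \<le> c"
      using slowly_varying_interval_bound[OF sv assms(2), of "x / 2" "2 * x"] x by auto
    have c0: "0 \<le> c" using c[of x] powr_ge_zero[of "b x" q] x by linarith
    have step: "\<bar>tail_mass q b s - tail_mass q b t\<bar> \<le> 2 * c / x * \<bar>s - t\<bar>"
      if "s \<in> {x / 2..2 * x}" "t \<in> {x / 2..2 * x}" "s \<le> t" for s t
    proof -
      have s: "0 < s" using that x by auto
      have "ennreal (tail_mass q b s - tail_mass q b t) \<le> ennreal (c * (t - s) / s)"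
        using that s c unfolding mass_interval_eq(1)[OF assms s that(3), symmetric]
        by (intro mass_interval_le) auto
      then have "tail_mass q b s - tail_mass q b t \<le> c * (t - s) / s"
        using c0 s that by (subst (asm) ennreal_le_iff) auto
      also have "\<dots> \<le> c * (t - s) / (x / 2)"
        using c0 s that x by (intro divide_left_mono) auto
      finally show ?thesis
        using tail_mass_antimono[OF assms s that(3)] that(3) by (simp add: mult_ac)
    qed
    have "(2 * c / x)-lipschitz_on {x / 2..2 * x} (tail_mass q b)"
    proof (rule lipschitz_onI)
      fix s t assume "s \<in> {x / 2..2 * x}" "t \<in> {x / 2..2 * x}"
      then show "dist (tail_mass q b s) (tail_mass q b t) \<le> 2 * c / x * dist s t"
        using step[of s t] step[of t s] by (cases "s \<le> t") (auto simp: dist_real_def abs_minus_commute)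
    qed (use c0 x in simp)
    then have "continuous_on {x / 2..2 * x} (tail_mass q b)" by (rule lipschitz_on_continuous_on)
    then show ?thesis using x by (intro continuous_on_interior[of "{x / 2..2 * x}"]) auto
  qed
  then show ?thesis by (simp add: continuous_at_imp_continuous_on)
qed

lemma enn2real_tail_norm:
  assumes "SV0 q b" "0 < q" "0 < t"
  shows "enn2real (tail_norm q b t) = tail_mass q b t powr (1 / q)"
  using assms mass_tail[OF assms] tail_mass_pos[OF assms] tail_norm_eq_mass[of q t b]
  by (simp add: SV0_def slowly_varying_weight epowr_ennreal)

lemma tail_mass_eq_integral:
  assumes "SV0 q b" "0 < q" "0 < t"
  shows "(LINT u:{t<..}|lebesgue. b u powr q / u) = tail_mass q b t"
proof -
  have w: "weight b" using assms(1) by (auto simp: SV0_def slowly_varying_weight)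
  have e: "ennreal (b x powr q / x) * 1 * indicator {t<..} x = ennreal (indicator {t<..} x *\<^sub>R (b x powr q / x))" for x
    by (auto split: split_indicator)
  have "(\<lambda>x. ennreal (b x powr q / x) * indicator {t<..} x) \<in> borel_measurable lebesgue"
    using assms(3) by (intro measurable_weight w) auto
  then have "(\<lambda>x. enn2real (ennreal (b x powr q / x) * indicator {t<..} x)) \<in> borel_measurable lebesgue"
    by measurable
  moreover have "enn2real (ennreal (b x powr q / x) * indicator {t<..} x) = indicator {t<..} x *\<^sub>R (b x powr q / x)" for x
    using assms(3) by (auto split: split_indicator)
  ultimately have "(\<lambda>x. indicator {t<..} x *\<^sub>R (b x powr q / x)) \<in> borel_measurable lebesgue" by simp
  then show ?thesis
    unfolding set_lebesgue_integral_def tail_mass_def wint_def e using assms(3)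
    by (intro integral_eq_nn_integral) (auto intro!: AE_I2 split: split_indicator)
qed

section \<open>The non-increasing rearrangement\<close>

lemma rearrangement_antimono: "s \<le> t \<Longrightarrow> rearrangement M f t \<le> rearrangement M f s"
  unfolding rearrangement_def
  by (rule Inf_superset_mono) (use ennreal_leI[of s t] in \<open>force intro: order_trans\<close>)

lemma measurable_rearrangement: "rearrangement M f \<in> borel_measurable lebesgue"
  by (rule mono_borel_measurable_ennreal) (auto intro: antimonoI rearrangement_antimono)

lemma measurable_rearrangement_dilated: "(\<lambda>x. rearrangement M f (x / 2)) \<in> borel_measurable lebesgue"
  by (rule mono_borel_measurable_ennreal) (auto intro!: antimonoI rearrangement_antimono)

lemma measurable_superlevel [measurable]:
  "f \<in> borel_measurable M \<Longrightarrow> {x \<in> space M. \<bar>f x\<bar> > (s::real)} \<in> sets M"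
  by measurable

lemma rearrangement_le:
  "0 \<le> s \<Longrightarrow> emeasure M {x \<in> space M. \<bar>f x\<bar> > s} \<le> ennreal t \<Longrightarrow> rearrangement M f t \<le> ennreal s"
  unfolding rearrangement_def by (rule Inf_lower) auto

lemma rearrangement_mono:
  assumes "g \<in> borel_measurable M" "\<And>x. x \<in> space M \<Longrightarrow> \<bar>f x\<bar> \<le> \<bar>g x\<bar>"
  shows "rearrangement M f t \<le> rearrangement M g t"
  unfolding rearrangement_def
proof (rule Inf_superset_mono, safe)
  fix s :: real assume s: "0 \<le> s" "emeasure M {x \<in> space M. \<bar>g x\<bar> > s} \<le> ennreal t"
  have "emeasure M {x \<in> space M. \<bar>f x\<bar> > s} \<le> emeasure M {x \<in> space M. \<bar>g x\<bar> > s}"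
    using assms by (intro emeasure_mono) (auto intro: less_le_trans)
  then show "\<exists>s'. ennreal s = ennreal s' \<and> 0 \<le> s' \<and> emeasure M {x \<in> space M. \<bar>f x\<bar> > s'} \<le> ennreal t"
    using s by (intro exI[of _ s]) (auto intro: order_trans)
qed

lemma rearrangement_le_bound:
  assumes "0 \<le> c" "\<And>x. x \<in> space M \<Longrightarrow> \<bar>f x\<bar> \<le> c"
  shows "rearrangement M f t \<le> ennreal c"
proof -
  have "{x \<in> space M. \<bar>f x\<bar> > c} = {}" using assms(2) by (auto simp: not_less)
  then have "emeasure M {x \<in> space M. \<bar>f x\<bar> > c} \<le> ennreal t" by (simp only: emeasure_empty zero_le)
  then show ?thesis using assms(1) by (intro rearrangement_le)
qed

text \<open>By continuity of the measure from below, the infimum that defines the rearrangement is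
  attained.\<close>

lemma emeasure_superlevel_rearrangement:
  assumes "f \<in> borel_measurable M" "rearrangement M f t = ennreal c" "0 \<le> c"
  shows "emeasure M {x \<in> space M. \<bar>f x\<bar> > c} \<le> ennreal t"
proof -
  let ?A = "\<lambda>n. {x \<in> space M. \<bar>f x\<bar> > c + 1 / real (Suc n)}"
  have small: "emeasure M (?A n) \<le> ennreal t" for n
  proof -
    have "rearrangement M f t < ennreal (c + 1 / real (Suc n))"
      using assms(2,3) by (simp add: ennreal_less_iff)
    then obtain s where s: "0 \<le> s" "emeasure M {x \<in> space M. \<bar>f x\<bar> > s} \<le> ennreal t"
      "ennreal s < ennreal (c + 1 / real (Suc n))"
      unfolding rearrangement_def Inf_less_iff by auto
    then have "s < c + 1 / real (Suc n)" by (simp add: ennreal_less_iff)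
    then have "emeasure M (?A n) \<le> emeasure M {x \<in> space M. \<bar>f x\<bar> > s}"
      using assms(1) by (intro emeasure_mono measurable_superlevel) auto
    with s(2) show ?thesis by (rule order_trans[rotated])
  qed
  have "incseq ?A"
  proof (rule incseq_SucI, rule subsetI)
    fix n x assume "x \<in> ?A n"
    moreover have "1 / real (Suc (Suc n)) \<le> 1 / real (Suc n)" by (simp add: divide_simps)
    ultimately show "x \<in> ?A (Suc n)" by auto
  qed
  then have "(SUP n. emeasure M (?A n)) = emeasure M (\<Union>n. ?A n)"
    using assms(1) by (intro SUP_emeasure_incseq) auto
  also have "(\<Union>n. ?A n) = {x \<in> space M. \<bar>f x\<bar> > c}"
  proof (intro equalityI subsetI)
    fix x assume x: "x \<in> {x \<in> space M. \<bar>f x\<bar> > c}"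
    then obtain n where "1 / real (Suc n) < \<bar>f x\<bar> - c"
      using nat_approx_posE[of "\<bar>f x\<bar> - c"] by auto
    then have "x \<in> ?A n" using x by (simp add: algebra_simps)
    then show "x \<in> (\<Union>n. ?A n)" by blast
  next
    fix x assume "x \<in> (\<Union>n. ?A n)"
    then obtain n where "x \<in> space M" "c + 1 / real (Suc n) < \<bar>f x\<bar>" by auto
    moreover have "0 < 1 / real (Suc n)" by simp
    ultimately show "x \<in> {x \<in> space M. \<bar>f x\<bar> > c}"
      unfolding mem_Collect_eq by (intro conjI) (assumption, linarith)
  qed
  finally have "emeasure M {x \<in> space M. \<bar>f x\<bar> > c} = (SUP n. emeasure M (?A n))" by (rule sym)
  then show ?thesis using small by (simp only: SUP_le_iff) simp
qed

text \<open>If \<open>\<bar>f + g\<bar> > c + d\<close> then \<open>\<bar>f\<bar> > c\<close> or \<open>\<bar>g\<bar> > d\<close>; each of the two sets is allowed half of the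
  measure.\<close>

lemma rearrangement_add:
  assumes "f \<in> borel_measurable M" "g \<in> borel_measurable M" "0 \<le> t"
  shows "rearrangement M (\<lambda>x. f x + g x) t \<le> rearrangement M f (t / 2) + rearrangement M g (t / 2)"
proof (cases "rearrangement M f (t / 2) = top \<or> rearrangement M g (t / 2) = top")
  case True
  then show ?thesis by auto
next
  case False
  then obtain c d where c: "rearrangement M f (t / 2) = ennreal c" "0 \<le> c"
    and d: "rearrangement M g (t / 2) = ennreal d" "0 \<le> d"
    by (metis ennreal_cases)
  let ?A = "{x \<in> space M. \<bar>f x\<bar> > c}" and ?B = "{x \<in> space M. \<bar>g x\<bar> > d}"
  have "emeasure M {x \<in> space M. \<bar>f x + g x\<bar> > c + d} \<le> emeasure M (?A \<union> ?B)"
    using assms by (intro emeasure_mono) auto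
  also have "\<dots> \<le> emeasure M ?A + emeasure M ?B"
    using assms by (intro emeasure_subadditive) auto
  also have "\<dots> \<le> ennreal (t / 2) + ennreal (t / 2)"
    using emeasure_superlevel_rearrangement assms(1,2) c d by (intro add_mono) auto
  also have "\<dots> = ennreal t" using assms(3) by (simp flip: ennreal_plus)
  finally have "rearrangement M (\<lambda>x. f x + g x) t \<le> ennreal (c + d)"
    using c d by (intro rearrangement_le) auto
  then show ?thesis using c d by simp
qed

text \<open>Cutting \<open>f\<close> at the height \<open>c = f\<^sup>*(t)\<close> splits it into a part with rearrangement supported in
  \<open>(0, t)\<close> and a part bounded by \<open>c\<close>.\<close>

lemma truncation_at_rearrangement:
  assumes "f \<in> borel_measurable M" "rearrangement M f t = ennreal c" "0 \<le> c"
  obtains f0 f1 where "f0 \<in> borel_measurable M" "f1 \<in> borel_measurable M" "f = f0 + f1"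
    "\<And>s. rearrangement M f0 s \<le> rearrangement M f s" "\<And>s. t \<le> s \<Longrightarrow> rearrangement M f0 s = 0"
    "\<And>s. rearrangement M f1 s \<le> rearrangement M f s" "\<And>s. rearrangement M f1 s \<le> ennreal c"
proof -
  define f1 where "f1 x = max (- c) (min (f x) c)" for x
  define f0 where "f0 x = f x - f1 x" for x
  have m1: "f1 \<in> borel_measurable M" unfolding f1_def using assms(1) by measurable
  have m0: "f0 \<in> borel_measurable M" unfolding f0_def using assms(1) m1 by measurable
  have le: "\<bar>f0 x\<bar> \<le> \<bar>f x\<bar>" "\<bar>f1 x\<bar> \<le> \<bar>f x\<bar>" "\<bar>f1 x\<bar> \<le> c" for x
    using assms(3) by (auto simp: f0_def f1_def)
  have supp: "rearrangement M f0 s = 0" if "t \<le> s" for s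
  proof -
    have "{x \<in> space M. \<bar>f0 x\<bar> > 0} \<subseteq> {x \<in> space M. \<bar>f x\<bar> > c}"
      using assms(3) by (auto simp: f0_def f1_def)
    then have "emeasure M {x \<in> space M. \<bar>f0 x\<bar> > 0} \<le> emeasure M {x \<in> space M. \<bar>f x\<bar> > c}"
      using assms(1) by (intro emeasure_mono) auto
    also have "\<dots> \<le> ennreal t" by (rule emeasure_superlevel_rearrangement[OF assms])
    also have "\<dots> \<le> ennreal s" using that by (rule ennreal_leI)
    finally have "rearrangement M f0 s \<le> ennreal 0" by (intro rearrangement_le) auto
    then show ?thesis by simp
  qed
  have "f = f0 + f1" by (auto simp: f0_def)
  then show thesis
    using m0 m1 supp le assms(1,3)
    by (intro that) (auto intro: rearrangement_mono rearrangement_le_bound)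
qed

section \<open>The inner norm of a generalized gamma space\<close>

definition inner_norm :: "real \<Rightarrow> real \<Rightarrow> (real \<Rightarrow> real) \<Rightarrow> (real \<Rightarrow> ennreal) \<Rightarrow> real \<Rightarrow> ennreal" where
  "inner_norm r p w g t = Lq_norm r {0<..<t} (\<lambda>\<tau>. ennreal (\<tau> powr (1 / p - 1 / r) * w \<tau>) * g \<tau>)"

lemma weight_power_mult:
  assumes "weight w"
  shows "weight (\<lambda>t. t powr a * w t)"
proof -
  have "(\<lambda>x. x) \<in> borel_measurable (lebesgue_on {0::real<..})"
    using id_borel_measurable_lebesgue_on[of "{0<..}"] by (simp add: id_def)
  then show ?thesis using assms by (auto simp: weight_def)
qed

lemma inner_norm_eq:
  assumes "0 < r" "weight w"
  shows "inner_norm r p w g t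
    = epowr (wint r (\<lambda>\<tau>. \<tau> powr (1 / p) * w \<tau>) {0<..<t} (\<lambda>\<tau>. epowr (g \<tau>) r)) (1 / r)"
proof -
  have eq: "\<tau> powr (1 / p - 1 / r) * w \<tau> = \<tau> powr (- 1 / r) * (\<tau> powr (1 / p) * w \<tau>)" for \<tau>
    by (simp add: algebra_simps flip: powr_add)
  have "0 \<le> \<tau> powr (1 / p) * w \<tau>" if "\<tau> \<in> {0<..<t}" for \<tau>
    using assms(2) that by (simp add: weight_def less_imp_le)
  then show ?thesis
    unfolding inner_norm_def eq using assms(1) by (intro Lq_norm_eq_wint) auto
qed

lemma inner_norm_mono:
  assumes "0 < r" "weight w" "s \<le> t" "\<And>\<tau>. 0 < \<tau> \<Longrightarrow> \<tau> < s \<Longrightarrow> g \<tau> \<le> h \<tau>"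
  shows "inner_norm r p w g s \<le> inner_norm r p w h t"
  unfolding inner_norm_eq[OF assms(1,2)] using assms
  by (intro epowr_mono wint_mono) auto

lemma inner_norm_const:
  assumes "0 < r" "weight w"
  shows "inner_norm r p w (\<lambda>_. c) t = c * inner_norm r p w (\<lambda>_. 1) t"
proof -
  have "wint r (\<lambda>\<tau>. \<tau> powr (1 / p) * w \<tau>) {0<..<t} (\<lambda>_. epowr c r * 1)
      = epowr c r * mass r (\<lambda>\<tau>. \<tau> powr (1 / p) * w \<tau>) {0<..<t}"
    using assms by (intro wint_cmult weight_power_mult) auto
  then show ?thesis
    using assms by (simp add: inner_norm_eq epowr_mult epowr_epowr epowr_def[of 1])
qed

lemma inner_norm_one_pos:
  assumes "0 < r" "weight w" "0 < t"
  shows "inner_norm r p w (\<lambda>_. 1) t \<noteq> 0"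
  using mass_pos[OF weight_power_mult[OF assms(2)], of 0 t r "1 / p"] assms
  by (simp add: inner_norm_eq epowr_def[of 1] flip: zero_less_iff_neq_zero)

lemma measurable_inner_norm:
  assumes "0 < r" "weight w"
  shows "inner_norm r p w g \<in> borel_measurable lebesgue"
  using assms by (intro mono_borel_measurable_ennreal disjI1 monoI inner_norm_mono) auto

lemma inner_norm_add:
  assumes "0 < r" "weight w" "g \<in> borel_measurable lebesgue" "h \<in> borel_measurable lebesgue"
  shows "inner_norm r p w (\<lambda>\<tau>. g \<tau> + h \<tau>) t
    \<le> ennreal (2 * 2 powr (1 / r)) * (inner_norm r p w g t + inner_norm r p w h t)"
proof -
  let ?b = "\<lambda>\<tau>. \<tau> powr (1 / p) * w \<tau>" and ?S = "{0<..<t}"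
  let ?I = "\<lambda>g. wint r ?b ?S (\<lambda>\<tau>. epowr (g \<tau>) r)"
  have w: "weight ?b" by (rule weight_power_mult[OF assms(2)])
  have m: "(\<lambda>\<tau>. epowr (g \<tau>) r) \<in> borel_measurable lebesgue" "(\<lambda>\<tau>. epowr (h \<tau>) r) \<in> borel_measurable lebesgue"
    using assms(3,4) by measurable
  have "wint r ?b ?S (\<lambda>\<tau>. epowr (g \<tau> + h \<tau>) r)
      \<le> wint r ?b ?S (\<lambda>\<tau>. ennreal (2 powr r) * (epowr (g \<tau>) r + epowr (h \<tau>) r))"
    using assms(1) by (intro wint_mono epowr_add_le) auto
  also have "\<dots> = ennreal (2 powr r) * wint r ?b ?S (\<lambda>\<tau>. epowr (g \<tau>) r + epowr (h \<tau>) r)"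
    using m by (intro wint_cmult w borel_measurable_add) auto
  also have "wint r ?b ?S (\<lambda>\<tau>. epowr (g \<tau>) r + epowr (h \<tau>) r) = ?I g + ?I h"
    using m by (intro wint_add w) auto
  finally have "inner_norm r p w (\<lambda>\<tau>. g \<tau> + h \<tau>) t
      \<le> ennreal ((2 powr r) powr (1 / r)) * epowr (?I g + ?I h) (1 / r)"
    unfolding inner_norm_eq[OF assms(1,2)] using assms(1) by (intro epowr_le_const_mult) auto
  also have "\<dots> \<le> ennreal 2 * (ennreal (2 powr (1 / r)) * (epowr (?I g) (1 / r) + epowr (?I h) (1 / r)))"
    using assms(1) epowr_add_le[of "1 / r" "?I g" "?I h"] by (simp add: powr_powr mult_left_mono)
  also have "\<dots> = ennreal (2 * 2 powr (1 / r)) * (inner_norm r p w g t + inner_norm r p w h t)"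
    unfolding inner_norm_eq[OF assms(1,2)] by (simp only: ennreal_mult' zero_le_numeral mult.assoc)
  finally show ?thesis .
qed

text \<open>Since \<open>w\<close> is slowly varying, the weight \<open>\<tau>\<^sup>1\<^sup>/\<^sup>p w(\<tau>)\<close> of the inner norm is multiplied by at most
  a constant under dilation by two, and gains a positive power under dilation by \<open>l \<le> 1\<close>.\<close>

lemma inner_norm_dilate_two:
  assumes "0 < r" "0 < p" "slowly_varying w"
  shows "\<exists>C>0. \<forall>g\<in>borel_measurable lebesgue. \<forall>t>0.
    inner_norm r p w (\<lambda>\<tau>. g (\<tau> / 2)) t \<le> ennreal C * inner_norm r p w g t"
proof -
  let ?b = "\<lambda>\<tau>. \<tau> powr (1 / p) * w \<tau>"
  have w: "weight w" "weight ?b" and pos: "\<And>t. 0 < t \<Longrightarrow> 0 < w t"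
    using slowly_varying_weight[OF assms(3)] weight_power_mult[OF slowly_varying_weight[OF assms(3)]]
    by (auto simp: weight_def)
  obtain C where C: "1 \<le> C"
    "\<And>s t. 0 < s \<Longrightarrow> s \<le> t \<Longrightarrow> t \<le> 2 * s \<Longrightarrow> w t \<le> C * w s \<and> w s \<le> C * w t"
    using slowly_varying_doubling[OF assms(3)] by blast
  let ?D = "2 powr (1 / p) * C"
  have "inner_norm r p w (\<lambda>\<tau>. g (\<tau> / 2)) t \<le> ennreal ?D * inner_norm r p w g t"
    if g: "g \<in> borel_measurable lebesgue" and t: "0 < t" for g t
  proof -
    have gm: "(\<lambda>\<tau>. epowr (g \<tau>) r) \<in> borel_measurable lebesgue" using g by measurable
    have "(\<lambda>\<tau>::real. (1 / 2) * \<tau>) \<in> lebesgue \<rightarrow>\<^sub>M lebesgue"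
      using lebesgue_affine_measurable[where c = "\<lambda>_::real. 1 / 2" and t = 0] by simp
    from measurable_compose[OF this gm]
    have gm': "(\<lambda>\<tau>. epowr (g (\<tau> / 2)) r) \<in> borel_measurable lebesgue" by simp
    have "wint r ?b {0<..<t} (\<lambda>\<tau>. epowr (g (\<tau> / 2)) r)
        = wint r (\<lambda>x. ?b (2 * x)) {0<..<t / 2} (\<lambda>\<tau>. epowr (g \<tau>) r)"
      using wint_dilate[OF w(2) _ gm', of 2 r t] by simp
    also have "\<dots> \<le> ennreal (?D powr r) * wint r ?b {0<..<t / 2} (\<lambda>\<tau>. epowr (g \<tau>) r)"
    proof (intro wint_weight_le w(2) gm)
      fix x assume "x \<in> {0<..<t / 2}"
      then have x: "0 < x" by simp
      then have "w (2 * x) \<le> C * w x" using C(2)[of x "2 * x"] by simp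
      then have "2 powr (1 / p) * x powr (1 / p) * w (2 * x) \<le> 2 powr (1 / p) * x powr (1 / p) * (C * w x)"
        by (intro mult_left_mono) auto
      then show "0 \<le> ?b (2 * x) \<and> ?b (2 * x) \<le> ?D * ?b x"
        using x pos[of "2 * x"] by (simp add: powr_mult mult_ac)
    qed (use assms(1) C(1) in auto)
    also have "\<dots> \<le> ennreal (?D powr r) * wint r ?b {0<..<t} (\<lambda>\<tau>. epowr (g \<tau>) r)"
      using t by (intro mult_left_mono wint_mono) auto
    finally have "inner_norm r p w (\<lambda>\<tau>. g (\<tau> / 2)) t \<le> ennreal ((?D powr r) powr (1 / r)) * inner_norm r p w g t"
      unfolding inner_norm_eq[OF assms(1) w(1)] using assms(1) by (intro epowr_le_const_mult) auto
    then show ?thesis using assms(1) C(1) by (simp add: powr_powr)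
  qed
  moreover have "0 < ?D" using C(1) by simp
  ultimately show ?thesis by blast
qed

lemma inner_norm_one_decay:
  assumes "0 < r" "0 < p" "slowly_varying w"
  shows "\<exists>C>0. \<forall>u t. 0 < u \<longrightarrow> u \<le> t \<longrightarrow>
    inner_norm r p w (\<lambda>_. 1) u \<le> ennreal (C * (u / t) powr (1 / (2 * p))) * inner_norm r p w (\<lambda>_. 1) t"
proof -
  let ?b = "\<lambda>\<tau>. \<tau> powr (1 / p) * w \<tau>"
  have w: "weight w" "weight ?b" and pos: "\<And>t. 0 < t \<Longrightarrow> 0 < w t"
    using slowly_varying_weight[OF assms(3)] weight_power_mult[OF slowly_varying_weight[OF assms(3)]]
    by (auto simp: weight_def)
  have half: "0 < 1 / (2 * p)" using assms(2) by simp
  obtain C where C: "1 \<le> C"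
    "\<And>s t. 0 < s \<Longrightarrow> s \<le> t \<Longrightarrow> w s \<le> C * (t / s) powr (1 / (2 * p)) * w t"
    using slowly_varying_power_bounds[OF assms(3) half] by metis
  have "inner_norm r p w (\<lambda>_. 1) u \<le> ennreal (C * (u / t) powr (1 / (2 * p))) * inner_norm r p w (\<lambda>_. 1) t"
    if ut: "0 < u" "u \<le> t" for u t
  proof -
    define l where "l = u / t"
    have l: "0 < l" "l \<le> 1" "u / l = t" using ut by (auto simp: l_def)
    let ?D = "C * l powr (1 / (2 * p))"
    have "mass r ?b {0<..<u} = mass r (\<lambda>x. ?b (l * x)) {0<..<t}"
      using wint_dilate[OF w(2) l(1), of "\<lambda>_. 1" r u] l(3) by simp
    also have "\<dots> \<le> ennreal (?D powr r) * mass r ?b {0<..<t}"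
    proof (intro wint_weight_le w(2))
      fix x assume "x \<in> {0<..<t}"
      then have x: "0 < x" by simp
      have "w (l * x) \<le> C * (x / (l * x)) powr (1 / (2 * p)) * w x"
        using C(2)[of "l * x" x] x l by (simp add: mult_le_cancel_right1)
      also have "\<dots> = C / l powr (1 / (2 * p)) * w x"
        using x l by (simp add: powr_divide)
      finally have "(l * x) powr (1 / p) * w (l * x) \<le> (l * x) powr (1 / p) * (C / l powr (1 / (2 * p)) * w x)"
        by (intro mult_left_mono) auto
      also have "(l * x) powr (1 / p) = l powr (1 / (2 * p)) * l powr (1 / (2 * p)) * x powr (1 / p)"
        using x l by (simp add: powr_mult flip: powr_add)
      also have "l powr (1 / (2 * p)) * l powr (1 / (2 * p)) * x powr (1 / p) * (C / l powr (1 / (2 * p)) * w x) = ?D * ?b x"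
        using l by simp
      finally have "?b (l * x) \<le> ?D * ?b x" using x l by (simp add: powr_mult flip: powr_add)
      then show "0 \<le> ?b (l * x) \<and> ?b (l * x) \<le> ?D * ?b x"
        using x l pos[of "l * x"] by simp
    qed (use assms(1) C(1) in auto)
    finally have "inner_norm r p w (\<lambda>_. 1) u \<le> ennreal ((?D powr r) powr (1 / r)) * inner_norm r p w (\<lambda>_. 1) t"
      unfolding inner_norm_eq[OF assms(1) w(1)] using assms(1)
      by (intro epowr_le_const_mult) (auto simp: epowr_def[of 1])
    then show ?thesis using assms(1) C(1) by (simp add: powr_powr l_def)
  qed
  then show ?thesis using C(1) by (intro exI[of _ C]) auto
qed

section \<open>The K-functional of a couple of gamma spaces\<close>

lemma Gamma_norm_eq:
  assumes "0 < q" "weight b"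
  shows "Gamma_norm M r q p b w f
    = epowr (wint q b {0<..} (\<lambda>t. epowr (inner_norm r p w (rearrangement M f) t) q)) (1 / q)"
  using Lq_norm_eq_wint[of "{0<..}" q b "inner_norm r p w (rearrangement M f)"] assms
  by (auto simp: Gamma_norm_def inner_norm_def weight_def less_imp_le)

lemma Gamma_space_sel [simp]:
  "points (Gamma_space M r q p b w) = {f \<in> borel_measurable M. Gamma_norm M r q p b w f < \<infinity>}"
  "qnorm (Gamma_space M r q p b w) = Gamma_norm M r q p b w"
  by (simp_all add: Gamma_space_def)

lemma K_functional_mono:
  assumes "s \<le> t"
  shows "K_functional A0 A1 s f \<le> K_functional A0 A1 t f"
  unfolding K_functional_def
proof (rule Inf_greatest, safe)
  fix f0 f1 assume f: "f0 \<in> points A0" "f1 \<in> points A1" "f = f0 + f1"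
  have "Inf {qnorm A0 g0 + ennreal s * qnorm A1 g1 | g0 g1. g0 \<in> points A0 \<and> g1 \<in> points A1 \<and> f0 + f1 = g0 + g1}
      \<le> qnorm A0 f0 + ennreal s * qnorm A1 f1"
    using f by (intro Inf_lower) blast
  also have "\<dots> \<le> qnorm A0 f0 + ennreal t * qnorm A1 f1"
    using assms by (intro add_left_mono mult_right_mono ennreal_leI) auto
  finally show "Inf {qnorm A0 g0 + ennreal s * qnorm A1 g1 | g0 g1. g0 \<in> points A0 \<and> g1 \<in> points A1 \<and> f0 + f1 = g0 + g1}
      \<le> qnorm A0 f0 + ennreal t * qnorm A1 f1" .
qed

lemma K_functional_finite_imp_sum_space:
  assumes "K_functional A0 A1 t f < top"
  shows "f \<in> sum_space A0 A1"
proof (rule ccontr)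
  assume "f \<notin> sum_space A0 A1"
  then have "{qnorm A0 f0 + ennreal t * qnorm A1 f1 | f0 f1. f0 \<in> points A0 \<and> f1 \<in> points A1 \<and> f = f0 + f1} = {}"
    unfolding sum_space_def by blast
  then have "K_functional A0 A1 t f = top" unfolding K_functional_def by (simp only: Inf_empty)
  with assms show False by simp
qed

locale gamma_couple =
  fixes M :: "'a measure" and r p q0 q1 :: real and w b0 b1 :: "real \<Rightarrow> real"
  assumes exponents: "0 < r" "0 < p" "0 < q0" "0 < q1"
    and w: "slowly_varying w" and b0: "SV0 q0 b0" and b1: "SV0 q1 b1"
begin

definition F :: "('a \<Rightarrow> real) \<Rightarrow> real \<Rightarrow> ennreal" where
  "F f = inner_norm r p w (rearrangement M f)"

definition a0 :: "real \<Rightarrow> real" where "a0 t = tail_mass q0 b0 t powr (1 / q0)"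

definition a1 :: "real \<Rightarrow> real" where "a1 t = tail_mass q1 b1 t powr (1 / q1)"

abbreviation "\<rho> \<equiv> rho q0 q1 b0 b1"

abbreviation "\<Gamma>0 \<equiv> Gamma_space M r q0 p b0 w"

abbreviation "\<Gamma>1 \<equiv> Gamma_space M r q1 p b1 w"

abbreviation K :: "real \<Rightarrow> ('a \<Rightarrow> real) \<Rightarrow> ennreal" where
  "K \<equiv> K_functional \<Gamma>0 \<Gamma>1"

text \<open>The two parts of a formula of Holmstedt type for the K-functional at \<open>\<rho> t\<close>: the quasi-norm of
  the first space over \<open>(0, t)\<close> and that of the second space over \<open>(t, \<infinity>)\<close>.\<close>

definition head_norm :: "('a \<Rightarrow> real) \<Rightarrow> real \<Rightarrow> ennreal" where
  "head_norm f t = epowr (wint q0 b0 {0<..t} (\<lambda>u. epowr (F f u) q0)) (1 / q0)"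

definition rest_norm :: "('a \<Rightarrow> real) \<Rightarrow> real \<Rightarrow> ennreal" where
  "rest_norm f t = epowr (wint q1 b1 {t<..} (\<lambda>u. epowr (F f u) q1)) (1 / q1)"

lemma weights: "weight w" "weight b0" "weight b1"
  using w b0 b1 by (auto simp: SV0_def intro: slowly_varying_weight)

lemma a_pos: "0 < t \<Longrightarrow> 0 < a0 t" "0 < t \<Longrightarrow> 0 < a1 t"
  using tail_mass_pos[OF b0 exponents(3), of t] tail_mass_pos[OF b1 exponents(4), of t]
  by (auto simp: a0_def a1_def)

lemma rho_eq: "0 < t \<Longrightarrow> \<rho> t = a0 t / a1 t"
  using exponents b0 b1 by (simp add: rho_def enn2real_tail_norm a0_def a1_def)

lemma rho_pos: "0 < t \<Longrightarrow> 0 < \<rho> t"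
  using a_pos[of t] by (simp add: rho_eq)

lemma F_mono: "s \<le> t \<Longrightarrow> F f s \<le> F f t"
  unfolding F_def using exponents weights by (intro inner_norm_mono) auto

lemma measurable_F_powr: "(\<lambda>u. epowr (F f u) q) \<in> borel_measurable lebesgue"
  using measurable_inner_norm[OF exponents(1) weights(1), of p "rearrangement M f"]
  unfolding F_def by measurable

lemma Gamma0_norm_eq: "Gamma_norm M r q0 p b0 w f = epowr (wint q0 b0 {0<..} (\<lambda>u. epowr (F f u) q0)) (1 / q0)"
  unfolding F_def by (rule Gamma_norm_eq[OF exponents(3) weights(2)])

lemma Gamma1_norm_eq: "Gamma_norm M r q1 p b1 w f = epowr (wint q1 b1 {0<..} (\<lambda>u. epowr (F f u) q1)) (1 / q1)"
  unfolding F_def by (rule Gamma_norm_eq[OF exponents(4) weights(3)])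

text \<open>As \<open>F f\<close> is non-decreasing, its value at \<open>t\<close> is controlled by the weighted norm over the
  tail \<open>(t, \<infinity>)\<close> alone.\<close>

lemma tail_mass_F_le:
  assumes "SV0 q b" "0 < q" "0 < t"
  shows "ennreal (tail_mass q b t) * epowr (F f t) q \<le> wint q b {t<..} (\<lambda>u. epowr (F f u) q)"
proof -
  have "weight b" using assms(1) by (auto simp: SV0_def intro: slowly_varying_weight)
  then have "wint q b {t<..} (\<lambda>u. epowr (F f t) q * 1) = epowr (F f t) q * mass q b {t<..}"
    using assms(3) by (intro wint_cmult) auto
  then have "ennreal (tail_mass q b t) * epowr (F f t) q = wint q b {t<..} (\<lambda>u. epowr (F f t) q)"
    using mass_tail[OF assms] by (simp add: mult.commute)
  also have "\<dots> \<le> wint q b {t<..} (\<lambda>u. epowr (F f u) q)"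
    using assms(2) by (intro wint_mono epowr_mono F_mono) auto
  finally show ?thesis .
qed

lemma a0_F_le_Gamma0:
  assumes "0 < t"
  shows "ennreal (a0 t) * F f t \<le> Gamma_norm M r q0 p b0 w f"
proof -
  have "ennreal (tail_mass q0 b0 t) * epowr (F f t) q0 \<le> wint q0 b0 {0<..} (\<lambda>u. epowr (F f u) q0)"
    using tail_mass_F_le[OF b0 exponents(3) assms, of f] assms
    by (elim order_trans) (intro wint_mono, auto)
  from epowr_mono[OF this, of "1 / q0"] show ?thesis
    using exponents(3) tail_mass_pos[OF b0 exponents(3) assms]
    by (simp add: Gamma0_norm_eq a0_def epowr_mult epowr_epowr epowr_ennreal)
qed

lemma a1_F_le_rest:
  assumes "0 < t"
  shows "ennreal (a1 t) * F f t \<le> rest_norm f t"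
  using epowr_mono[OF tail_mass_F_le[OF b1 exponents(4) assms, of f], of "1 / q1"]
    exponents(4) tail_mass_pos[OF b1 exponents(4) assms]
  by (simp add: rest_norm_def a1_def epowr_mult epowr_epowr epowr_ennreal)

lemma rest_le_Gamma1:
  assumes "0 < t"
  shows "rest_norm f t \<le> Gamma_norm M r q1 p b1 w f"
  unfolding rest_norm_def Gamma1_norm_eq using assms exponents
  by (intro epowr_mono wint_mono) auto

lemma F_add:
  "\<exists>C>0. \<forall>f\<in>borel_measurable M. \<forall>g\<in>borel_measurable M. \<forall>t>0.
    F (f + g) t \<le> ennreal C * (F f t + F g t)"
proof -
  obtain C where C: "0 < C" "\<And>g t. g \<in> borel_measurable lebesgue \<Longrightarrow> 0 < t \<Longrightarrow>
      inner_norm r p w (\<lambda>\<tau>. g (\<tau> / 2)) t \<le> ennreal C * inner_norm r p w g t"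
    using inner_norm_dilate_two[OF exponents(1,2) w] by blast
  define D where "D = 2 * 2 powr (1 / r)"
  have D: "0 < D" by (simp add: D_def)
  have "F (f + g) t \<le> ennreal (D * C) * (F f t + F g t)"
    if "f \<in> borel_measurable M" "g \<in> borel_measurable M" "0 < t" for f g t
  proof -
    have "F (f + g) t \<le> inner_norm r p w (\<lambda>\<tau>. rearrangement M f (\<tau> / 2) + rearrangement M g (\<tau> / 2)) t"
      unfolding F_def plus_fun_def using that exponents weights
      by (intro inner_norm_mono rearrangement_add) auto
    also have "\<dots> \<le> ennreal D * (inner_norm r p w (\<lambda>\<tau>. rearrangement M f (\<tau> / 2)) t
        + inner_norm r p w (\<lambda>\<tau>. rearrangement M g (\<tau> / 2)) t)"
      unfolding D_def by (intro inner_norm_add exponents weights measurable_rearrangement_dilated)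
    also have "\<dots> \<le> ennreal D * (ennreal C * F f t + ennreal C * F g t)"
      unfolding F_def using that by (intro mult_left_mono add_mono C measurable_rearrangement) auto
    also have "\<dots> = ennreal (D * C) * (F f t + F g t)"
      using C(1) D by (simp add: ennreal_mult distrib_left mult.assoc)
    finally show ?thesis .
  qed
  moreover have "0 < D * C" using C(1) D by simp
  ultimately show ?thesis by blast
qed

text \<open>For any decomposition \<open>f = f0 + f1\<close> the value \<open>F f t\<close> is controlled by \<open>F f0 t + F f1 t\<close>, and
  multiplication by \<open>a0 t = \<rho> t * a1 t\<close> turns the two terms into lower bounds for the two
  quasi-norms of the K-functional.\<close>

lemma K_lower:
  "\<exists>C>0. \<forall>f. \<forall>t>0. ennreal (a0 t) * F f t \<le> ennreal C * K (\<rho> t) f"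
proof -
  obtain C where C: "0 < C" "\<And>f g t. f \<in> borel_measurable M \<Longrightarrow> g \<in> borel_measurable M \<Longrightarrow> 0 < t \<Longrightarrow>
      F (f + g) t \<le> ennreal C * (F f t + F g t)"
    using F_add by blast
  have "ennreal (a0 t) * F f t \<le> ennreal C * K (\<rho> t) f" if t: "0 < t" for f t
  proof -
    have a: "0 < a0 t" "0 < a1 t" "a0 t = \<rho> t * a1 t" "0 < \<rho> t"
      using a_pos[OF t] rho_pos[OF t] by (auto simp: rho_eq[OF t])
    have "ennreal (1 / C) * (ennreal (a0 t) * F f t) \<le> K (\<rho> t) f"
      unfolding K_functional_def
    proof (rule Inf_greatest, safe)
      fix f0 f1 assume f: "f0 \<in> points \<Gamma>0" "f1 \<in> points \<Gamma>1"
      then have "F (f0 + f1) t \<le> ennreal C * (F f0 t + F f1 t)" using t by (intro C(2)) auto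
      then have "ennreal (1 / C) * (ennreal (a0 t) * F (f0 + f1) t)
          \<le> ennreal (1 / C) * (ennreal (a0 t) * (ennreal C * (F f0 t + F f1 t)))"
        by (intro mult_left_mono) auto
      also have "\<dots> = (ennreal (1 / C) * ennreal C) * (ennreal (a0 t) * (F f0 t + F f1 t))"
        by (simp only: mult_ac)
      also have "ennreal (1 / C) * ennreal C = 1"
        using C(1) by (simp flip: ennreal_mult)
      also have "1 * (ennreal (a0 t) * (F f0 t + F f1 t))
          = ennreal (a0 t) * F f0 t + ennreal (\<rho> t) * (ennreal (a1 t) * F f1 t)"
        using a by (simp add: distrib_left ennreal_mult mult.assoc)
      also have "\<dots> \<le> qnorm \<Gamma>0 f0 + ennreal (\<rho> t) * qnorm \<Gamma>1 f1"
        using a0_F_le_Gamma0[OF t] order_trans[OF a1_F_le_rest[OF t] rest_le_Gamma1[OF t]]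
        by (auto intro!: add_mono mult_left_mono)
      finally show "ennreal (1 / C) * (ennreal (a0 t) * F (f0 + f1) t) \<le> qnorm \<Gamma>0 f0 + ennreal (\<rho> t) * qnorm \<Gamma>1 f1" .
    qed
    then have "ennreal C * (ennreal (1 / C) * (ennreal (a0 t) * F f t)) \<le> ennreal C * K (\<rho> t) f"
      by (rule mult_left_mono) simp
    moreover have "ennreal C * (ennreal (1 / C) * (ennreal (a0 t) * F f t)) = ennreal (a0 t) * F f t"
      using C(1) by (simp flip: mult.assoc ennreal_mult)
    ultimately show ?thesis by simp
  qed
  with C(1) show ?thesis by blast
qed

text \<open>As \<open>f0\<^sup>*\<close> vanishes after \<open>t\<close>, the function \<open>F f0\<close> is constant there and contributes at most
  \<open>a0 t * F f t = \<rho> t * a1 t * F f t\<close>, which the tail of the second quasi-norm dominates.  No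
  separate middle summand \<open>a0 t * F f t\<close> is therefore left in the upper bound.\<close>

lemma high_part_norm:
  assumes "0 < t" "\<And>s. rearrangement M f0 s \<le> rearrangement M f s"
    "\<And>s. t \<le> s \<Longrightarrow> rearrangement M f0 s = 0"
  shows "Gamma_norm M r q0 p b0 w f0
    \<le> ennreal (2 powr (1 / q0)) * (head_norm f t + ennreal (\<rho> t) * rest_norm f t)"
proof -
  have F0: "F f0 u \<le> F f u" for u
    unfolding F_def using exponents weights assms(2) by (intro inner_norm_mono) auto
  have F0': "F f0 u \<le> F f t" if "t \<le> u" for u
  proof -
    have "wint r (\<lambda>\<tau>. \<tau> powr (1 / p) * w \<tau>) {0<..<u} (\<lambda>\<tau>. epowr (rearrangement M f0 \<tau>) r)
      \<le> wint r (\<lambda>\<tau>. \<tau> powr (1 / p) * w \<tau>) {0<..<t} (\<lambda>\<tau>. epowr (rearrangement M f \<tau>) r)"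
      unfolding wint_def using assms(2,3) exponents
      by (intro nn_integral_mono) (auto split: split_indicator intro!: mult_left_mono epowr_mono)
    then show ?thesis
      unfolding F_def using exponents weights by (simp add: inner_norm_eq epowr_mono)
  qed
  have a: "0 < a0 t" "0 < a1 t" "a0 t = \<rho> t * a1 t" "0 < \<rho> t"
    using a_pos[OF assms(1)] rho_pos[OF assms(1)] by (auto simp: rho_eq[OF assms(1)])
  have "wint q0 b0 {0<..} (\<lambda>u. epowr (F f0 u) q0)
      = wint q0 b0 {0<..t} (\<lambda>u. epowr (F f0 u) q0) + wint q0 b0 {t<..} (\<lambda>u. epowr (F f0 u) q0)"
    using assms(1) weights measurable_F_powr[of f0 q0]
    by (subst wint_Un[symmetric]) (auto simp: ivl_disj_un)
  also have "\<dots> \<le> wint q0 b0 {0<..t} (\<lambda>u. epowr (F f u) q0) + wint q0 b0 {t<..} (\<lambda>u. epowr (F f t) q0 * 1)"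
    using F0 F0' exponents by (intro add_mono wint_mono) (auto intro!: epowr_mono)
  also have "wint q0 b0 {t<..} (\<lambda>u. epowr (F f t) q0 * 1) = epowr (F f t) q0 * ennreal (tail_mass q0 b0 t)"
    using assms(1) weights by (subst wint_cmult) (auto simp: mass_tail[OF b0 exponents(3)])
  also have "\<dots> = epowr (ennreal (a0 t) * F f t) q0"
    using exponents tail_mass_pos[OF b0 exponents(3) assms(1)]
    by (simp add: epowr_mult epowr_ennreal a0_def powr_powr mult.commute)
  also have "\<dots> \<le> epowr (ennreal (\<rho> t) * rest_norm f t) q0"
    using a1_F_le_rest[OF assms(1), of f] a exponents
    by (intro epowr_mono) (auto simp: ennreal_mult mult.assoc intro!: mult_left_mono)
  finally have "Gamma_norm M r q0 p b0 w f0
      \<le> epowr (wint q0 b0 {0<..t} (\<lambda>u. epowr (F f u) q0) + epowr (ennreal (\<rho> t) * rest_norm f t) q0) (1 / q0)"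
    unfolding Gamma0_norm_eq using exponents by (intro epowr_mono) auto
  also have "\<dots> \<le> ennreal (2 powr (1 / q0)) * (head_norm f t + ennreal (\<rho> t) * rest_norm f t)"
    using epowr_add_le[of "1 / q0"] exponents
    by (metis epowr_inverse_exponent(1) head_norm_def zero_less_divide_1_iff)
  finally show ?thesis .
qed

text \<open>The part below the height \<open>c = f\<^sup>*(t)\<close> has \<open>F f1 \<le> F f\<close>, which is used after \<open>t\<close>, while on
  \<open>(0, t)\<close> the bound \<open>f1 \<le> c\<close> makes \<open>F f1\<close> decay like a power at zero, fast enough to absorb
  any slowly varying weight.\<close>

lemma low_part_norm:
  "\<exists>C>0. \<forall>f f1 c t. 0 < t \<longrightarrow> rearrangement M f t = c \<longrightarrow> (\<forall>s. rearrangement M f1 s \<le> rearrangement M f s)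
    \<longrightarrow> (\<forall>s. rearrangement M f1 s \<le> c) \<longrightarrow> Gamma_norm M r q1 p b1 w f1 \<le> ennreal C * rest_norm f t"
proof -
  let ?W = "inner_norm r p w (\<lambda>_. 1)"
  obtain Cw where Cw: "0 < Cw" "\<And>u t. 0 < u \<Longrightarrow> u \<le> t \<Longrightarrow>
      ?W u \<le> ennreal (Cw * (u / t) powr (1 / (2 * p))) * ?W t"
    using inner_norm_one_decay[OF exponents(1,2) w] by blast
  define \<delta> where "\<delta> = q1 / (2 * p)"
  have \<delta>: "0 < \<delta>" using exponents by (simp add: \<delta>_def)
  have sv: "slowly_varying b1" using b1 by (simp add: SV0_def)
  obtain C1 where C1: "0 < C1" "\<And>t. 0 < t \<Longrightarrow>
      wint q1 b1 {0<..t} (\<lambda>u. ennreal ((u / t) powr \<delta>)) \<le> ennreal C1 * ennreal (b1 t powr q1)"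
    using slowly_varying_power_integral_le[OF sv exponents(4) \<delta>] by blast
  obtain C2 where C2: "0 < C2" "\<And>t. 0 < t \<Longrightarrow> ennreal (b1 t powr q1) \<le> ennreal C2 * mass q1 b1 {t<..}"
    using slowly_varying_le_tail_mass[OF sv exponents(4)] by blast
  define D where "D = Cw powr q1 * C1 * C2"
  have D: "0 < D" using Cw C1 C2 by (simp add: D_def)
  have "Gamma_norm M r q1 p b1 w f1 \<le> ennreal ((D + 1) powr (1 / q1)) * rest_norm f t"
    if t: "0 < t" and c: "rearrangement M f t = c" and le: "\<And>s. rearrangement M f1 s \<le> rearrangement M f s"
      and bd: "\<And>s. rearrangement M f1 s \<le> c" for f f1 c t
  proof -
    let ?R = "wint q1 b1 {t<..} (\<lambda>u. epowr (F f u) q1)"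
    have F1: "F f1 u \<le> F f u" for u
      unfolding F_def using exponents weights le by (intro inner_norm_mono) auto
    have cW: "c * ?W t \<le> F f t"
      unfolding F_def inner_norm_const[OF exponents(1) weights(1), symmetric] using exponents weights
      by (intro inner_norm_mono) (auto simp flip: c intro: rearrangement_antimono)
    have near: "F f1 u \<le> ennreal (Cw * (u / t) powr (1 / (2 * p))) * F f t" if u: "0 < u" "u \<le> t" for u
    proof -
      have "F f1 u \<le> inner_norm r p w (\<lambda>_. c) u"
        unfolding F_def using exponents weights bd by (intro inner_norm_mono) auto
      also have "\<dots> = c * ?W u" by (rule inner_norm_const[OF exponents(1) weights(1)])
      also have "\<dots> \<le> c * (ennreal (Cw * (u / t) powr (1 / (2 * p))) * ?W t)"
        by (intro mult_left_mono Cw u) simp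
      also have "\<dots> = ennreal (Cw * (u / t) powr (1 / (2 * p))) * (c * ?W t)" by (simp only: mult_ac)
      also have "\<dots> \<le> ennreal (Cw * (u / t) powr (1 / (2 * p))) * F f t"
        by (intro mult_left_mono cW) simp
      finally show ?thesis .
    qed
    have near_pow: "epowr (F f1 u) q1 \<le> (ennreal (Cw powr q1) * epowr (F f t) q1) * ennreal ((u / t) powr \<delta>)"
      if u: "u \<in> {0<..t}" for u
    proof -
      have "epowr (F f1 u) q1 \<le> ennreal ((Cw * (u / t) powr (1 / (2 * p))) powr q1) * epowr (F f t) q1"
        using near[of u] u Cw(1) exponents by (intro epowr_le_const_mult) auto
      also have "(Cw * (u / t) powr (1 / (2 * p))) powr q1 = Cw powr q1 * (u / t) powr \<delta>"
        using Cw(1) by (simp add: powr_mult powr_powr \<delta>_def)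
      finally show ?thesis using Cw(1) by (simp add: ennreal_mult mult_ac)
    qed
    have "wint q1 b1 {0<..t} (\<lambda>u. epowr (F f1 u) q1)
        \<le> wint q1 b1 {0<..t} (\<lambda>u. (ennreal (Cw powr q1) * epowr (F f t) q1) * ennreal ((u / t) powr \<delta>))"
      by (intro wint_mono near_pow order_refl)
    also have "\<dots> = (ennreal (Cw powr q1) * epowr (F f t) q1) * wint q1 b1 {0<..t} (\<lambda>u. ennreal ((u / t) powr \<delta>))"
      using weights by (intro wint_cmult) (auto intro!: measurable_completion)
    also have "\<dots> \<le> (ennreal (Cw powr q1) * epowr (F f t) q1) * (ennreal C1 * (ennreal C2 * mass q1 b1 {t<..}))"
      using C1(2)[OF t] C2(2)[OF t] by (intro mult_left_mono order_trans[OF C1(2)[OF t]]) auto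
    also have "\<dots> = ennreal D * (ennreal (tail_mass q1 b1 t) * epowr (F f t) q1)"
      using Cw(1) C1(1) C2(1) mass_tail[OF b1 exponents(4) t] by (simp add: D_def ennreal_mult mult_ac)
    also have "\<dots> \<le> ennreal D * ?R"
      by (intro mult_left_mono tail_mass_F_le b1 exponents t) simp
    finally have near_int: "wint q1 b1 {0<..t} (\<lambda>u. epowr (F f1 u) q1) \<le> ennreal D * ?R" .
    have "wint q1 b1 {0<..} (\<lambda>u. epowr (F f1 u) q1)
        = wint q1 b1 {0<..t} (\<lambda>u. epowr (F f1 u) q1) + wint q1 b1 {t<..} (\<lambda>u. epowr (F f1 u) q1)"
      using t weights measurable_F_powr[of f1 q1]
      by (subst wint_Un[symmetric]) (auto simp: ivl_disj_un)
    also have "\<dots> \<le> ennreal D * ?R + ?R"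
      using near_int F1 exponents by (intro add_mono wint_mono epowr_mono) auto
    also have "\<dots> = ennreal (D + 1) * ?R"
      using D by (simp add: distrib_right)
    finally show ?thesis
      unfolding Gamma1_norm_eq rest_norm_def using exponents D by (intro epowr_le_const_mult) auto
  qed
  moreover have "0 < (D + 1) powr (1 / q1)" using D by simp
  ultimately show ?thesis by blast
qed

text \<open>The upper bound comes from the truncation of \<open>f\<close> at the height \<open>f\<^sup>*(t)\<close>.  This height is finite
  as soon as the right-hand side is, because \<open>F f t\<close> dominates \<open>f\<^sup>*(t)\<close> times the norm of the constant
  function one.\<close>

lemma K_upper:
  "\<exists>C>0. \<forall>f\<in>borel_measurable M. \<forall>t>0. K (\<rho> t) f \<le> ennreal C * (head_norm f t + ennreal (\<rho> t) * rest_norm f t)"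
proof -
  obtain C where C: "0 < C" "\<And>f f1 c t. 0 < t \<Longrightarrow> rearrangement M f t = c
      \<Longrightarrow> (\<And>s. rearrangement M f1 s \<le> rearrangement M f s)
      \<Longrightarrow> (\<And>s. rearrangement M f1 s \<le> c) \<Longrightarrow> Gamma_norm M r q1 p b1 w f1 \<le> ennreal C * rest_norm f t"
    using low_part_norm by metis
  let ?D = "2 powr (1 / q0) + C"
  have "K (\<rho> t) f \<le> ennreal ?D * (head_norm f t + ennreal (\<rho> t) * rest_norm f t)"
    if f: "f \<in> borel_measurable M" and t: "0 < t" for f t
  proof (cases "head_norm f t + ennreal (\<rho> t) * rest_norm f t = top")
    case True
    have "0 < ?D" using C(1) by (simp add: add_pos_pos)
    then have "ennreal ?D * top = top" by (simp add: ennreal_mult_top del: ennreal_plus)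
    then show ?thesis unfolding True by simp
  next
    case False
    have \<rho>: "0 < \<rho> t" by (rule rho_pos[OF t])
    from False \<rho> have fin: "rest_norm f t < top"
      by (auto simp: ennreal_mult_eq_top_iff less_top)
    have "F f t \<noteq> top"
    proof
      assume "F f t = top"
      then have "rest_norm f t = top"
        using a1_F_le_rest[OF t, of f] a_pos[OF t] by (simp add: ennreal_mult_top top_unique)
      with fin show False by simp
    qed
    moreover have "rearrangement M f t * inner_norm r p w (\<lambda>_. 1) t \<le> F f t"
      unfolding F_def inner_norm_const[OF exponents(1) weights(1), symmetric] using exponents weights
      by (intro inner_norm_mono) (auto intro: rearrangement_antimono)
    ultimately have "rearrangement M f t \<noteq> top"
      using inner_norm_one_pos[OF exponents(1) weights(1) t, of p] by (auto simp: ennreal_top_mult top_unique)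
    then obtain c where c: "rearrangement M f t = ennreal c" "0 \<le> c" by (metis ennreal_cases)
    obtain f0 f1 where sp: "f0 \<in> borel_measurable M" "f1 \<in> borel_measurable M" "f = f0 + f1"
      "\<And>s. rearrangement M f0 s \<le> rearrangement M f s" "\<And>s. t \<le> s \<Longrightarrow> rearrangement M f0 s = 0"
      "\<And>s. rearrangement M f1 s \<le> rearrangement M f s" "\<And>s. rearrangement M f1 s \<le> ennreal c"
      by (rule truncation_at_rearrangement[OF f c]) blast
    have n0: "Gamma_norm M r q0 p b0 w f0
        \<le> ennreal (2 powr (1 / q0)) * (head_norm f t + ennreal (\<rho> t) * rest_norm f t)"
      by (rule high_part_norm[OF t sp(4,5)])
    have n1: "Gamma_norm M r q1 p b1 w f1 \<le> ennreal C * rest_norm f t"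
      by (rule C(2)[OF t c(1) sp(6,7)])
    have "Gamma_norm M r q0 p b0 w f0 < top"
      using n0 False by (auto simp: ennreal_mult_less_top less_top intro: le_less_trans)
    moreover have "Gamma_norm M r q1 p b1 w f1 < top"
      using n1 fin by (auto simp: ennreal_mult_less_top less_top intro: le_less_trans)
    ultimately have "K (\<rho> t) f \<le> Gamma_norm M r q0 p b0 w f0 + ennreal (\<rho> t) * Gamma_norm M r q1 p b1 w f1"
      unfolding K_functional_def using sp(1-3) by (intro Inf_lower) auto
    also have "\<dots> \<le> ennreal (2 powr (1 / q0)) * (head_norm f t + ennreal (\<rho> t) * rest_norm f t)
        + ennreal (\<rho> t) * (ennreal C * rest_norm f t)"
      by (intro add_mono mult_left_mono n0 n1) simp
    also have "ennreal (\<rho> t) * (ennreal C * rest_norm f t) = ennreal C * (ennreal (\<rho> t) * rest_norm f t)"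
      by (simp only: mult_ac)
    also have "\<dots> \<le> ennreal C * (head_norm f t + ennreal (\<rho> t) * rest_norm f t)"
      by (intro mult_left_mono) auto
    also have "ennreal (2 powr (1 / q0)) * (head_norm f t + ennreal (\<rho> t) * rest_norm f t)
        + ennreal C * (head_norm f t + ennreal (\<rho> t) * rest_norm f t)
        = ennreal ?D * (head_norm f t + ennreal (\<rho> t) * rest_norm f t)"
      using C(1) by (simp add: ennreal_plus distrib_right)
    finally show ?thesis by (simp add: add_left_mono)
  qed
  moreover have "0 < ?D" using C(1) by (simp add: add_pos_pos)
  ultimately show ?thesis by blast
qed

end

section \<open>Discretization along the level points of \<open>\<rho>\<close>\<close>

lemma powr_comparable:
  fixes x y C e :: real
  assumes "0 < x" "0 < y" "1 \<le> C" "x \<le> C * y" "y \<le> C * x"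
  shows "x powr e \<le> C powr \<bar>e\<bar> * y powr e"
proof (cases "0 \<le> e")
  case True
  then have "x powr e \<le> (C * y) powr e" using assms by (intro powr_mono2) auto
  then show ?thesis using True assms by (simp add: powr_mult)
next
  case False
  then have "(C * x) powr e \<le> y powr e" using assms by (intro powr_mono2') auto
  then have "C powr (- e) * (C powr e * x powr e) \<le> C powr (- e) * y powr e"
    using assms by (intro mult_left_mono) (simp_all add: powr_mult)
  moreover have "C powr (- e) * (C powr e * x powr e) = x powr e"
    using assms by (simp add: powr_minus)
  ultimately show ?thesis using False by simp
qed

lemma slowly_varying_power_doubling:
  assumes "slowly_varying b"
  shows "\<exists>C\<ge>1. \<forall>s t. 0 < s \<longrightarrow> s \<le> t \<longrightarrow> t \<le> 2 * s \<longrightarrow>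
    t powr a * b t \<le> C * (s powr a * b s) \<and> s powr a * b s \<le> C * (t powr a * b t)"
proof -
  have pos: "\<And>t. 0 < t \<Longrightarrow> 0 < b t" using assms by (simp add: slowly_varying_def)
  obtain C where C: "1 \<le> C"
    "\<And>s t. 0 < s \<Longrightarrow> s \<le> t \<Longrightarrow> t \<le> 2 * s \<Longrightarrow> b t \<le> C * b s \<and> b s \<le> C * b t"
    using slowly_varying_doubling[OF assms] by blast
  have "t powr a * b t \<le> (2 powr \<bar>a\<bar> * C) * (s powr a * b s) \<and> s powr a * b s \<le> (2 powr \<bar>a\<bar> * C) * (t powr a * b t)"
    if st: "0 < s" "s \<le> t" "t \<le> 2 * s" for s t
  proof -
    have b: "b t \<le> C * b s" "b s \<le> C * b t" using C(2)[OF st] by auto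
    have p: "t powr a \<le> 2 powr \<bar>a\<bar> * s powr a" "s powr a \<le> 2 powr \<bar>a\<bar> * t powr a"
      using st by (auto intro!: powr_comparable)
    have "t powr a * b t \<le> (2 powr \<bar>a\<bar> * s powr a) * (C * b s)"
      using p b pos[of t] st by (intro mult_mono) auto
    moreover have "s powr a * b s \<le> (2 powr \<bar>a\<bar> * t powr a) * (C * b t)"
      using p b pos[of s] st by (intro mult_mono) auto
    ultimately show ?thesis by (simp only: mult_ac)
  qed
  moreover have "1 \<le> 2 powr \<bar>a\<bar> * C"
    using C(1) ge_one_powr_ge_zero[of 2 "\<bar>a\<bar>"] mult_mono[of 1 "2 powr \<bar>a\<bar>" 1 C] by simp
  ultimately show ?thesis by blast
qed

lemma dyadic_level:
  assumes "0 < (y::real)"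
  shows "\<exists>k::int. 2 powr of_int k < y \<and> y \<le> 2 powr of_int (k + 1)"
proof -
  let ?k = "\<lceil>log 2 y\<rceil> - 1"
  have "2 powr of_int ?k < 2 powr log 2 y" "2 powr log 2 y \<le> 2 powr of_int (?k + 1)"
    by (intro powr_less_mono powr_mono; linarith)+
  then show ?thesis using assms by (intro exI[of _ ?k]) simp
qed

lemma dyadic_level_unique:
  fixes k l :: int and y :: real
  assumes "2 powr of_int k < y" "y \<le> 2 powr of_int (k + 1)" "2 powr of_int l < y" "y \<le> 2 powr of_int (l + 1)"
  shows "k = l"
proof -
  have "2 powr of_int k < (2::real) powr of_int (l + 1)" "2 powr of_int l < (2::real) powr of_int (k + 1)"
    using assms by linarith+
  then show ?thesis by simp
qed

locale gamma_reiteration = gamma_couple M r p q0 q1 w b0 b1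
  for M :: "'a measure" and r p q0 q1 :: real and w b0 b1 :: "real \<Rightarrow> real" +
  fixes q \<theta> :: real and b :: "real \<Rightarrow> real"
  assumes q: "0 < q" and \<theta>: "0 < \<theta>" "\<theta> < 1" and b: "slowly_varying b"
    and rho_eps_mono: "\<exists>\<epsilon>>0. \<exists>h. mono_on {0<..} h \<and> equivalent_pos (rho_eps \<epsilon> q0 q1 b0 b1) h"
    and rho_strict_mono: "strict_mono_on {0<..} \<rho>"
    and rho_at_0: "(\<rho> \<longlongrightarrow> 0) (at_right 0)"
    and rho_at_top: "filterlim \<rho> at_top at_top"
begin

lemma a_antimono:
  assumes "0 < s" "s \<le> t"
  shows "a0 t \<le> a0 s" "a1 t \<le> a1 s"
  using assms exponents tail_mass_antimono[OF b0 exponents(3) assms] tail_mass_antimono[OF b1 exponents(4) assms]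
    tail_mass_pos[OF b0 exponents(3), of t] tail_mass_pos[OF b1 exponents(4), of t]
  by (auto simp: a0_def a1_def intro!: powr_mono2)

lemma rho_continuous: "continuous_on {0<..} \<rho>"
proof -
  have root: "continuous_on {0<..} (\<lambda>t. tail_mass q' b' t powr (1 / q'))" if "SV0 q' b'" "0 < q'" for q' b'
  proof (intro continuous_on_powr tail_mass_continuous continuous_on_const that ballI)
    fix t :: real assume "t \<in> {0<..}"
    then show "tail_mass q' b' t \<noteq> 0" using tail_mass_pos[OF that, of t] by simp
  qed
  have "\<forall>t\<in>{0<..}. a1 t \<noteq> 0" using a_pos(2) by (metis greaterThan_iff less_irrefl)
  then have "continuous_on {0<..} (\<lambda>t. a0 t / a1 t)"
    using root[OF b0 exponents(3)] root[OF b1 exponents(4)]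
    by (intro continuous_on_divide) (simp_all add: a0_def[abs_def] a1_def[abs_def])
  then show ?thesis by (rule continuous_on_eq) (simp add: rho_eq)
qed

lemma rho_surj:
  assumes "0 < s"
  shows "\<exists>t>0. \<rho> t = s"
proof -
  have "eventually (\<lambda>t. \<rho> t < s) (at_right 0)"
    using rho_at_0 assms by (rule order_tendstoD)
  moreover have "eventually (\<lambda>t::real. 0 < t) (at_right 0)" by (rule eventually_at_right_less)
  ultimately have "eventually (\<lambda>t. \<rho> t < s \<and> 0 < t) (at_right 0)" by (rule eventually_conj)
  then obtain x where x: "\<rho> x < s" "0 < x"
    using eventually_happens'[OF trivial_limit_at_right_real] by blast
  have "eventually (\<lambda>t. s \<le> \<rho> t) at_top" using rho_at_top by (simp add: filterlim_at_top)
  moreover have "eventually (\<lambda>t. x \<le> t) at_top" by (rule eventually_ge_at_top)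
  ultimately have "eventually (\<lambda>t. s \<le> \<rho> t \<and> x \<le> t) at_top" by (rule eventually_conj)
  then obtain y where y: "s \<le> \<rho> y" "x \<le> y"
    using eventually_happens'[OF trivial_limit_at_top_linorder] by blast
  have "continuous_on {x..y} \<rho>"
    using x by (intro continuous_on_subset[OF rho_continuous]) auto
  then obtain t where "x \<le> t" "\<rho> t = s" using IVT'[of \<rho> x s y] x y by auto
  then show ?thesis using x by (intro exI[of _ t]) auto
qed

lemma rho_less_iff: "0 < x \<Longrightarrow> 0 < y \<Longrightarrow> \<rho> x < \<rho> y \<longleftrightarrow> x < y"
  using strict_mono_on_less[OF rho_strict_mono, of x y] by simp

text \<open>The continuous increasing bijection \<open>\<rho>\<close> of \<open>(0, \<infinity>)\<close> pulls the dyadic points back to a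
  partition on whose intervals \<open>\<rho>\<close>, \<open>a0\<close> and \<open>a1\<close> are all constant up to bounded factors.\<close>

definition T :: "int \<Rightarrow> real" where
  "T k = (SOME t. 0 < t \<and> \<rho> t = 2 powr of_int k)"

lemma T_pos: "0 < T k" and rho_T: "\<rho> (T k) = 2 powr of_int k"
  using someI_ex[of "\<lambda>t. 0 < t \<and> \<rho> t = 2 powr of_int k"] rho_surj[of "2 powr of_int k"]
  by (auto simp: T_def)

definition I :: "int \<Rightarrow> real set" where "I k = {T k<..T (k + 1)}"

lemma mem_I_iff: "0 < x \<Longrightarrow> x \<in> I k \<longleftrightarrow> 2 powr of_int k < \<rho> x \<and> \<rho> x \<le> 2 powr of_int (k + 1)"
  using rho_less_iff[of "T k" x] rho_less_iff[of "T (k + 1)" x] T_pos[of k] T_pos[of "k + 1"]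
  by (auto simp: I_def rho_T simp flip: not_less)

lemma I_pos: "x \<in> I k \<Longrightarrow> 0 < x"
  using T_pos[of k] by (auto simp: I_def)

lemma I_sets: "I k \<in> sets lebesgue" "I k \<subseteq> {0<..}"
  using I_pos by (auto simp: I_def)

lemma I_cover: "0 < x \<Longrightarrow> \<exists>k. x \<in> I k"
  using dyadic_level[OF rho_pos, of x] by (simp add: mem_I_iff)

lemma I_disjoint: "x \<in> I k \<Longrightarrow> x \<in> I l \<Longrightarrow> k = l"
  using mem_I_iff[OF I_pos, of x k k] mem_I_iff[OF I_pos, of x k l] dyadic_level_unique by blast

lemma T_le_iff: "T k \<le> T l \<longleftrightarrow> k \<le> l"
  using rho_less_iff[OF T_pos T_pos, of l k] by (auto simp: rho_T simp flip: not_less)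

lemma T_le_Suc: "T k \<le> T (k + 1)"
  by (simp add: T_le_iff)

lemma a0_T: "a0 (T k) = 2 powr of_int k * a1 (T k)"
  using rho_eq[OF T_pos, of k] a_pos(2)[OF T_pos, of k] by (simp add: rho_T field_simps)

text \<open>From \<open>T k\<close> to \<open>T (k + 1)\<close> the quotient \<open>\<rho> = a0 / a1\<close> doubles while \<open>a0\<close> does not increase, so
  \<open>a1\<close> drops at least by the factor two.  Hence \<open>I k\<close> carries a fixed fraction of the tail mass of
  \<open>b1\<close> beyond \<open>T k\<close>, as recorded in \<open>mass_b1_I\<close>.\<close>

lemma a1_T_halves: "2 * a1 (T (k + 1)) \<le> a1 (T k)"
proof -
  have "2 powr of_int k * (2 * a1 (T (k + 1))) = a0 (T (k + 1))"
    unfolding a0_T by (simp add: powr_add)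
  also have "\<dots> \<le> 2 powr of_int k * a1 (T k)"
    using a_antimono(1)[OF T_pos T_le_Suc] by (simp add: a0_T)
  finally show ?thesis by simp
qed

text \<open>The converse is where \<open>\<rho>\<^sub>\<epsilon>\<close> enters: \<open>\<rho>\<^sub>\<epsilon>(T k)\<close> is \<open>2\<^bsup>k(1 + \<epsilon>)\<^esup> a1(T k)\<^bsup>\<epsilon>\<^esup>\<close>, so its quasi-monotonicity
  prevents \<open>a1\<close> from dropping by more than a constant factor in one step.\<close>

lemma a1_T_doubling: "\<exists>C\<ge>1. \<forall>k. a1 (T k) \<le> C * a1 (T (k + 1))"
proof -
  obtain \<epsilon> h c C where h: "0 < \<epsilon>" "mono_on {0<..} h" "0 < c" "0 < C"
    "\<And>t. 0 < t \<Longrightarrow> c * h t \<le> rho_eps \<epsilon> q0 q1 b0 b1 t \<and> rho_eps \<epsilon> q0 q1 b0 b1 t \<le> C * h t"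
    using rho_eps_mono unfolding equivalent_pos_def by metis
  have val: "rho_eps \<epsilon> q0 q1 b0 b1 (T k) = (2 powr of_int k) powr (1 + \<epsilon>) * a1 (T k) powr \<epsilon>" for k
  proof -
    have "rho_eps \<epsilon> q0 q1 b0 b1 (T k) = a0 (T k) powr (1 + \<epsilon>) / a1 (T k)"
      using exponents b0 b1 T_pos by (simp add: rho_eps_def enn2real_tail_norm a0_def a1_def)
    also have "\<dots> = (2 powr of_int k) powr (1 + \<epsilon>) * (a1 (T k) powr (1 + \<epsilon>) / a1 (T k))"
      using a_pos(2)[OF T_pos, of k] unfolding a0_T by (simp add: powr_mult)
    also have "a1 (T k) powr (1 + \<epsilon>) / a1 (T k) = a1 (T k) powr \<epsilon>"
      using a_pos(2)[OF T_pos, of k] by (simp add: powr_add)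
    finally show ?thesis .
  qed
  define D where "D = (C / c) * 2 powr (1 + \<epsilon>)"
  have D: "0 < D" using h by (simp add: D_def)
  have "a1 (T k) \<le> D powr (1 / \<epsilon>) * a1 (T (k + 1))" for k
  proof -
    have "C * h (T k) \<le> C * h (T (k + 1))"
      using mono_onD[OF h(2), of "T k" "T (k + 1)"] T_pos T_le_Suc h(4) by (intro mult_left_mono) auto
    also have "\<dots> \<le> C / c * rho_eps \<epsilon> q0 q1 b0 b1 (T (k + 1))"
    proof (rule scaled_bound[OF _ h(3,4) order_refl])
      show "c * h (T (k + 1)) \<le> rho_eps \<epsilon> q0 q1 b0 b1 (T (k + 1))" using h(5)[OF T_pos] by blast
      show "0 \<le> rho_eps \<epsilon> q0 q1 b0 b1 (T (k + 1))" unfolding val by simp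
    qed
    finally have "rho_eps \<epsilon> q0 q1 b0 b1 (T k) \<le> C / c * rho_eps \<epsilon> q0 q1 b0 b1 (T (k + 1))"
      using h(5)[OF T_pos, of k] by linarith
    then have "(2 powr of_int k) powr (1 + \<epsilon>) * a1 (T k) powr \<epsilon>
        \<le> (2 powr of_int k) powr (1 + \<epsilon>) * (D * a1 (T (k + 1)) powr \<epsilon>)"
      unfolding val D_def by (simp add: powr_add powr_mult mult_ac)
    then have "a1 (T k) powr \<epsilon> \<le> D * a1 (T (k + 1)) powr \<epsilon>"
      by (rule mult_left_le_imp_le) simp
    then have "(a1 (T k) powr \<epsilon>) powr (1 / \<epsilon>) \<le> (D * a1 (T (k + 1)) powr \<epsilon>) powr (1 / \<epsilon>)"
      using h(1) by (intro powr_mono2) auto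
    then show ?thesis
      using h(1) D a_pos(2)[OF T_pos, of k] a_pos(2)[OF T_pos, of "k + 1"] by (simp add: powr_mult powr_powr)
  qed
  then have "a1 (T k) \<le> max 1 (D powr (1 / \<epsilon>)) * a1 (T (k + 1))" for k
    by (rule order_trans[OF _ mult_right_mono[OF max.cobounded2 less_imp_le[OF a_pos(2)[OF T_pos]]]])
  then show ?thesis by (intro exI[of _ "max 1 (D powr (1 / \<epsilon>))"]) auto
qed

lemma mass_b1_I:
  "mass q1 b1 (I k) \<le> ennreal (a1 (T k) powr q1)"
  "ennreal ((1 - 2 powr (- q1)) * a1 (T k) powr q1) \<le> mass q1 b1 (I k)"
proof -
  have A: "a1 t powr q1 = tail_mass q1 b1 t" if "0 < t" for t
    using tail_mass_pos[OF b1 exponents(4) that] exponents by (simp add: a1_def powr_powr)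
  have eq: "mass q1 b1 (I k) = ennreal (a1 (T k) powr q1 - a1 (T (k + 1)) powr q1)"
    unfolding I_def A[OF T_pos] by (rule mass_interval_eq[OF b1 exponents(4) T_pos T_le_Suc])
  show "mass q1 b1 (I k) \<le> ennreal (a1 (T k) powr q1)" unfolding eq by (intro ennreal_leI) simp
  have "a1 (T (k + 1)) powr q1 \<le> (a1 (T k) / 2) powr q1"
    using a1_T_halves[of k] a_pos(2)[OF T_pos, of "k + 1"] exponents by (intro powr_mono2) auto
  also have "\<dots> = 2 powr (- q1) * a1 (T k) powr q1"
    using a_pos(2)[OF T_pos, of k] by (simp add: powr_divide powr_minus field_simps)
  finally show "ennreal ((1 - 2 powr (- q1)) * a1 (T k) powr q1) \<le> mass q1 b1 (I k)"
    unfolding eq by (intro ennreal_leI) (simp add: algebra_simps)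
qed

lemma mass_b0_I: "mass q0 b0 (I k) \<le> ennreal (a0 (T k) powr q0)"
proof -
  have A: "a0 t powr q0 = tail_mass q0 b0 t" if "0 < t" for t
    using tail_mass_pos[OF b0 exponents(3) that] exponents by (simp add: a0_def powr_powr)
  have "mass q0 b0 (I k) = ennreal (a0 (T k) powr q0 - a0 (T (k + 1)) powr q0)"
    unfolding I_def A[OF T_pos] by (rule mass_interval_eq[OF b0 exponents(3) T_pos T_le_Suc])
  also have "\<dots> \<le> ennreal (a0 (T k) powr q0)" by (intro ennreal_leI) simp
  finally show ?thesis .
qed

section \<open>Both quasi-norms as discrete sums\<close>

text \<open>The sums below are the discrete forms of the two quasi-norms: \<open>G f k\<close> stands in the first where
  the K-functional at \<open>2\<^sup>k = \<rho> (T k)\<close> stands in the second.\<close>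

definition u :: "int \<Rightarrow> real" where
  "u k = (2 powr of_int k) powr (- \<theta>) * b (2 powr of_int k)"

definition G :: "('a \<Rightarrow> real) \<Rightarrow> int \<Rightarrow> ennreal" where
  "G f k = ennreal (a0 (T k)) * F f (T k)"

definition gamma_sum :: "('a \<Rightarrow> real) \<Rightarrow> ennreal" where
  "gamma_sum f = zsum (\<lambda>k. epowr (ennreal (u k) * G f k) q)"

definition K_sum :: "('a \<Rightarrow> real) \<Rightarrow> ennreal" where
  "K_sum f = zsum (\<lambda>k. epowr (ennreal (u k) * K (2 powr of_int k) f) q)"

abbreviation "bt \<equiv> b_tilde q0 q1 q \<theta> b0 b1 b"

lemma b_pos: "0 < t \<Longrightarrow> 0 < b t"
  using b by (simp add: slowly_varying_def)

lemma u_pos: "0 < u k"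
  by (simp add: u_def b_pos)

text \<open>The step from \<open>T k\<close> to \<open>T (k + 1)\<close> costs only a constant factor.\<close>

lemma step_comparable:
  "\<exists>C\<ge>1. \<forall>k. u k * 2 powr of_int k * a1 (T k) \<le> C * (u (k + 1) * a0 (T (k + 1)))"
proof -
  obtain C1 where C1: "1 \<le> C1" "\<And>k. a1 (T k) \<le> C1 * a1 (T (k + 1))"
    using a1_T_doubling by blast
  obtain C2 where C2: "1 \<le> C2" "\<And>s t. 0 < s \<Longrightarrow> s \<le> t \<Longrightarrow> t \<le> 2 * s \<Longrightarrow>
      s powr (- \<theta>) * b s \<le> C2 * (t powr (- \<theta>) * b t)"
    using slowly_varying_power_doubling[OF b, of "- \<theta>"] by blast
  have "u k * 2 powr of_int k * a1 (T k) \<le> (C2 * C1) * (u (k + 1) * a0 (T (k + 1)))" for k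
  proof -
    have "u k \<le> C2 * u (k + 1)"
      unfolding u_def by (intro C2(2)) (simp_all add: powr_add)
    then have "u k * (2 powr of_int k * a1 (T k)) \<le> (C2 * u (k + 1)) * (2 powr of_int k * (C1 * a1 (T (k + 1))))"
      using C1 C2(1) u_pos[of k] u_pos[of "k + 1"] a_pos(2)[OF T_pos]
      by (intro mult_mono mult_left_mono) (auto intro: less_imp_le mult_nonneg_nonneg)
    also have "\<dots> \<le> (C2 * u (k + 1)) * (2 powr of_int (k + 1) * (C1 * a1 (T (k + 1))))"
      using C1(1) C2(1) u_pos[of "k + 1"] a_pos(2)[OF T_pos, of "k + 1"]
      by (intro mult_left_mono mult_right_mono) (auto intro: less_imp_le)
    finally show ?thesis unfolding a0_T by (simp only: mult_ac)
  qed
  moreover have "1 \<le> C2 * C1" using C1(1) C2(1) mult_mono[of 1 C2 1 C1] by simp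
  ultimately show ?thesis by blast
qed

text \<open>On \<open>I k\<close> the function \<open>b_tilde\<close> is a constant times \<open>b1\<^bsup>q1/q\<^esup>\<close>, up to bounded factors.\<close>

lemma b_tilde_on_I:
  "\<exists>D>0. \<forall>k. \<forall>x\<in>I k.
    bt x powr q \<le> D * ((u k * 2 powr of_int k) powr q * a1 (T k) powr (q - q1)) * b1 x powr q1 \<and>
    (u k * 2 powr of_int k) powr q * a1 (T k) powr (q - q1) * b1 x powr q1 \<le> D * bt x powr q"
proof -
  obtain C1 where C1: "1 \<le> C1" "\<And>k. a1 (T k) \<le> C1 * a1 (T (k + 1))"
    using a1_T_doubling by blast
  obtain C2 where C2: "1 \<le> C2" "\<And>s t. 0 < s \<Longrightarrow> s \<le> t \<Longrightarrow> t \<le> 2 * s \<Longrightarrow>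
      t powr (1 - \<theta>) * b t \<le> C2 * (s powr (1 - \<theta>) * b s) \<and> s powr (1 - \<theta>) * b s \<le> C2 * (t powr (1 - \<theta>) * b t)"
    using slowly_varying_power_doubling[OF b, of "1 - \<theta>"] by blast
  define E where "E = C1 powr \<bar>q - q1\<bar>"
  define D where "D = C2 powr q * E"
  have E: "0 < E" and D: "0 < D" using C1(1) C2(1) by (simp_all add: D_def E_def)
  have "bt x powr q \<le> D * ((u k * 2 powr of_int k) powr q * a1 (T k) powr (q - q1)) * b1 x powr q1 \<and>
    (u k * 2 powr of_int k) powr q * a1 (T k) powr (q - q1) * b1 x powr q1 \<le> D * bt x powr q"
    if xk: "x \<in> I k" for k x
  proof -
    have x: "0 < x" by (rule I_pos[OF xk])
    let ?\<phi> = "\<rho> x powr (1 - \<theta>) * b (\<rho> x)" and ?v = "u k * 2 powr of_int k" and ?b = "b1 x powr q1"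
    have b1x: "0 < b1 x" using weights(3) x by (simp add: weight_def)
    have \<phi>0: "0 < ?\<phi>" using b_pos[OF rho_pos[OF x]] rho_pos[OF x] by simp
    have v0: "0 < ?v" using u_pos[of k] by simp
    have v: "?v = (2 powr of_int k) powr (1 - \<theta>) * b (2 powr of_int k)"
      by (simp add: u_def powr_diff powr_minus divide_inverse)
    have "2 powr of_int k \<le> \<rho> x" "\<rho> x \<le> 2 * 2 powr of_int k"
      using mem_I_iff[OF x, of k] xk by (simp_all add: powr_add)
    then have \<phi>: "?\<phi> \<le> C2 * ?v" "?v \<le> C2 * ?\<phi>" unfolding v using C2(2)[of "2 powr of_int k" "\<rho> x"] by auto
    have \<phi>q: "?\<phi> powr q \<le> C2 powr q * ?v powr q" "?v powr q \<le> C2 powr q * ?\<phi> powr q"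
      using powr_mono2[OF _ _ \<phi>(1), of q] powr_mono2[OF _ _ \<phi>(2), of q] q C2(1) \<phi>0 v0
      by (simp_all only: powr_mult less_imp_le)
    have ax: "0 < a1 x" "0 < a1 (T k)" using a_pos(2) x T_pos by auto
    have le1: "a1 x \<le> a1 (T k)" using a_antimono(2)[OF T_pos, of k x] xk by (simp add: I_def)
    have "a1 (T (k + 1)) \<le> a1 x" using a_antimono(2)[OF x, of "T (k + 1)"] xk by (simp add: I_def)
    then have "C1 * a1 (T (k + 1)) \<le> C1 * a1 x" using C1(1) by (intro mult_left_mono) auto
    then have le2: "a1 (T k) \<le> C1 * a1 x" using C1(2)[of k] by linarith
    have "1 * a1 (T k) \<le> C1 * a1 (T k)" using C1(1) ax by (intro mult_right_mono) auto
    then have le3: "a1 x \<le> C1 * a1 (T k)" using le1 by linarith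
    have aq: "a1 x powr (q - q1) \<le> E * a1 (T k) powr (q - q1)" "a1 (T k) powr (q - q1) \<le> E * a1 x powr (q - q1)"
      unfolding E_def by (intro powr_comparable ax C1(1) le2 le3)+
    have A: "tail_mass q1 b1 x = a1 x powr q1"
      using tail_mass_pos[OF b1 exponents(4) x] exponents by (simp add: a1_def powr_powr)
    have "bt x = ?\<phi> * b1 x powr (q1 / q) * (a1 x powr q1) powr (1 / q1 - 1 / q)"
      unfolding b_tilde_def tail_mass_eq_integral[OF b1 exponents(4) x] A ..
    also have "(a1 x powr q1) powr (1 / q1 - 1 / q) = a1 x powr ((q - q1) / q)"
    proof -
      have "q1 * (1 / q1 - 1 / q) = (q - q1) / q"
        using exponents q by (simp add: right_diff_distrib diff_divide_distrib)
      then show ?thesis by (simp only: powr_powr)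
    qed
    finally have bt: "bt x powr q = ?\<phi> powr q * ?b * a1 x powr (q - q1)"
      using q \<phi>0 b1x ax by (simp add: powr_mult powr_powr)
    have "?\<phi> powr q * a1 x powr (q - q1) \<le> (C2 powr q * ?v powr q) * (E * a1 (T k) powr (q - q1))"
      using \<phi>q aq by (intro mult_mono) auto
    from mult_right_mono[OF this, of ?b]
    have up: "bt x powr q \<le> D * (?v powr q * a1 (T k) powr (q - q1)) * ?b"
      unfolding bt D_def by (simp add: mult_ac)
    have "?v powr q * a1 (T k) powr (q - q1) \<le> (C2 powr q * ?\<phi> powr q) * (E * a1 x powr (q - q1))"
      using \<phi>q aq E by (intro mult_mono) auto
    from mult_right_mono[OF this, of ?b]
    have "?v powr q * a1 (T k) powr (q - q1) * ?b \<le> D * bt x powr q"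
      unfolding bt D_def by (simp add: mult_ac)
    with up show ?thesis by blast
  qed
  with D show ?thesis by blast
qed

lemma Gamma_tilde_norm_eq:
  "Gamma_norm M r q p bt w f = epowr (wint q bt {0<..} (\<lambda>t. epowr (F f t) q)) (1 / q)"
proof -
  have "0 \<le> bt x" if "x \<in> {0<..}" for x
    using that b_pos[OF rho_pos, of x] weights(3) by (auto simp: b_tilde_def weight_def)
  then show ?thesis
    unfolding Gamma_norm_def F_def inner_norm_def[abs_def] using q by (intro Lq_norm_eq_wint) auto
qed

text \<open>On \<open>I k\<close> the function \<open>F f\<close> lies between its values at the two end points, and the mass of \<open>I k\<close>
  turns the power \<open>q - q1\<close> of \<open>a1\<close> in \<open>b_tilde\<close> into \<open>q\<close>.  The right end point is reached by a shift
  of the index, at the cost of the constant of \<open>step_comparable\<close>.\<close>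

lemma gamma_tilde_le_sum:
  "\<exists>C>0. \<forall>f. wint q bt {0<..} (\<lambda>t. epowr (F f t) q) \<le> ennreal C * gamma_sum f"
proof -
  let ?m = "\<lambda>k. (u k * 2 powr of_int k) powr q * a1 (T k) powr (q - q1)"
  obtain D where D: "0 < D" "\<And>k x. x \<in> I k \<Longrightarrow> bt x powr q \<le> D * ?m k * b1 x powr q1"
    using b_tilde_on_I by blast
  obtain C where C: "1 \<le> C" "\<And>k. u k * 2 powr of_int k * a1 (T k) \<le> C * (u (k + 1) * a0 (T (k + 1)))"
    using step_comparable by blast
  have "wint q bt {0<..} (\<lambda>t. epowr (F f t) q) \<le> ennreal (D * C powr q) * gamma_sum f" for f
  proof -
    let ?X = "\<lambda>k. epowr (ennreal (u k) * G f k) q"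
    have "wint q bt {0<..} (\<lambda>t. epowr (F f t) q)
        \<le> zsum (\<lambda>k. (ennreal (D * ?m k) * epowr (F f (T (k + 1))) q) * mass q1 b1 (I k))"
      unfolding wint_def[of q bt]
    proof (rule nn_integral_le_zsum_mass[OF weights(3) I_sets])
      fix x :: real assume "x \<in> {0<..}"
      then obtain k where k: "x \<in> I k" using I_cover[of x] by auto
      have x: "0 < x" by (rule I_pos[OF k])
      have "bt x powr q / x \<le> D * ?m k * (b1 x powr q1 / x)"
        using divide_right_mono[OF D(2)[OF k], of x] x by simp
      then have "ennreal (bt x powr q / x) \<le> ennreal (D * ?m k) * ennreal (b1 x powr q1 / x)"
        using D(1) x by (simp flip: ennreal_mult)
      moreover have "epowr (F f x) q \<le> epowr (F f (T (k + 1))) q"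
        using k q by (intro epowr_mono F_mono) (auto simp: I_def)
      ultimately have "ennreal (bt x powr q / x) * epowr (F f x) q
          \<le> (ennreal (D * ?m k) * ennreal (b1 x powr q1 / x)) * epowr (F f (T (k + 1))) q"
        by (intro mult_mono) auto
      then show "\<exists>k. x \<in> I k \<and> ennreal (bt x powr q / x) * epowr (F f x) q
          \<le> ennreal (D * ?m k) * epowr (F f (T (k + 1))) q * ennreal (b1 x powr q1 / x)"
        using k by (intro exI[of _ k]) (simp add: mult_ac)
    qed
    also have "\<dots> \<le> zsum (\<lambda>k. ennreal (D * C powr q) * ?X (k + 1))"
    proof (rule zsum_mono)
      fix k
      have "?m k * a1 (T k) powr q1 = (u k * 2 powr of_int k * a1 (T k)) powr q"
        using a_pos(2)[OF T_pos, of k] u_pos[of k] by (simp add: powr_mult flip: powr_add)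
      also have "\<dots> \<le> (C * (u (k + 1) * a0 (T (k + 1)))) powr q"
        using C(2) q u_pos[of k] a_pos(2)[OF T_pos, of k] by (intro powr_mono2) auto
      also have "\<dots> = C powr q * (u (k + 1) * a0 (T (k + 1))) powr q"
        using C(1) u_pos[of "k + 1"] a_pos(1)[OF T_pos, of "k + 1"] by (simp add: powr_mult)
      finally have "D * (?m k * a1 (T k) powr q1) \<le> D * (C powr q * (u (k + 1) * a0 (T (k + 1))) powr q)"
        using D(1) by (intro mult_left_mono) auto
      then have "ennreal (D * ?m k * a1 (T k) powr q1) \<le> ennreal (D * C powr q * (u (k + 1) * a0 (T (k + 1))) powr q)"
        by (intro ennreal_leI) (simp only: mult.assoc)
      then have c: "ennreal (D * ?m k) * ennreal (a1 (T k) powr q1)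
          \<le> ennreal (D * C powr q) * ennreal ((u (k + 1) * a0 (T (k + 1))) powr q)"
        using D(1) by (simp flip: ennreal_mult)
      have "(ennreal (D * ?m k) * epowr (F f (T (k + 1))) q) * mass q1 b1 (I k)
          \<le> (ennreal (D * ?m k) * epowr (F f (T (k + 1))) q) * ennreal (a1 (T k) powr q1)"
        by (intro mult_left_mono mass_b1_I) simp
      also have "\<dots> = (ennreal (D * ?m k) * ennreal (a1 (T k) powr q1)) * epowr (F f (T (k + 1))) q"
        by (simp only: mult_ac)
      also have "\<dots> \<le> (ennreal (D * C powr q) * ennreal ((u (k + 1) * a0 (T (k + 1))) powr q)) * epowr (F f (T (k + 1))) q"
        by (intro mult_right_mono c) simp
      also have "\<dots> = ennreal (D * C powr q) * ?X (k + 1)"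
        using q u_pos[of "k + 1"] a_pos(1)[OF T_pos, of "k + 1"]
        by (simp add: G_def epowr_const_mult mult.assoc less_imp_le flip: ennreal_mult mult.assoc)
      finally show "ennreal (D * ?m k) * epowr (F f (T (k + 1))) q * mass q1 b1 (I k)
          \<le> ennreal (D * C powr q) * ?X (k + 1)" .
    qed
    also have "\<dots> = ennreal (D * C powr q) * gamma_sum f"
      unfolding zsum_cmult gamma_sum_def by (simp only: zsum_shift[of ?X 1])
    finally show ?thesis .
  qed
  moreover have "0 < D * C powr q" using D(1) C(1) by simp
  ultimately show ?thesis by blast
qed

lemma sum_le_gamma_tilde:
  "\<exists>C>0. \<forall>f. gamma_sum f \<le> ennreal C * wint q bt {0<..} (\<lambda>t. epowr (F f t) q)"
proof -
  let ?m = "\<lambda>k. (u k * 2 powr of_int k) powr q * a1 (T k) powr (q - q1)"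
  obtain D where D: "0 < D" "\<And>k x. x \<in> I k \<Longrightarrow> ?m k * b1 x powr q1 \<le> D * bt x powr q"
    using b_tilde_on_I by blast
  define \<kappa> where "\<kappa> = 1 - 2 powr (- q1)"
  have \<kappa>: "0 < \<kappa>" using exponents by (simp add: \<kappa>_def powr_less_one)
  have "gamma_sum f \<le> ennreal (D / \<kappa>) * wint q bt {0<..} (\<lambda>t. epowr (F f t) q)" for f
  proof -
    have "gamma_sum f \<le> zsum (\<lambda>k. ennreal (D / \<kappa>) * ((ennreal (?m k / D) * epowr (F f (T k)) q) * mass q1 b1 (I k)))"
      unfolding gamma_sum_def
    proof (rule zsum_mono)
      fix k
      have pos: "0 < u k" "0 < a1 (T k)" using u_pos a_pos(2)[OF T_pos] by auto
      have "ennreal ((u k * a0 (T k)) powr q) = ennreal (D / \<kappa>) * (ennreal (?m k / D) * ennreal (\<kappa> * a1 (T k) powr q1))"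
      proof -
        have "(u k * a0 (T k)) powr q = ?m k * a1 (T k) powr q1"
          using pos unfolding a0_T by (simp add: powr_mult flip: powr_add)
        also have "\<dots> = D / \<kappa> * (?m k / D * (\<kappa> * a1 (T k) powr q1))"
          using D(1) \<kappa> by simp
        finally show ?thesis
          using D(1) \<kappa> by (simp only: flip: ennreal_mult) (simp flip: ennreal_mult)
      qed
      also have "\<dots> \<le> ennreal (D / \<kappa>) * (ennreal (?m k / D) * mass q1 b1 (I k))"
        unfolding \<kappa>_def by (intro mult_left_mono mass_b1_I) auto
      finally have "ennreal ((u k * a0 (T k)) powr q) * epowr (F f (T k)) q
          \<le> (ennreal (D / \<kappa>) * (ennreal (?m k / D) * mass q1 b1 (I k))) * epowr (F f (T k)) q"
        by (rule mult_right_mono) simp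
      moreover have "epowr (ennreal (u k) * G f k) q = ennreal ((u k * a0 (T k)) powr q) * epowr (F f (T k)) q"
        using q pos a_pos(1)[OF T_pos, of k]
        by (simp add: G_def epowr_const_mult less_imp_le flip: ennreal_mult mult.assoc)
      ultimately show "epowr (ennreal (u k) * G f k) q
          \<le> ennreal (D / \<kappa>) * ((ennreal (?m k / D) * epowr (F f (T k)) q) * mass q1 b1 (I k))"
        by (simp only: mult_ac)
    qed
    also have "\<dots> = ennreal (D / \<kappa>) * zsum (\<lambda>k. (ennreal (?m k / D) * epowr (F f (T k)) q) * mass q1 b1 (I k))"
      by (rule zsum_cmult)
    also have "\<dots> \<le> ennreal (D / \<kappa>) * wint q bt {0<..} (\<lambda>t. epowr (F f t) q)"
      unfolding wint_def[of q bt]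
    proof (intro mult_left_mono zsum_mass_le_nn_integral[OF weights(3) I_sets I_sets(2) I_disjoint])
      fix k x assume k: "x \<in> I k"
      have x: "0 < x" by (rule I_pos[OF k])
      have "?m k / D * b1 x powr q1 \<le> bt x powr q"
        using D(2)[OF k] D(1) by (simp add: field_simps)
      then have "?m k / D * (b1 x powr q1 / x) \<le> bt x powr q / x"
        using divide_right_mono[of "?m k / D * b1 x powr q1" "bt x powr q" x] x by simp
      then have "ennreal (?m k / D) * ennreal (b1 x powr q1 / x) \<le> ennreal (bt x powr q / x)"
        using D(1) x by (simp flip: ennreal_mult)
      moreover have "epowr (F f (T k)) q \<le> epowr (F f x) q"
        using k q by (intro epowr_mono F_mono) (auto simp: I_def)
      ultimately have "(ennreal (?m k / D) * ennreal (b1 x powr q1 / x)) * epowr (F f (T k)) q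
          \<le> ennreal (bt x powr q / x) * epowr (F f x) q"
        by (intro mult_mono) auto
      then show "ennreal (?m k / D) * epowr (F f (T k)) q * ennreal (b1 x powr q1 / x)
          \<le> ennreal (bt x powr q / x) * epowr (F f x) q"
        by (simp only: mult_ac)
    qed auto
    finally show ?thesis .
  qed
  moreover have "0 < D / \<kappa>" using D(1) \<kappa> by simp
  ultimately show ?thesis by blast
qed

text \<open>The interpolation quasi-norm is discretized at the points \<open>2\<^sup>k\<close> in the same way; the
  K-functional is non-decreasing in \<open>t\<close>.\<close>

definition v :: "real \<Rightarrow> real" where "v t = t powr (- \<theta>) * b t"

definition J :: "int \<Rightarrow> real set" where "J k = {2 powr of_int k<..2 powr of_int (k + 1)}"

lemma weight_v: "weight v"
  unfolding v_def[abs_def] by (intro weight_power_mult slowly_varying_weight b)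

lemma J_sets: "J k \<in> sets lebesgue" "J k \<subseteq> {0<..}"
  by (auto simp: J_def intro: less_trans[of 0 "2 powr of_int k"])

lemma J_cover: "0 < x \<Longrightarrow> \<exists>k. x \<in> J k"
  using dyadic_level[of x] by (simp add: J_def)

lemma J_disjoint: "x \<in> J k \<Longrightarrow> x \<in> J l \<Longrightarrow> k = l"
  using dyadic_level_unique[of k x l] by (simp add: J_def)

lemma interp_norm_eq:
  "interp_norm \<Gamma>0 \<Gamma>1 \<theta> q b f = epowr (wint q v {0<..} (\<lambda>t. epowr (K t f) q)) (1 / q)"
proof -
  have eq: "t powr (- \<theta> - 1 / q) * b t = t powr (- 1 / q) * v t" for t
    by (simp add: v_def algebra_simps flip: powr_add)
  show ?thesis
    unfolding interp_norm_def eq using q weight_v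
    by (intro Lq_norm_eq_wint) (auto simp: weight_def intro: less_imp_le)
qed

lemma mass_v_J: "\<exists>C>0. \<forall>k. mass q v (J k) \<le> ennreal (C * u (k + 1) powr q) \<and> ennreal (u k powr q) \<le> ennreal C * mass q v (J k)"
proof -
  obtain C where C: "1 \<le> C" "\<And>s t. 0 < s \<Longrightarrow> s \<le> t \<Longrightarrow> t \<le> 2 * s \<Longrightarrow> v t \<le> C * v s \<and> v s \<le> C * v t"
    using slowly_varying_power_doubling[OF b, of "- \<theta>"] unfolding v_def by blast
  have vpos: "0 < v t" if "0 < t" for t using weight_v that by (simp add: weight_def)
  have u: "u k = v (2 powr of_int k)" for k by (simp add: u_def v_def)
  have "mass q v (J k) \<le> ennreal ((2 * C powr q) * u (k + 1) powr q) \<and> ennreal (u k powr q) \<le> ennreal (2 * C powr q) * mass q v (J k)" for k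
  proof -
    define s :: real where "s = 2 powr of_int k"
    have s: "0 < s" by (simp add: s_def)
    have J: "J k = {s<..2 * s}" "u k = v s" "u (k + 1) = v (2 * s)"
      by (simp_all add: J_def u s_def powr_add mult.commute)
    have up: "v x powr q \<le> C powr q * v (2 * s) powr q" if "s < x" "x \<le> 2 * s" for x
    proof -
      have "v x powr q \<le> (C * v (2 * s)) powr q"
        using C(2)[of x "2 * s"] that s q vpos[of x] by (intro powr_mono2) auto
      then show ?thesis using C(1) vpos[of "2 * s"] s by (simp add: powr_mult)
    qed
    have "mass q v {s<..2 * s} \<le> ennreal (C powr q * v (2 * s) powr q * (2 * s - s) / s)"
      using s up by (intro mass_interval_le) auto
    also have "\<dots> \<le> ennreal ((2 * C powr q) * v (2 * s) powr q)"
      using s by (intro ennreal_leI) (simp add: mult_ac)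
    finally have 1: "mass q v (J k) \<le> ennreal ((2 * C powr q) * u (k + 1) powr q)" unfolding J .
    have lo: "v s powr q / C powr q \<le> v x powr q" if "s < x" "x \<le> 2 * s" for x
    proof -
      have "v s powr q \<le> (C * v x) powr q"
        using C(2)[of s x] that s q vpos[of s] by (intro powr_mono2) auto
      then show ?thesis using C(1) vpos[of x] s that by (simp add: powr_mult pos_divide_le_eq mult.commute)
    qed
    have "ennreal (v s powr q / C powr q * (2 * s - s) / (2 * s)) \<le> mass q v {s<..2 * s}"
      using s lo C(1) by (intro mass_interval_ge) auto
    then have "ennreal (2 * C powr q) * ennreal (v s powr q / C powr q * (2 * s - s) / (2 * s))
        \<le> ennreal (2 * C powr q) * mass q v {s<..2 * s}"
      by (rule mult_left_mono) simp
    moreover have "ennreal (2 * C powr q) * ennreal (v s powr q / C powr q * (2 * s - s) / (2 * s)) = ennreal (v s powr q)"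
      using s C(1) by (simp flip: ennreal_mult)
    ultimately show ?thesis using 1 unfolding J by simp
  qed
  moreover have "0 < 2 * C powr q" using C(1) by simp
  ultimately show ?thesis by blast
qed

lemma interp_le_sum:
  "\<exists>C>0. \<forall>f. wint q v {0<..} (\<lambda>t. epowr (K t f) q) \<le> ennreal C * K_sum f"
proof -
  obtain C where C: "0 < C" "\<And>k. mass q v (J k) \<le> ennreal (C * u (k + 1) powr q)"
    using mass_v_J by blast
  have "wint q v {0<..} (\<lambda>t. epowr (K t f) q) \<le> ennreal C * K_sum f" for f
  proof -
    let ?X = "\<lambda>k. epowr (ennreal (u k) * K (2 powr of_int k) f) q"
    have "wint q v {0<..} (\<lambda>t. epowr (K t f) q) \<le> zsum (\<lambda>k. epowr (K (2 powr of_int (k + 1)) f) q * mass q v (J k))"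
    proof (rule wint_le_zsum[OF weight_v J_sets])
      fix x :: real assume "x \<in> {0<..}"
      then obtain k where k: "x \<in> J k" using J_cover[of x] by auto
      then show "\<exists>k. x \<in> J k \<and> epowr (K x f) q \<le> epowr (K (2 powr of_int (k + 1)) f) q"
        using q by (intro exI[of _ k] conjI epowr_mono K_functional_mono) (auto simp: J_def)
    qed
    also have "\<dots> \<le> zsum (\<lambda>k. ennreal C * ?X (k + 1))"
    proof (rule zsum_mono)
      fix k
      have "epowr (K (2 powr of_int (k + 1)) f) q * mass q v (J k)
          \<le> epowr (K (2 powr of_int (k + 1)) f) q * ennreal (C * u (k + 1) powr q)"
        by (intro mult_left_mono C) simp
      also have "\<dots> = ennreal C * ?X (k + 1)"
        using C(1) q u_pos[of "k + 1"] by (simp add: epowr_const_mult ennreal_mult less_imp_le mult_ac)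
      finally show "epowr (K (2 powr of_int (k + 1)) f) q * mass q v (J k) \<le> ennreal C * ?X (k + 1)" .
    qed
    also have "\<dots> = ennreal C * K_sum f"
      unfolding zsum_cmult K_sum_def by (simp only: zsum_shift[of ?X 1])
    finally show ?thesis .
  qed
  with C(1) show ?thesis by blast
qed

lemma sum_le_interp:
  "\<exists>C>0. \<forall>f. K_sum f \<le> ennreal C * wint q v {0<..} (\<lambda>t. epowr (K t f) q)"
proof -
  obtain C where C: "0 < C" "\<And>k. ennreal (u k powr q) \<le> ennreal C * mass q v (J k)"
    using mass_v_J by blast
  have "K_sum f \<le> ennreal C * wint q v {0<..} (\<lambda>t. epowr (K t f) q)" for f
  proof -
    have "K_sum f \<le> zsum (\<lambda>k. ennreal C * (epowr (K (2 powr of_int k) f) q * mass q v (J k)))"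
      unfolding K_sum_def
    proof (rule zsum_mono)
      fix k
      have "epowr (ennreal (u k) * K (2 powr of_int k) f) q = ennreal (u k powr q) * epowr (K (2 powr of_int k) f) q"
        using q u_pos[of k] by (simp add: epowr_const_mult less_imp_le)
      also have "\<dots> \<le> (ennreal C * mass q v (J k)) * epowr (K (2 powr of_int k) f) q"
        by (intro mult_right_mono C) simp
      finally show "epowr (ennreal (u k) * K (2 powr of_int k) f) q
          \<le> ennreal C * (epowr (K (2 powr of_int k) f) q * mass q v (J k))"
        by (simp only: mult_ac)
    qed
    also have "\<dots> = ennreal C * zsum (\<lambda>k. epowr (K (2 powr of_int k) f) q * mass q v (J k))"
      by (rule zsum_cmult)
    also have "\<dots> \<le> ennreal C * wint q v {0<..} (\<lambda>t. epowr (K t f) q)"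
      using q by (intro mult_left_mono zsum_le_wint[OF weight_v J_sets J_sets(2) J_disjoint] epowr_mono K_functional_mono)
        (auto simp: J_def)
    finally show ?thesis .
  qed
  with C(1) show ?thesis by blast
qed

section \<open>Comparison of the two sums\<close>

lemma gamma_sum_le_K_sum:
  "\<exists>C>0. \<forall>f. gamma_sum f \<le> ennreal C * K_sum f"
proof -
  obtain C where C: "0 < C" "\<And>f t. 0 < t \<Longrightarrow> ennreal (a0 t) * F f t \<le> ennreal C * K (\<rho> t) f"
    using K_lower by blast
  have "gamma_sum f \<le> ennreal (C powr q) * K_sum f" for f
  proof -
    have "gamma_sum f \<le> zsum (\<lambda>k. ennreal (C powr q) * epowr (ennreal (u k) * K (2 powr of_int k) f) q)"
      unfolding gamma_sum_def
    proof (rule zsum_mono)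
      fix k
      have "ennreal (u k) * G f k \<le> ennreal (u k) * (ennreal C * K (2 powr of_int k) f)"
        using C(2)[OF T_pos, of k f] unfolding G_def rho_T by (rule mult_left_mono) simp
      also have "\<dots> = ennreal C * (ennreal (u k) * K (2 powr of_int k) f)" by (simp only: mult_ac)
      finally show "epowr (ennreal (u k) * G f k) q \<le> ennreal (C powr q) * epowr (ennreal (u k) * K (2 powr of_int k) f) q"
        using C(1) q by (intro epowr_le_const_mult) auto
    qed
    then show ?thesis by (simp only: zsum_cmult K_sum_def)
  qed
  moreover have "0 < C powr q" using C(1) by simp
  ultimately show ?thesis by blast
qed

text \<open>Each piece \<open>I j\<close> contributes at most a multiple of \<open>G f (j + 1)\<close>, because \<open>a0\<close> changes only by a
  bounded factor over \<open>I j\<close>.\<close>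

lemma head_norm_le_sum:
  "\<exists>C>0. \<forall>f k. head_norm f (T k) \<le> ennreal C * epowr (zsum (\<lambda>j. if j \<le> k then epowr (G f j) q0 else 0)) (1 / q0)"
proof -
  obtain C where C: "1 \<le> C" "\<And>k. a1 (T k) \<le> C * a1 (T (k + 1))"
    using a1_T_doubling by blast
  have "head_norm f (T k) \<le> ennreal C * epowr (zsum (\<lambda>j. if j \<le> k then epowr (G f j) q0 else 0)) (1 / q0)" for f k
  proof -
    let ?X = "\<lambda>j. if j \<le> k then epowr (G f j) q0 else 0"
    have "wint q0 b0 {0<..T k} (\<lambda>t. epowr (F f t) q0)
        \<le> zsum (\<lambda>j. (if j + 1 \<le> k then epowr (F f (T (j + 1))) q0 else 0) * mass q0 b0 (I j))"
    proof (rule wint_le_zsum[OF weights(2) I_sets])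
      fix x assume x: "x \<in> {0<..T k}"
      then obtain j where j: "x \<in> I j" using I_cover[of x] by auto
      then have "T j < T k" using x by (simp add: I_def)
      then have "j + 1 \<le> k" using T_le_iff[of k j] by linarith
      then show "\<exists>j. x \<in> I j \<and> epowr (F f x) q0 \<le> (if j + 1 \<le> k then epowr (F f (T (j + 1))) q0 else 0)"
        using j exponents by (intro exI[of _ j]) (auto simp: I_def intro!: epowr_mono F_mono)
    qed
    also have "\<dots> \<le> zsum (\<lambda>j. ennreal (C powr q0) * ?X (j + 1))"
    proof (rule zsum_mono)
      fix j
      have "a0 (T j) \<le> C * a0 (T (j + 1))"
      proof -
        have "a0 (T j) \<le> 2 powr of_int j * (C * a1 (T (j + 1)))" unfolding a0_T by (intro mult_left_mono C) simp
        also have "\<dots> \<le> 2 powr of_int (j + 1) * (C * a1 (T (j + 1)))"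
          using C(1) a_pos(2)[OF T_pos, of "j + 1"] by (intro mult_right_mono) auto
        finally show ?thesis unfolding a0_T by (simp only: mult_ac)
      qed
      then have "a0 (T j) powr q0 \<le> (C * a0 (T (j + 1))) powr q0"
        using exponents a_pos(1)[OF T_pos, of j] by (intro powr_mono2) auto
      then have "mass q0 b0 (I j) \<le> ennreal (C powr q0 * a0 (T (j + 1)) powr q0)"
        using C(1) a_pos(1)[OF T_pos, of "j + 1"] by (intro order_trans[OF mass_b0_I] ennreal_leI) (simp add: powr_mult)
      then have "epowr (F f (T (j + 1))) q0 * mass q0 b0 (I j)
          \<le> epowr (F f (T (j + 1))) q0 * ennreal (C powr q0 * a0 (T (j + 1)) powr q0)"
        by (rule mult_left_mono) simp
      also have "\<dots> = ennreal (C powr q0) * epowr (G f (j + 1)) q0"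
        using exponents a_pos(1)[OF T_pos, of "j + 1"] by (simp add: G_def epowr_const_mult less_imp_le ennreal_mult mult_ac)
      finally show "(if j + 1 \<le> k then epowr (F f (T (j + 1))) q0 else 0) * mass q0 b0 (I j) \<le> ennreal (C powr q0) * ?X (j + 1)"
        by auto
    qed
    also have "\<dots> = ennreal (C powr q0) * zsum ?X"
      unfolding zsum_cmult by (simp only: zsum_shift[of ?X 1])
    finally have "head_norm f (T k) \<le> ennreal ((C powr q0) powr (1 / q0)) * epowr (zsum ?X) (1 / q0)"
      unfolding head_norm_def using exponents by (intro epowr_le_const_mult) auto
    then show ?thesis using exponents C(1) by (simp add: powr_powr)
  qed
  then show ?thesis using C(1) by (intro exI[of _ C]) auto
qed

text \<open>On the side \<open>j \<ge> k\<close> the natural weight is \<open>a1 (T j) = 2\<^bsup>- j\<^esup> a0 (T j)\<close>.\<close>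

lemma rest_norm_le_sum:
  "\<exists>C>0. \<forall>f k. rest_norm f (T k) \<le> ennreal C *
    epowr (zsum (\<lambda>j. if k \<le> j then epowr (ennreal (2 powr (- of_int j)) * G f j) q1 else 0)) (1 / q1)"
proof -
  obtain C where C: "1 \<le> C" "\<And>k. a1 (T k) \<le> C * a1 (T (k + 1))"
    using a1_T_doubling by blast
  have "rest_norm f (T k) \<le> ennreal C *
    epowr (zsum (\<lambda>j. if k \<le> j then epowr (ennreal (2 powr (- of_int j)) * G f j) q1 else 0)) (1 / q1)" for f k
  proof -
    let ?X = "\<lambda>j. if k \<le> j then epowr (ennreal (2 powr (- of_int j)) * G f j) q1 else 0"
    have "wint q1 b1 {T k<..} (\<lambda>t. epowr (F f t) q1)
        \<le> zsum (\<lambda>j. (if k \<le> j then epowr (F f (T (j + 1))) q1 else 0) * mass q1 b1 (I j))"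
    proof (rule wint_le_zsum[OF weights(3) I_sets])
      fix x assume x: "x \<in> {T k<..}"
      then obtain j where j: "x \<in> I j" using I_cover[of x] T_pos[of k] by auto
      then have "T k < T (j + 1)" using x by (simp add: I_def)
      then have "k \<le> j" using T_le_iff[of "j + 1" k] by linarith
      then show "\<exists>j. x \<in> I j \<and> epowr (F f x) q1 \<le> (if k \<le> j then epowr (F f (T (j + 1))) q1 else 0)"
        using j exponents by (intro exI[of _ j]) (auto simp: I_def intro!: epowr_mono F_mono)
    qed
    also have "\<dots> \<le> zsum (\<lambda>j. ennreal (C powr q1) * ?X (j + 1))"
    proof (rule zsum_mono)
      fix j
      have "a1 (T j) powr q1 \<le> (C * a1 (T (j + 1))) powr q1"
        using exponents C(2) a_pos(2)[OF T_pos, of j] by (intro powr_mono2) auto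
      then have "mass q1 b1 (I j) \<le> ennreal (C powr q1 * a1 (T (j + 1)) powr q1)"
        using C(1) a_pos(2)[OF T_pos, of "j + 1"] by (intro order_trans[OF mass_b1_I(1)] ennreal_leI) (simp add: powr_mult)
      then have "epowr (F f (T (j + 1))) q1 * mass q1 b1 (I j)
          \<le> epowr (F f (T (j + 1))) q1 * ennreal (C powr q1 * a1 (T (j + 1)) powr q1)"
        by (rule mult_left_mono) simp
      also have "\<dots> = ennreal (C powr q1) * epowr (ennreal (a1 (T (j + 1))) * F f (T (j + 1))) q1"
        using exponents a_pos(2)[OF T_pos, of "j + 1"] by (simp add: epowr_const_mult less_imp_le ennreal_mult mult_ac)
      also have "ennreal (a1 (T (j + 1))) * F f (T (j + 1)) = ennreal (2 powr (- of_int (j + 1))) * G f (j + 1)"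
      proof -
        have "a1 (T (j + 1)) = 2 powr (- of_int (j + 1)) * a0 (T (j + 1))"
          unfolding a0_T mult.assoc[symmetric] powr_add[symmetric] by simp
        then have "ennreal (a1 (T (j + 1))) = ennreal (2 powr (- of_int (j + 1))) * ennreal (a0 (T (j + 1)))"
          using a_pos(1)[OF T_pos, of "j + 1"] by (simp only: ennreal_mult' powr_ge_zero)
        then show ?thesis unfolding G_def by (simp only: mult.assoc)
      qed
      finally show "(if k \<le> j then epowr (F f (T (j + 1))) q1 else 0) * mass q1 b1 (I j) \<le> ennreal (C powr q1) * ?X (j + 1)"
        by auto
    qed
    also have "\<dots> = ennreal (C powr q1) * zsum ?X"
      unfolding zsum_cmult by (simp only: zsum_shift[of ?X 1])
    finally have "rest_norm f (T k) \<le> ennreal ((C powr q1) powr (1 / q1)) * epowr (zsum ?X) (1 / q1)"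
      unfolding rest_norm_def using exponents by (intro epowr_le_const_mult) auto
    then show ?thesis using exponents C(1) by (simp add: powr_powr)
  qed
  then show ?thesis using C(1) by (intro exI[of _ C]) auto
qed

text \<open>The weights \<open>u k\<close> behave like \<open>2\<^bsup>- \<theta> k\<^esup>\<close> up to a factor of arbitrarily small exponential
  growth, so \<open>u k\<close> decays and \<open>2\<^sup>k u k\<close> grows geometrically because \<open>0 < \<theta> < 1\<close>.\<close>

lemma u_decay:
  "\<exists>\<alpha>>0. \<exists>C>0. \<forall>k j. (j \<le> k \<longrightarrow> u k \<le> C * (2 powr (- \<alpha> * \<bar>of_int (k - j)\<bar>) * u j)) \<and>
    (k \<le> j \<longrightarrow> u k * 2 powr of_int k * 2 powr (- of_int j) \<le> C * (2 powr (- \<alpha> * \<bar>of_int (k - j)\<bar>) * u j))"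
proof -
  define \<alpha> where "\<alpha> = min \<theta> (1 - \<theta>) / 2"
  have \<alpha>: "0 < \<alpha>" "2 * \<alpha> \<le> \<theta>" "2 * \<alpha> \<le> 1 - \<theta>" using \<theta> by (auto simp: \<alpha>_def)
  obtain C where C: "1 \<le> C" "\<And>s t. 0 < s \<Longrightarrow> s \<le> t \<Longrightarrow> b t \<le> C * (t / s) powr \<alpha> * b s"
    "\<And>s t. 0 < s \<Longrightarrow> s \<le> t \<Longrightarrow> b s \<le> C * (t / s) powr \<alpha> * b t"
    using slowly_varying_power_bounds[OF b \<alpha>(1)] by metis
  have ratio: "((2::real) powr x / 2 powr y) powr \<alpha> = 2 powr (\<alpha> * (x - y))" for x y
    by (simp add: powr_powr mult.commute flip: powr_diff)
  have up: "u k \<le> C * (2 powr (- \<alpha> * \<bar>of_int (k - j)\<bar>) * u j)" if "j \<le> k" for k j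
  proof -
    define d where "d = real_of_int (k - j)"
    have d: "0 \<le> d" "real_of_int k = real_of_int j + d" using that by (auto simp: d_def)
    have "b (2 powr of_int k) \<le> C * 2 powr (\<alpha> * d) * b (2 powr of_int j)"
      using C(2)[of "2 powr of_int j" "2 powr of_int k"] that d by (simp add: ratio)
    then have "u k \<le> 2 powr (- \<theta> * of_int k) * (C * 2 powr (\<alpha> * d) * b (2 powr of_int j))"
      unfolding u_def powr_powr by (simp add: mult.commute mult_left_mono)
    also have "\<dots> = C * (2 powr (\<alpha> * d - \<theta> * d) * (2 powr (- \<theta> * of_int j) * b (2 powr of_int j)))"
      unfolding d(2) by (simp add: algebra_simps flip: powr_add)
    also have "2 powr (- \<theta> * of_int j) * b (2 powr of_int j) = u j"
      unfolding u_def powr_powr by (simp add: mult.commute)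
    also have "C * (2 powr (\<alpha> * d - \<theta> * d) * u j) \<le> C * (2 powr (- \<alpha> * d) * u j)"
    proof -
      have "2 * \<alpha> * d \<le> \<theta> * d" using \<alpha> d by (intro mult_right_mono) auto
      then show ?thesis using C(1) u_pos[of j] by (intro mult_left_mono mult_right_mono powr_mono) auto
    qed
    also have "d = \<bar>of_int (k - j)\<bar>" using that by (simp add: d_def)
    finally show ?thesis .
  qed
  have down: "u k * 2 powr of_int k * 2 powr (- of_int j) \<le> C * (2 powr (- \<alpha> * \<bar>of_int (k - j)\<bar>) * u j)" if "k \<le> j" for k j
  proof -
    define d where "d = real_of_int (j - k)"
    have d: "0 \<le> d" "real_of_int k = real_of_int j - d" using that by (auto simp: d_def)
    have "b (2 powr of_int k) \<le> C * 2 powr (\<alpha> * d) * b (2 powr of_int j)"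
      using C(3)[of "2 powr of_int k" "2 powr of_int j"] that d by (simp add: ratio)
    then have "u k * 2 powr of_int k * 2 powr (- of_int j)
        \<le> 2 powr (- \<theta> * of_int k) * (C * 2 powr (\<alpha> * d) * b (2 powr of_int j)) * 2 powr of_int k * 2 powr (- of_int j)"
      unfolding u_def powr_powr by (intro mult_right_mono) (simp_all add: mult.commute mult_left_mono)
    also have "\<dots> = C * (2 powr (\<alpha> * d + \<theta> * d - d) * (2 powr (- \<theta> * of_int j) * b (2 powr of_int j)))"
      unfolding d(2) by (simp add: algebra_simps flip: powr_add)
    also have "2 powr (- \<theta> * of_int j) * b (2 powr of_int j) = u j"
      unfolding u_def powr_powr by (simp add: mult.commute)
    also have "C * (2 powr (\<alpha> * d + \<theta> * d - d) * u j) \<le> C * (2 powr (- \<alpha> * d) * u j)"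
    proof -
      have "2 * \<alpha> * d \<le> (1 - \<theta>) * d" using \<alpha> d by (intro mult_right_mono) auto
      then show ?thesis using C(1) u_pos[of j]
        by (intro mult_left_mono mult_right_mono powr_mono) (auto simp: algebra_simps)
    qed
    also have "d = \<bar>of_int (k - j)\<bar>" using that by (simp add: d_def)
    finally show ?thesis .
  qed
  from up down \<alpha>(1) C(1) show ?thesis by (intro exI[of _ \<alpha>] conjI exI[of _ C]) auto
qed

text \<open>The bounds for \<open>head_norm\<close> and \<open>rest_norm\<close> are sums over \<open>j \<le> k\<close> and \<open>j \<ge> k\<close>.  By \<open>u_decay\<close>
  both are dominated, after multiplication by \<open>u k\<close>, by two-sided geometric convolutions of
  \<open>u j * G f j\<close>, with exponents \<open>q0\<close> and \<open>q1\<close>; the discrete Hardy inequality brings both back to \<open>q\<close>.\<close>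

lemma K_sum_le_gamma_sum:
  "\<exists>C>0. \<forall>f\<in>borel_measurable M. K_sum f \<le> ennreal C * gamma_sum f"
proof -
  obtain CK where CK: "0 < CK" "\<And>f t. f \<in> borel_measurable M \<Longrightarrow> 0 < t \<Longrightarrow>
      K (\<rho> t) f \<le> ennreal CK * (head_norm f t + ennreal (\<rho> t) * rest_norm f t)"
    using K_upper by blast
  obtain C0 where C0: "0 < C0"
    "\<And>f k. head_norm f (T k) \<le> ennreal C0 * epowr (zsum (\<lambda>j. if j \<le> k then epowr (G f j) q0 else 0)) (1 / q0)"
    using head_norm_le_sum by blast
  obtain C1 where C1: "0 < C1" "\<And>f k. rest_norm f (T k) \<le> ennreal C1 *
      epowr (zsum (\<lambda>j. if k \<le> j then epowr (ennreal (2 powr (- of_int j)) * G f j) q1 else 0)) (1 / q1)"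
    using rest_norm_le_sum by blast
  obtain \<alpha> Cu where \<alpha>: "0 < \<alpha>" and Cu: "0 < Cu"
    "\<And>k j. j \<le> k \<Longrightarrow> u k \<le> Cu * (2 powr (- \<alpha> * \<bar>of_int (k - j)\<bar>) * u j)"
    "\<And>k j. k \<le> j \<Longrightarrow> u k * 2 powr of_int k * 2 powr (- of_int j) \<le> Cu * (2 powr (- \<alpha> * \<bar>of_int (k - j)\<bar>) * u j)"
    using u_decay by blast
  define H where "H s X k = epowr (zsum (\<lambda>j. epowr (ennreal (2 powr (- \<alpha> * \<bar>of_int (k - j)\<bar>)) * X j) s)) (1 / s)"
    for s :: real and X :: "int \<Rightarrow> ennreal" and k :: int
  obtain D0 where D0: "0 < D0" "\<And>X. zsum (\<lambda>k. epowr (H q0 X k) q) \<le> ennreal D0 * zsum (\<lambda>j. epowr (X j) q)"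
    using discrete_hardy[OF exponents(3) q \<alpha>] unfolding H_def epowr_epowr by auto
  obtain D1 where D1: "0 < D1" "\<And>X. zsum (\<lambda>k. epowr (H q1 X k) q) \<le> ennreal D1 * zsum (\<lambda>j. epowr (X j) q)"
    using discrete_hardy[OF exponents(4) q \<alpha>] unfolding H_def epowr_epowr by auto
  define E where "E = CK * (C0 * Cu + C1 * Cu)"
  have E: "0 < E" using CK(1) C0(1) C1(1) Cu(1) by (simp add: E_def add_pos_pos)
  have scale: "ennreal c * epowr (zsum Y) (1 / s) \<le> ennreal Cu * H s X k"
    if "0 < s" "0 \<le> c" "\<And>j. ennreal (c powr s) * Y j \<le> ennreal (Cu powr s) * epowr (ennreal (2 powr (- \<alpha> * \<bar>of_int (k - j)\<bar>)) * X j) s"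
    for c s X Y k
  proof -
    have "ennreal c * epowr (zsum Y) (1 / s) = epowr (zsum (\<lambda>j. ennreal (c powr s) * Y j)) (1 / s)"
      using that by (simp add: zsum_cmult epowr_const_mult powr_powr)
    also have "\<dots> \<le> epowr (zsum (\<lambda>j. ennreal (Cu powr s) * epowr (ennreal (2 powr (- \<alpha> * \<bar>of_int (k - j)\<bar>)) * X j) s)) (1 / s)"
      using that by (intro epowr_mono zsum_mono) auto
    also have "\<dots> = ennreal Cu * H s X k"
      using that Cu(1) by (simp add: H_def zsum_cmult epowr_const_mult powr_powr)
    finally show ?thesis .
  qed
  have "K_sum f \<le> ennreal (E powr q * (2 powr q * (D0 + D1))) * gamma_sum f" if f: "f \<in> borel_measurable M" for f
  proof -
    define X where "X j = ennreal (u j) * G f j" for j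
    have entry: "epowr (ennreal (u k) * K (2 powr of_int k) f) q
        \<le> ennreal (E powr q) * (ennreal (2 powr q) * (epowr (H q0 X k) q + epowr (H q1 X k) q))" for k
    proof -
      have h: "ennreal (u k) * head_norm f (T k) \<le> ennreal (C0 * Cu) * H q0 X k"
      proof -
        let ?Y = "\<lambda>j. if j \<le> k then epowr (G f j) q0 else 0"
        have "ennreal (u k) * epowr (zsum ?Y) (1 / q0) \<le> ennreal Cu * H q0 X k"
        proof (rule scale[OF exponents(3) less_imp_le[OF u_pos]])
          fix j
          have "ennreal (u k) * G f j \<le> ennreal Cu * (ennreal (2 powr (- \<alpha> * \<bar>of_int (k - j)\<bar>)) * X j)" if "j \<le> k"
            using mult_right_mono[OF ennreal_leI[OF Cu(2)[OF that]], of "G f j"] Cu(1) u_pos[of j]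
            by (simp add: X_def ennreal_mult less_imp_le mult.assoc)
          then have "epowr (ennreal (u k) * G f j) q0
              \<le> ennreal (Cu powr q0) * epowr (ennreal (2 powr (- \<alpha> * \<bar>of_int (k - j)\<bar>)) * X j) q0" if "j \<le> k"
            using that Cu(1) exponents by (intro epowr_le_const_mult) auto
          then show "ennreal (u k powr q0) * ?Y j
              \<le> ennreal (Cu powr q0) * epowr (ennreal (2 powr (- \<alpha> * \<bar>of_int (k - j)\<bar>)) * X j) q0"
            using exponents u_pos[of k] by (simp add: epowr_const_mult less_imp_le)
        qed
        from mult_left_mono[OF this, of "ennreal C0"]
        have "ennreal (u k) * (ennreal C0 * epowr (zsum ?Y) (1 / q0)) \<le> ennreal (C0 * Cu) * H q0 X k"
          using C0(1) Cu(1) by (simp add: ennreal_mult mult_ac)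
        moreover have "ennreal (u k) * head_norm f (T k) \<le> ennreal (u k) * (ennreal C0 * epowr (zsum ?Y) (1 / q0))"
          by (intro mult_left_mono C0) simp
        ultimately show ?thesis by (rule order_trans[rotated])
      qed
      have r: "ennreal (u k) * (ennreal (2 powr of_int k) * rest_norm f (T k)) \<le> ennreal (C1 * Cu) * H q1 X k"
      proof -
        let ?Y = "\<lambda>j. if k \<le> j then epowr (ennreal (2 powr (- of_int j)) * G f j) q1 else 0"
        have c: "0 \<le> u k * 2 powr of_int k" using u_pos[of k] by simp
        have "ennreal (u k * 2 powr of_int k) * epowr (zsum ?Y) (1 / q1) \<le> ennreal Cu * H q1 X k"
        proof (rule scale[OF exponents(4) c])
          fix j
          have "ennreal (u k * 2 powr of_int k) * (ennreal (2 powr (- of_int j)) * G f j)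
              \<le> ennreal Cu * (ennreal (2 powr (- \<alpha> * \<bar>of_int (k - j)\<bar>)) * X j)" if "k \<le> j"
          proof -
            have "ennreal (u k * 2 powr of_int k) * (ennreal (2 powr (- of_int j)) * G f j)
                = ennreal (u k * 2 powr of_int k * 2 powr (- of_int j)) * G f j"
              unfolding ennreal_mult'[OF c] by (simp only: mult.assoc)
            also have "\<dots> \<le> ennreal (Cu * (2 powr (- \<alpha> * \<bar>of_int (k - j)\<bar>) * u j)) * G f j"
              by (intro mult_right_mono ennreal_leI Cu(3) that) simp
            also have "\<dots> = ennreal Cu * (ennreal (2 powr (- \<alpha> * \<bar>of_int (k - j)\<bar>)) * X j)"
              using Cu(1) u_pos[of j] by (simp add: X_def ennreal_mult less_imp_le mult.assoc)
            finally show ?thesis .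
          qed
          then have "epowr (ennreal (u k * 2 powr of_int k) * (ennreal (2 powr (- of_int j)) * G f j)) q1
              \<le> ennreal (Cu powr q1) * epowr (ennreal (2 powr (- \<alpha> * \<bar>of_int (k - j)\<bar>)) * X j) q1" if "k \<le> j"
            using that Cu(1) exponents by (intro epowr_le_const_mult) auto
          then show "ennreal ((u k * 2 powr of_int k) powr q1) * ?Y j
              \<le> ennreal (Cu powr q1) * epowr (ennreal (2 powr (- \<alpha> * \<bar>of_int (k - j)\<bar>)) * X j) q1"
            using exponents c by (simp add: epowr_const_mult)
        qed
        from mult_left_mono[OF this, of "ennreal C1"]
        have "ennreal (u k) * (ennreal (2 powr of_int k) * (ennreal C1 * epowr (zsum ?Y) (1 / q1))) \<le> ennreal (C1 * Cu) * H q1 X k"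
          using C1(1) Cu(1) u_pos[of k] by (simp add: ennreal_mult less_imp_le mult_ac)
        moreover have "ennreal (u k) * (ennreal (2 powr of_int k) * rest_norm f (T k))
            \<le> ennreal (u k) * (ennreal (2 powr of_int k) * (ennreal C1 * epowr (zsum ?Y) (1 / q1)))"
          by (intro mult_left_mono C1) auto
        ultimately show ?thesis by (rule order_trans[rotated])
      qed
      have "ennreal (u k) * K (2 powr of_int k) f
          \<le> ennreal (u k) * (ennreal CK * (head_norm f (T k) + ennreal (2 powr of_int k) * rest_norm f (T k)))"
        using CK(2)[OF f T_pos, of k] unfolding rho_T by (rule mult_left_mono) simp
      also have "\<dots> = ennreal CK * (ennreal (u k) * head_norm f (T k) + ennreal (u k) * (ennreal (2 powr of_int k) * rest_norm f (T k)))"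
        by (simp only: distrib_left mult_ac)
      also have "\<dots> \<le> ennreal CK * (ennreal (C0 * Cu) * H q0 X k + ennreal (C1 * Cu) * H q1 X k)"
        by (intro mult_left_mono add_mono h r) simp
      also have "\<dots> \<le> ennreal CK * (ennreal (C0 * Cu + C1 * Cu) * (H q0 X k + H q1 X k))"
        unfolding distrib_left using C0(1) C1(1) Cu(1)
        by (intro mult_left_mono add_mono mult_right_mono ennreal_leI) auto
      also have "\<dots> = ennreal E * (H q0 X k + H q1 X k)"
        unfolding E_def using CK(1) by (simp only: ennreal_mult' less_imp_le mult.assoc)
      finally have "epowr (ennreal (u k) * K (2 powr of_int k) f) q \<le> ennreal (E powr q) * epowr (H q0 X k + H q1 X k) q"
        using E q by (intro epowr_le_const_mult) auto
      also have "\<dots> \<le> ennreal (E powr q) * (ennreal (2 powr q) * (epowr (H q0 X k) q + epowr (H q1 X k) q))"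
        by (intro mult_left_mono epowr_add_le q) simp
      finally show ?thesis .
    qed
    have "K_sum f \<le> ennreal (E powr q) * (ennreal (2 powr q) * zsum (\<lambda>k. epowr (H q0 X k) q + epowr (H q1 X k) q))"
      unfolding K_sum_def zsum_cmult[symmetric] by (intro zsum_mono entry)
    also have "zsum (\<lambda>k. epowr (H q0 X k) q + epowr (H q1 X k) q)
        = zsum (\<lambda>k. epowr (H q0 X k) q) + zsum (\<lambda>k. epowr (H q1 X k) q)"
      by (rule nn_integral_add) auto
    also have "ennreal (E powr q) * (ennreal (2 powr q) * (zsum (\<lambda>k. epowr (H q0 X k) q) + zsum (\<lambda>k. epowr (H q1 X k) q)))
        \<le> ennreal (E powr q) * (ennreal (2 powr q) * (ennreal D0 * zsum (\<lambda>j. epowr (X j) q) + ennreal D1 * zsum (\<lambda>j. epowr (X j) q)))"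
      by (intro mult_left_mono add_mono D0 D1) auto
    also have "\<dots> = ennreal (E powr q * (2 powr q * (D0 + D1))) * gamma_sum f"
      using D0(1) D1(1) by (simp add: gamma_sum_def X_def ennreal_mult ennreal_plus distrib_right mult.assoc)
    finally show ?thesis .
  qed
  moreover have "0 < E powr q * (2 powr q * (D0 + D1))" using E D0(1) D1(1) by (simp add: add_pos_pos)
  ultimately show ?thesis by blast
qed

section \<open>The reiteration theorem\<close>

lemma reiteration_norms:
  "\<exists>C>0. \<forall>f. Gamma_norm M r q p bt w f \<le> ennreal C * interp_norm \<Gamma>0 \<Gamma>1 \<theta> q b f"
  "\<exists>C>0. \<forall>f\<in>borel_measurable M. interp_norm \<Gamma>0 \<Gamma>1 \<theta> q b f \<le> ennreal C * Gamma_norm M r q p bt w f"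
proof -
  have chain: "x \<le> ennreal (A * (B * C)) * z" if "x \<le> ennreal A * y" "y \<le> ennreal B * y'" "y' \<le> ennreal C * z"
    "0 < A" "0 < B" "0 < C" for x y y' z :: ennreal and A B C :: real
  proof -
    have "x \<le> ennreal A * (ennreal B * (ennreal C * z))"
      using that by (meson mult_left_mono order_trans zero_le)
    then show ?thesis using that by (simp add: ennreal_mult mult.assoc)
  qed
  obtain A1 A2 A3 where A: "0 < A1" "0 < A2" "0 < A3"
    "\<And>f. wint q bt {0<..} (\<lambda>t. epowr (F f t) q) \<le> ennreal A1 * gamma_sum f"
    "\<And>f. gamma_sum f \<le> ennreal A2 * K_sum f"
    "\<And>f. K_sum f \<le> ennreal A3 * wint q v {0<..} (\<lambda>t. epowr (K t f) q)"
    using gamma_tilde_le_sum gamma_sum_le_K_sum sum_le_interp by metis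
  have "Gamma_norm M r q p bt w f \<le> ennreal ((A1 * (A2 * A3)) powr (1 / q)) * interp_norm \<Gamma>0 \<Gamma>1 \<theta> q b f" for f
    unfolding Gamma_tilde_norm_eq interp_norm_eq using A(1-3) q
    by (intro epowr_le_const_mult chain[OF A(4,5,6)]) auto
  moreover have "0 < (A1 * (A2 * A3)) powr (1 / q)" using A(1-3) by simp
  ultimately show "\<exists>C>0. \<forall>f. Gamma_norm M r q p bt w f \<le> ennreal C * interp_norm \<Gamma>0 \<Gamma>1 \<theta> q b f"
    by blast
  obtain B1 B2 B3 where B: "0 < B1" "0 < B2" "0 < B3"
    "\<And>f. wint q v {0<..} (\<lambda>t. epowr (K t f) q) \<le> ennreal B1 * K_sum f"
    "\<And>f. f \<in> borel_measurable M \<Longrightarrow> K_sum f \<le> ennreal B2 * gamma_sum f"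
    "\<And>f. gamma_sum f \<le> ennreal B3 * wint q bt {0<..} (\<lambda>t. epowr (F f t) q)"
    using interp_le_sum K_sum_le_gamma_sum sum_le_gamma_tilde by metis
  have "interp_norm \<Gamma>0 \<Gamma>1 \<theta> q b f \<le> ennreal ((B1 * (B2 * B3)) powr (1 / q)) * Gamma_norm M r q p bt w f"
    if "f \<in> borel_measurable M" for f
    unfolding Gamma_tilde_norm_eq interp_norm_eq using B(1-3) q
    by (intro epowr_le_const_mult chain[OF B(4) B(5)[OF that] B(6)]) auto
  moreover have "0 < (B1 * (B2 * B3)) powr (1 / q)" using B(1-3) by simp
  ultimately show "\<exists>C>0. \<forall>f\<in>borel_measurable M. interp_norm \<Gamma>0 \<Gamma>1 \<theta> q b f \<le> ennreal C * Gamma_norm M r q p bt w f"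
    by blast
qed

text \<open>A finite interpolation quasi-norm forces a finite K-functional at \<open>1\<close>, whose infimum is then
  taken over a non-empty set of decompositions.\<close>

lemma interp_finite_imp_sum_space:
  assumes "interp_norm \<Gamma>0 \<Gamma>1 \<theta> q b f < \<infinity>"
  shows "f \<in> sum_space \<Gamma>0 \<Gamma>1"
proof -
  obtain C where C: "0 < C" "K_sum f \<le> ennreal C * wint q v {0<..} (\<lambda>t. epowr (K t f) q)"
    using sum_le_interp by blast
  have "wint q v {0<..} (\<lambda>t. epowr (K t f) q) \<noteq> top" using assms by (auto simp: interp_norm_eq)
  then have "K_sum f \<noteq> top" using C by (auto simp: ennreal_mult_eq_top_iff top_unique)
  then have "epowr (ennreal (u 0) * K (2 powr of_int 0) f) q \<noteq> top"
    using zsum_ge_term[of "\<lambda>k. epowr (ennreal (u k) * K (2 powr of_int k) f) q" 0]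
    by (auto simp: K_sum_def top_unique)
  then have "K (2 powr of_int 0) f \<noteq> top"
    using u_pos[of 0] by (auto simp: ennreal_mult_top)
  then show ?thesis by (intro K_functional_finite_imp_sum_space) (simp add: less_top[symmetric])
qed

lemma reiteration: "same_space (interp_space \<Gamma>0 \<Gamma>1 \<theta> q b) (Gamma_space M r q p bt w)"
proof -
  obtain A where A: "0 < A" "\<And>f. Gamma_norm M r q p bt w f \<le> ennreal A * interp_norm \<Gamma>0 \<Gamma>1 \<theta> q b f"
    using reiteration_norms(1) by blast
  obtain B where B: "0 < B" "\<And>f. f \<in> borel_measurable M \<Longrightarrow>
      interp_norm \<Gamma>0 \<Gamma>1 \<theta> q b f \<le> ennreal B * Gamma_norm M r q p bt w f"
    using reiteration_norms(2) by blast
  have meas: "f \<in> borel_measurable M" if "f \<in> sum_space \<Gamma>0 \<Gamma>1" for f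
    using that by (auto simp: sum_space_def plus_fun_def)
  have "points (interp_space \<Gamma>0 \<Gamma>1 \<theta> q b) = points (Gamma_space M r q p bt w)"
  proof (intro set_eqI iffI)
    fix f assume "f \<in> points (interp_space \<Gamma>0 \<Gamma>1 \<theta> q b)"
    then have f: "f \<in> sum_space \<Gamma>0 \<Gamma>1" "interp_norm \<Gamma>0 \<Gamma>1 \<theta> q b f < top"
      by (auto simp: interp_space_def)
    have "Gamma_norm M r q p bt w f < top"
      by (rule le_less_trans[OF A(2)]) (use f(2) in \<open>simp add: ennreal_mult_less_top\<close>)
    then show "f \<in> points (Gamma_space M r q p bt w)" using meas[OF f(1)] by simp
  next
    fix f assume "f \<in> points (Gamma_space M r q p bt w)"
    then have f: "f \<in> borel_measurable M" "Gamma_norm M r q p bt w f < top" by auto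
    have "interp_norm \<Gamma>0 \<Gamma>1 \<theta> q b f < top"
      by (rule le_less_trans[OF B(2)[OF f(1)]]) (use f(2) in \<open>simp add: ennreal_mult_less_top\<close>)
    then show "f \<in> points (interp_space \<Gamma>0 \<Gamma>1 \<theta> q b)"
      using interp_finite_imp_sum_space[of f] by (simp add: interp_space_def)
  qed
  moreover have "ennreal (1 / A) * qnorm (Gamma_space M r q p bt w) f \<le> qnorm (interp_space \<Gamma>0 \<Gamma>1 \<theta> q b) f
      \<and> qnorm (interp_space \<Gamma>0 \<Gamma>1 \<theta> q b) f \<le> ennreal B * qnorm (Gamma_space M r q p bt w) f"
    if "f \<in> points (interp_space \<Gamma>0 \<Gamma>1 \<theta> q b)" for f
  proof
    have "ennreal (1 / A) * Gamma_norm M r q p bt w f \<le> ennreal (1 / A) * (ennreal A * interp_norm \<Gamma>0 \<Gamma>1 \<theta> q b f)"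
      by (intro mult_left_mono A) simp
    also have "\<dots> = interp_norm \<Gamma>0 \<Gamma>1 \<theta> q b f"
      using A(1) by (simp flip: mult.assoc ennreal_mult)
    finally show "ennreal (1 / A) * qnorm (Gamma_space M r q p bt w) f \<le> qnorm (interp_space \<Gamma>0 \<Gamma>1 \<theta> q b) f"
      by (simp add: interp_space_def)
    show "qnorm (interp_space \<Gamma>0 \<Gamma>1 \<theta> q b) f \<le> ennreal B * qnorm (Gamma_space M r q p bt w) f"
      using B(2)[OF meas, of f] that by (simp add: interp_space_def)
  qed
  moreover have "0 < 1 / A" using A(1) by simp
  ultimately show ?thesis unfolding same_space_def using B(1) by blast
qed

end

theorem theorem5p5:
  fixes M :: "'a measure"
    and q0 q1 q p r \<theta> :: real
    and b0 b1 b w :: "real \<Rightarrow> real"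
  assumes "sigma_finite_measure M"
    and "0 < q0" "0 < q1" "q0 \<noteq> q1"
    and "0 < q" "0 < p" "0 < r"
    and "0 < \<theta>" "\<theta> < 1"
    and "SV0 q0 b0" "SV0 q1 b1"
    and "slowly_varying b" "slowly_varying w"
    and "\<exists>\<epsilon>>0. \<exists>h. mono_on {0<..} h \<and> equivalent_pos (rho_eps \<epsilon> q0 q1 b0 b1) h"
    and "strict_mono_on {0<..} (rho q0 q1 b0 b1)"
    and "(rho q0 q1 b0 b1 \<longlongrightarrow> 0) (at_right 0)"
    and "filterlim (rho q0 q1 b0 b1) at_top at_top"
  shows "same_space
    (interp_space (Gamma_space M r q0 p b0 w) (Gamma_space M r q1 p b1 w) \<theta> q b)
    (Gamma_space M r q p (b_tilde q0 q1 q \<theta> b0 b1 b) w)"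
proof -
  interpret gamma_reiteration M r p q0 q1 w b0 b1 q \<theta> b
    using assms by unfold_locales
  show ?thesis by (rule reiteration)
qed

end
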